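(* Let $X_{1,2,3}$ be the blowup of $\mathbb P^1\times\mathbb P^2$ in $3$ points in general position. The effective cone $\operatorname{Eff}(X_{1,2,3})\subset N^1(X_{1,2,3})$ is the convex cone generated by the classes $E_i$, $H_1-E_i$ ($1\le i\le 3$) and $H_2-E_i-E_j$ ($1\le i<j\le 3$). Equivalently, it is the set of classes $d_1H_1+d_2H_2-\sum_{i=1}^3 m_iE_i$ (with real coefficients) satisfying $$d_1\ge 0,\quad d_2\ge 0,\quad d_1+d_2\ge m_i,\quad d_1+2d_2\ge m_i+m_j,\quad d_1+2d_2\ge m_1+m_2+m_3$$ for all distinct $i,j\in\{1,2,3\}$.
   Context: Everything is over $\mathbb C$. "In general position" means: for all sets of points corresponding to the complement of some proper Zariski closed subset of the Hilbert scheme of points of $\mathbb P^1\times\mathbb P^2$ of the given length. $H_1$ and $H_2$ are the pullbacks of the hyperplane classes of $\mathbb P^1$ and $\mathbb P^2$, and $E_i$ is the exceptional divisor over the $i$-th blown-up point. $N^1(X)$ is the real vector space of Cartier divisors modulo numerical equivalence tensored with $\mathbb R$; $N^1(X_{1,2,3})$ has basis $H_1,H_2,E_1,E_2,E_3$. $\operatorname{Eff}(X)\subset N^1(X)$ is the convex cone spanned by classes of effective divisors. *)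

theory Defs
  imports
    "HOL-Analysis.Analysis"
    "HOL-Library.Poly_Mapping"
    "HOL-Computational_Algebra.Polynomial_Factorial"
begin

text \<open>
  Integral schemes with function field \<open>K\<close> are given in Chevalley's way: a separated integral
  scheme is identified with the set of its local rings (at all scheme points, closed or not),
  each a subring of \<open>K\<close>.  The generic point is \<open>K\<close> itself, and a point \<open>R\<close> lies in the closure
  of a point \<open>S\<close> iff \<open>R \<subseteq> S\<close>.
\<close>

section \<open>Subrings of a field, localization, spectra\<close>

definition is_subring :: "'k::field set \<Rightarrow> bool" where
  "is_subring A \<longleftrightarrow> 0 \<in> A \<and> 1 \<in> A \<and> (\<forall>a\<in>A. \<forall>b\<in>A. a - b \<in> A \<and> a * b \<in> A)"

definition is_ideal :: "'k::field set \<Rightarrow> 'k set \<Rightarrow> bool" where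
  "is_ideal A I \<longleftrightarrow>
     I \<subseteq> A \<and> 0 \<in> I \<and> (\<forall>a\<in>I. \<forall>b\<in>I. a + b \<in> I) \<and> (\<forall>a\<in>A. \<forall>b\<in>I. a * b \<in> I)"

definition is_prime_ideal :: "'k::field set \<Rightarrow> 'k set \<Rightarrow> bool" where
  "is_prime_ideal A P \<longleftrightarrow>
     is_ideal A P \<and> 1 \<notin> P \<and> (\<forall>a\<in>A. \<forall>b\<in>A. a * b \<in> P \<longrightarrow> a \<in> P \<or> b \<in> P)"

definition localization :: "'k::field set \<Rightarrow> 'k set \<Rightarrow> 'k set" where
  "localization A P = {a / b | a b. a \<in> A \<and> b \<in> A - P}"

definition Spec :: "'k::field set \<Rightarrow> 'k set set" where
  "Spec A = {localization A P | P. is_prime_ideal A P}"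

definition units_of_ring :: "'k::field set \<Rightarrow> 'k set" where
  "units_of_ring R = {u \<in> R. u \<noteq> 0 \<and> inverse u \<in> R}"

text \<open>The maximal ideal when \<open>R\<close> is local.\<close>
definition nonunits :: "'k::field set \<Rightarrow> 'k set" where
  "nonunits R = R - units_of_ring R"

section \<open>Blowing up closed points\<close>

text \<open>
  For a closed point with local ring \<open>R\<close> and maximal ideal \<open>m\<close>, the blowup of \<open>m\<close> is
  \<open>Proj (\<Oplus>n. m^n)\<close>; it is covered by the affine charts \<open>Spec R[m/u]\<close> with \<open>0 \<noteq> u \<in> m\<close>.  The points of these
  charts not lying over \<open>R\<close> are generizations of \<open>R\<close>, hence already points of \<open>X\<close>.
\<close>
definition blowup :: "'k::field set set \<Rightarrow> 'k set set \<Rightarrow> 'k set set" where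
  "blowup X S = (X - S) \<union>
     (\<Union>R\<in>S. \<Union>u\<in>nonunits R - {0}.
        Spec (is_subring hull (R \<union> {x / u | x. x \<in> nonunits R})))"

section \<open>Cartier divisors\<close>

text \<open>
  A Cartier divisor, i.e. a global section of \<open>K\<^sup>*/O\<^sup>*\<close>, assigns to every point \<open>R\<close> a
  coset \<open>f R\<^sup>*\<close> (the local equations), and locally a single \<open>f\<close> works.  The
  Zariski topology has the basis of open sets \<open>{R \<in> X. F \<subseteq> R}\<close>, \<open>F\<close> finite.  Outside \<open>X\<close> the value is
  \<open>{}\<close>, so that equality of functions is equality of divisors.
\<close>
type_synonym 'k divisor = "'k set \<Rightarrow> 'k set"

definition unit_coset :: "'k::field set \<Rightarrow> 'k \<Rightarrow> 'k set" where
  "unit_coset R f = (\<lambda>u. f * u) ` units_of_ring R"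

definition cartier_divisor :: "'k::field set set \<Rightarrow> 'k divisor \<Rightarrow> bool" where
  "cartier_divisor X D \<longleftrightarrow>
     (\<forall>R. R \<notin> X \<longrightarrow> D R = {}) \<and>
     (\<forall>R\<in>X. \<exists>F f. finite F \<and> F \<subseteq> R \<and> f \<noteq> 0 \<and> (\<forall>S\<in>X. F \<subseteq> S \<longrightarrow> D S = unit_coset S f))"

definition effective_divisor :: "'k::field set set \<Rightarrow> 'k divisor \<Rightarrow> bool" where
  "effective_divisor X D \<longleftrightarrow> cartier_divisor X D \<and> (\<forall>R\<in>X. D R \<subseteq> R)"

definition divisor_add :: "'k::field divisor \<Rightarrow> 'k divisor \<Rightarrow> 'k divisor" where
  "divisor_add D D' = (\<lambda>R. {f * g | f g. f \<in> D R \<and> g \<in> D' R})"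

text \<open>
  The exceptional divisor over the blown-up closed point with local ring \<open>p\<close>: the inverse image
  ideal sheaf of the maximal ideal of \<open>p\<close>.  (If \<open>p \<subseteq> R\<close> but \<open>R\<close> does not lie over \<open>p\<close>, the ideal is \<open>R\<close>.)
\<close>
definition exceptional_divisor :: "'k::field set set \<Rightarrow> 'k set \<Rightarrow> 'k divisor" where
  "exceptional_divisor X p = (\<lambda>R.
     if R \<notin> X then {}
     else if p \<subseteq> R then {g. g \<noteq> 0 \<and> (\<lambda>r. g * r) ` R = is_ideal R hull (nonunits p)}
     else units_of_ring R)"

text \<open>
  For a morphism to projective space given by homogeneous coordinates \<open>t\<close> in \<open>K\<close>: the pullback of
  the hyperplane on which the first coordinate vanishes.  On the chart where all \<open>t$l / t$k\<close> are
  regular its local equation is \<open>t$1 / t$k\<close>.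
\<close>
definition hyperplane_divisor :: "'k::field set set \<Rightarrow> 'k ^ 'n::{finite,one} \<Rightarrow> 'k divisor" where
  "hyperplane_divisor X t = (\<lambda>R.
     if R \<notin> X then {}
     else (\<Union>k\<in>{k. t $ k \<noteq> 0 \<and> (\<forall>l. t $ l / t $ k \<in> R)}. unit_coset R (t $ 1 / t $ k)))"

section \<open>The product of the projective line and the projective plane\<close>

text \<open>The function field \<open>\<complex>(s, x, y)\<close>.\<close>
type_synonym K = "complex poly poly poly fract"

definition const :: "complex \<Rightarrow> K" where
  "const c = to_fract [:[:[:c:]:]:]"

definition P1_coords :: "K ^ 2" where
  "P1_coords = vector [1, to_fract [:[:[:0, 1:]:]:]]"

definition P2_coords :: "K ^ 3" where
  "P2_coords = vector [1, to_fract [:[:0, 1:]:], to_fract [:0, 1:]]"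

definition P1xP2_chart :: "2 \<Rightarrow> 3 \<Rightarrow> K set" where
  "P1xP2_chart i j = is_subring hull
     (range const \<union> range (\<lambda>k. P1_coords $ k / P1_coords $ i)
                  \<union> range (\<lambda>k. P2_coords $ k / P2_coords $ j))"

definition P1xP2 :: "K set set" where
  "P1xP2 = (\<Union>i j. Spec (P1xP2_chart i j))"

text \<open>
  The closed point with given homogeneous coordinates (both nonzero vectors): the localization of
  any chart containing it, whence the harmless choice of \<open>i\<close> and \<open>j\<close>.
\<close>
definition closed_point :: "(complex ^ 2) \<times> (complex ^ 3) \<Rightarrow> K set" where
  "closed_point p = (let a = fst p; b = snd p; i = (SOME i. a $ i \<noteq> 0); j = (SOME j. b $ j \<noteq> 0);
       A = P1xP2_chart i j
     in localization A (is_ideal A hull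
          (range (\<lambda>k. P1_coords $ k / P1_coords $ i - const (a $ k / a $ i)) \<union>
           range (\<lambda>k. P2_coords $ k / P2_coords $ j - const (b $ k / b $ j)))))"

section \<open>Intersection numbers with curves\<close>

text \<open>Generic points of the integral curves in \<open>X\<close>: the points with one-dimensional closure.\<close>
definition curves :: "'k set set \<Rightarrow> 'k set set" where
  "curves X = {C \<in> X. (\<exists>R\<in>X. R \<subset> C) \<and> \<not> (\<exists>R\<in>X. \<exists>S\<in>X. R \<subset> S \<and> S \<subset> C)}"

text \<open>
  A normalized discrete valuation, trivial on the constants, of the function field (residue field)
  of the curve with generic point \<open>C\<close>, written as a function of representatives in the local
  ring \<open>C\<close>.  The value \<open>0\<close> off the units is a convention making equal valuations equal functions.
\<close>
definition curve_valuation :: "K set \<Rightarrow> (K \<Rightarrow> int) \<Rightarrow> bool" where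
  "curve_valuation C v \<longleftrightarrow>
     (\<forall>f. f \<notin> units_of_ring C \<longrightarrow> v f = 0) \<and>
     (\<forall>f\<in>units_of_ring C. \<forall>m\<in>nonunits C. v (f + m) = v f) \<and>
     (\<forall>f\<in>units_of_ring C. \<forall>g\<in>units_of_ring C. v (f * g) = v f + v g) \<and>
     (\<forall>f\<in>units_of_ring C. \<forall>g\<in>units_of_ring C.
        f + g \<in> units_of_ring C \<longrightarrow> min (v f) (v g) \<le> v (f + g)) \<and>
     (\<forall>c. v (const c) = 0) \<and>
     (\<exists>f\<in>units_of_ring C. v f = 1)"

text \<open>
  The closed points of the normalization of the curve, each together with its image point \<open>R\<close>
  in \<open>X\<close>: the valuation ring of \<open>v\<close> dominates the image of \<open>R\<close> in the residue field of \<open>C\<close>.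
\<close>
definition normalization_points :: "K set set \<Rightarrow> K set \<Rightarrow> (K set \<times> (K \<Rightarrow> int)) set" where
  "normalization_points X C = {(R, v). R \<in> X \<and> R \<subseteq> C \<and> curve_valuation C v \<and>
     (\<forall>f\<in>R \<inter> units_of_ring C. 0 \<le> v f) \<and>
     (\<forall>f\<in>nonunits R \<inter> units_of_ring C. 0 < v f)}"

text \<open>
  \<open>f0\<close> is a local equation of \<open>D\<close> at the generic point of the curve, so \<open>1/f0\<close> restricts to
  a nonzero rational section of \<open>O(D)\<close> on the normalized curve; this is its order at a point.
  The choice of the local equation at \<open>R\<close> does not matter.
\<close>
definition section_order :: "K divisor \<Rightarrow> K \<Rightarrow> K set \<times> (K \<Rightarrow> int) \<Rightarrow> int" where
  "section_order D f0 = (\<lambda>(R, v). v ((SOME f. f \<in> D R) / f0))"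

text \<open>
  \<open>D \<cdot> C = n\<close>: the degree of \<open>O(D)\<close> on the normalized curve, i.e. the degree of the divisor of
  a nonzero rational section.  (On a projective \<open>X\<close> it does not depend on the section.)
\<close>
definition intersection_number :: "K set set \<Rightarrow> K divisor \<Rightarrow> K set \<Rightarrow> int \<Rightarrow> bool" where
  "intersection_number X D C n \<longleftrightarrow>
     (\<exists>f0\<in>D C. finite {q \<in> normalization_points X C. section_order D f0 q \<noteq> 0} \<and>
        n = (\<Sum>q \<in> {q \<in> normalization_points X C. section_order D f0 q \<noteq> 0}. section_order D f0 q))"

definition numerically_trivial :: "K set set \<Rightarrow> K divisor \<Rightarrow> bool" where
  "numerically_trivial X D \<longleftrightarrow>
     cartier_divisor X D \<and> (\<forall>C\<in>curves X. intersection_number X D C 0)"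

section \<open>The real Neron-Severi space and the effective cone\<close>

instantiation poly_mapping :: (type, real_vector) real_vector
begin

definition scaleR_poly_mapping :: "real \<Rightarrow> ('a \<Rightarrow>\<^sub>0 'b) \<Rightarrow> ('a \<Rightarrow>\<^sub>0 'b)" where
  "scaleR_poly_mapping r p = Poly_Mapping.map (scaleR r) p"

lemma lookup_scaleR:
  "Poly_Mapping.lookup (r *\<^sub>R p) k = r *\<^sub>R Poly_Mapping.lookup (p :: 'a \<Rightarrow>\<^sub>0 'b) k"
  by (simp add: scaleR_poly_mapping_def Poly_Mapping.map.rep_eq when_def)

instance
  by standard (auto intro!: poly_mapping_eqI simp: lookup_scaleR lookup_add algebra_simps)

end

text \<open>
  \<open>N\<^sup>1(X)\<close>, the group of Cartier divisors modulo numerical equivalence tensored with \<open>\<real>\<close>, by its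
  standard presentation: formal real combinations of divisors modulo the real subspace generated by
  the relations of additivity and by the numerically trivial divisors.  Its elements
  are the cosets \<open>num_class X v\<close>; \<open>num_class X\<close> is the linear quotient map.
\<close>
abbreviation formal :: "K divisor \<Rightarrow> (K divisor \<Rightarrow>\<^sub>0 real)" where
  "formal D \<equiv> Poly_Mapping.single D 1"

definition num_relations :: "K set set \<Rightarrow> (K divisor \<Rightarrow>\<^sub>0 real) set" where
  "num_relations X = span
     ({formal (divisor_add D D') - formal D - formal D' | D D'.
         cartier_divisor X D \<and> cartier_divisor X D'} \<union>
      {formal D | D. numerically_trivial X D})"

definition num_class :: "K set set \<Rightarrow> (K divisor \<Rightarrow>\<^sub>0 real) \<Rightarrow> (K divisor \<Rightarrow>\<^sub>0 real) set" where
  "num_class X v = {w. w - v \<in> num_relations X}"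

text \<open>
  As \<open>num_class X\<close> is linear, the convex cone generated by classes \<open>num_class X g\<close>, \<open>g \<in> G\<close>, is
  the image of the convex cone generated by \<open>G\<close>.
\<close>
definition num_cone :: "K set set \<Rightarrow> (K divisor \<Rightarrow>\<^sub>0 real) set \<Rightarrow> (K divisor \<Rightarrow>\<^sub>0 real) set set" where
  "num_cone X G = num_class X ` (convex_cone hull G)"

definition Eff :: "K set set \<Rightarrow> (K divisor \<Rightarrow>\<^sub>0 real) set set" where
  "Eff X = num_cone X {formal D | D. effective_divisor X D}"

section \<open>Three points in general position\<close>

text \<open>Homogeneous coordinates of an ordered triple of points.\<close>
type_synonym triple = "3 \<Rightarrow> (complex ^ 2) \<times> (complex ^ 3)"

definition triples :: "triple set" where
  "triples = {c. \<forall>i. fst (c i) \<noteq> 0 \<and> snd (c i) \<noteq> 0}"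

definition pairwise_distinct :: "triple \<Rightarrow> bool" where
  "pairwise_distinct c \<longleftrightarrow> (\<forall>i j. i \<noteq> j \<longrightarrow>
     \<not> ((\<exists>l. fst (c i) = l *s fst (c j)) \<and> (\<exists>m. snd (c i) = m *s snd (c j))))"

inductive_set polynomials :: "(triple \<Rightarrow> complex) set" where
  "(\<lambda>c. a) \<in> polynomials"
| "(\<lambda>c. fst (c i) $ k) \<in> polynomials"
| "(\<lambda>c. snd (c i) $ k) \<in> polynomials"
| "f \<in> polynomials \<Longrightarrow> g \<in> polynomials \<Longrightarrow> (\<lambda>c. f c + g c) \<in> polynomials"
| "f \<in> polynomials \<Longrightarrow> g \<in> polynomials \<Longrightarrow> (\<lambda>c. f c * g c) \<in> polynomials"

definition multihomogeneous :: "(triple \<Rightarrow> complex) \<Rightarrow> bool" where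
  "multihomogeneous f \<longleftrightarrow> (\<exists>d e :: 3 \<Rightarrow> nat. \<forall>c l m.
     f (\<lambda>i. (l i *s fst (c i), m i *s snd (c i))) = (\<Prod>i\<in>UNIV. l i ^ d i * m i ^ e i) * f c)"

text \<open>Zariski closed subsets of \<open>(P\<^sup>1 \<times> P\<^sup>2)\<^sup>3\<close>, in homogeneous coordinates.\<close>
definition zariski_closed :: "triple set \<Rightarrow> bool" where
  "zariski_closed Z \<longleftrightarrow> (\<exists>F \<subseteq> polynomials.
     (\<forall>f\<in>F. multihomogeneous f) \<and> Z = {c \<in> triples. \<forall>f\<in>F. f c = 0})"

text \<open>
  Sets of three points form the open subscheme of the Hilbert scheme which is the quotient of the
  space of ordered triples of distinct points by the symmetric group.  Its closed subsets thus
  correspond to the permutation invariant closed sets of triples, and since all spaces involved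
  are irreducible, proper ones correspond to proper ones.
\<close>
definition holds_in_general_position :: "(triple \<Rightarrow> bool) \<Rightarrow> bool" where
  "holds_in_general_position P \<longleftrightarrow> (\<exists>Z. zariski_closed Z \<and> Z \<noteq> triples \<and>
     (\<forall>c\<in>Z. \<forall>\<sigma>. bij \<sigma> \<longrightarrow> c \<circ> \<sigma> \<in> Z) \<and>
     (\<forall>c\<in>triples - Z. pairwise_distinct c \<longrightarrow> P c))"

end

theory Submission
  imports Defs "HOL-Computational_Algebra.Field_as_Ring"
    "HOL-Computational_Algebra.Fundamental_Theorem_Algebra"
begin

text \<open>
  One inclusion is geometry of the generators: \<open>E\<^sub>i\<close> is effective, \<open>H\<^sub>1 - E\<^sub>i\<close> is the class of the strict transform of
  the fibre of the first projection through the \<open>i\<close>-th point, and \<open>H\<^sub>2 - E\<^sub>i - E\<^sub>j\<close> that of the strict transform of the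
  preimage of a line through the images of two points in the plane.

  For the other inclusion, let \<open>D\<close> be an effective divisor. The blowup \<open>X\<close> is covered by charts whose coordinate
  rings are polynomial rings: six charts of the product and three more around every exceptional divisor
  (\<open>X_cases\<close>). By unique factorization a Cartier divisor is determined by its orders along prime
  divisors (\<open>cart_unit_everywhere\<close>), and every divisor of the affine chart with coordinates \<open>s\<close>, \<open>x\<close>, \<open>y\<close> is
  principal (\<open>prescribed_orders\<close>). The prime divisors outside the affine chart are the fibre \<open>s = \<infinity>\<close>, the
  preimage of the line at infinity of the plane, and the exceptional divisors. Hence \<open>D\<close> is linearly
  equivalent to some \<open>d\<^sub>1 H\<^sub>1 + d\<^sub>2 H\<^sub>2 - \<Sum> m\<^sub>i E\<^sub>i\<close>, and it is the divisor of a polynomial \<open>F\<close> of bidegree at most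
  \<open>(d\<^sub>1, d\<^sub>2)\<close> that vanishes to order at least \<open>m\<^sub>i\<close> at the \<open>i\<close>-th point (\<open>effective_divisor_equation\<close>).
  Linearly equivalent divisors have the same numerical class, because a principal divisor is
  numerically trivial (\<open>numerically_trivial_principal\<close>).

  The inequalities come from restricting \<open>F\<close> to families of rational curves that cover the space, so that \<open>F\<close> does
  not vanish on some member: the number of zeros that the multiplicities force on the curve is at most the
  degree of \<open>d\<^sub>1 H\<^sub>1 + d\<^sub>2 H\<^sub>2\<close> on it (\<open>curve_bound\<close>). Curves of bidegree \<open>(1, 1)\<close> through one point
  give \<open>m\<^sub>i \<le> d\<^sub>1 + d\<^sub>2\<close>, and graphs of conics through the three points give \<open>\<Sum> max 0 m\<^sub>i \<le> d\<^sub>1 + 2 d\<^sub>2\<close>, which contains the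
  remaining inequalities. Through a general point passes a conic of this kind because the images of the
  three points in the plane are not collinear.

  Finally the polyhedral cone cut out by the inequalities is generated by the listed classes
  (\<open>split_multiplicities\<close>, \<open>polyhedron_subset_gens\<close>), which closes the circle of inclusions.

  The function field elements \<open>Sf\<close>, \<open>Xf\<close>, \<open>Yf\<close> are the affine coordinates \<open>s\<close>, \<open>x\<close>, \<open>y\<close>, and \<open>S3\<close>, \<open>X3\<close>, \<open>Y3\<close>
  are the corresponding variables of the abstract polynomial ring, which is mapped to the function field
  differently for every chart.
\<close>

section \<open>Subrings and localizations of a field\<close>

lemma is_subringD:
  assumes "is_subring A"
  shows "0 \<in> A" "1 \<in> A" "a \<in> A \<Longrightarrow> b \<in> A \<Longrightarrow> a - b \<in> A" "a \<in> A \<Longrightarrow> b \<in> A \<Longrightarrow> a * b \<in> A"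
    "a \<in> A \<Longrightarrow> - a \<in> A" "a \<in> A \<Longrightarrow> b \<in> A \<Longrightarrow> a + b \<in> A" "a \<in> A \<Longrightarrow> a ^ n \<in> A"
proof -
  note A = assms[unfolded is_subring_def]
  show 0: "0 \<in> A" and 1: "1 \<in> A" using A by auto
  have m: "\<And>a b. a \<in> A \<Longrightarrow> b \<in> A \<Longrightarrow> a - b \<in> A" and t: "\<And>a b. a \<in> A \<Longrightarrow> b \<in> A \<Longrightarrow> a * b \<in> A"
    using A by auto
  show "a \<in> A \<Longrightarrow> b \<in> A \<Longrightarrow> a - b \<in> A" "a \<in> A \<Longrightarrow> b \<in> A \<Longrightarrow> a * b \<in> A" using m t by auto
  have u: "- a \<in> A" if "a \<in> A" for a using m[OF 0 that] by simp
  then show "a \<in> A \<Longrightarrow> - a \<in> A" .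
  show "a \<in> A \<Longrightarrow> b \<in> A \<Longrightarrow> a + b \<in> A" using m[OF _ u, of a b] by simp
  show "a \<in> A \<Longrightarrow> a ^ n \<in> A" by (induction n) (auto intro: 1 t)
qed

lemma is_subring_sum: "is_subring A \<Longrightarrow> (\<And>i. i \<in> I \<Longrightarrow> f i \<in> A) \<Longrightarrow> sum f I \<in> A"
  by (induction I rule: infinite_finite_induct) (auto simp: is_subringD)

lemma is_subring_hull: "is_subring (is_subring hull G)"
  by (rule hull_in) (auto simp: is_subring_def)

lemma is_ideal_hull:
  assumes G: "G \<subseteq> A" and A: "is_subring A"
  shows "is_ideal A (is_ideal A hull G)"
proof -
  have AA: "is_ideal A A" using A by (auto simp: is_ideal_def is_subringD)
  have sub: "is_ideal A hull G \<subseteq> A" using hull_minimal[of G A "is_ideal A", OF G AA] .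
  show ?thesis
    unfolding is_ideal_def[of A "is_ideal A hull G"]
  proof (intro conjI sub)
    show "0 \<in> is_ideal A hull G" by (auto simp: hull_def is_ideal_def)
    show "\<forall>a\<in>is_ideal A hull G. \<forall>b\<in>is_ideal A hull G. a + b \<in> is_ideal A hull G"
      unfolding hull_def is_ideal_def by blast
    show "\<forall>a\<in>A. \<forall>b\<in>is_ideal A hull G. a * b \<in> is_ideal A hull G"
      unfolding hull_def is_ideal_def by blast
  qed
qed

definition is_local_ring :: "'k::field set \<Rightarrow> bool" where
  "is_local_ring R \<longleftrightarrow> is_subring R \<and> (\<forall>a\<in>nonunits R. \<forall>b\<in>nonunits R. a + b \<in> nonunits R)"

lemma units_iff: "u \<in> units_of_ring R \<longleftrightarrow> u \<in> R \<and> u \<noteq> 0 \<and> inverse u \<in> R"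
  by (auto simp: units_of_ring_def)

lemma units_mult: "is_subring R \<Longrightarrow> u \<in> units_of_ring R \<Longrightarrow> v \<in> units_of_ring R \<Longrightarrow> u * v \<in> units_of_ring R"
  by (auto simp: units_iff is_subringD)

lemma units_inverse: "u \<in> units_of_ring R \<Longrightarrow> inverse u \<in> units_of_ring R"
  by (auto simp: units_iff)

lemma units_divide: "is_subring R \<Longrightarrow> u \<in> units_of_ring R \<Longrightarrow> v \<in> units_of_ring R \<Longrightarrow> u / v \<in> units_of_ring R"
  by (simp add: divide_inverse units_mult units_inverse)

lemma units_1: "is_subring R \<Longrightarrow> 1 \<in> units_of_ring R"
  by (auto simp: units_iff is_subringD)

lemma units_mono: "R \<subseteq> S \<Longrightarrow> units_of_ring R \<subseteq> units_of_ring S"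
  by (auto simp: units_iff)

lemma units_power_int: "is_subring R \<Longrightarrow> u \<in> units_of_ring R \<Longrightarrow> u powi k \<in> units_of_ring R"
  by (auto simp: units_iff power_int_def is_subringD simp flip: power_inverse)

lemma units_mult_cancel: "is_subring R \<Longrightarrow> u \<in> units_of_ring R \<Longrightarrow> u * v \<in> units_of_ring R \<longleftrightarrow> v \<in> units_of_ring R"
proof
  assume R: "is_subring R" and u: "u \<in> units_of_ring R" and uv: "u * v \<in> units_of_ring R"
  have "inverse u * (u * v) = v" using u by (simp add: units_iff field_simps)
  then show "v \<in> units_of_ring R" using units_mult[OF R units_inverse[OF u] uv] by (simp only:)
qed (rule units_mult)

lemma nonunits_mult:
  assumes "is_subring R" "a \<in> R" "b \<in> nonunits R" shows "a * b \<in> nonunits R"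
proof -
  have b: "b \<in> R" "b \<notin> units_of_ring R" using assms by (auto simp: nonunits_def)
  have "a * b \<notin> units_of_ring R"
  proof
    assume u: "a * b \<in> units_of_ring R"
    then have "b \<noteq> 0" "inverse b = a * inverse (a * b)" by (auto simp: units_iff)
    then have "inverse b \<in> R" using u assms by (metis is_subringD(4) units_iff)
    with b \<open>b \<noteq> 0\<close> show False by (auto simp: units_iff)
  qed
  then show ?thesis using assms b by (auto simp: nonunits_def is_subringD)
qed

lemma local_ringD:
  assumes "is_local_ring R" shows "is_subring R"
    "a \<in> nonunits R \<Longrightarrow> b \<in> nonunits R \<Longrightarrow> a + b \<in> nonunits R"
    "a \<in> R \<Longrightarrow> b \<in> nonunits R \<Longrightarrow> a * b \<in> nonunits R"
    "a \<in> nonunits R \<Longrightarrow> b \<in> nonunits R \<Longrightarrow> a - b \<in> nonunits R"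
    "u \<in> units_of_ring R \<Longrightarrow> b \<in> nonunits R \<Longrightarrow> u + b \<in> units_of_ring R"
    "u \<in> units_of_ring R \<Longrightarrow> b \<in> nonunits R \<Longrightarrow> u - b \<in> units_of_ring R"
proof -
  show 1: "is_subring R" using assms by (auto simp: is_local_ring_def)
  show 2: "a \<in> nonunits R \<Longrightarrow> b \<in> nonunits R \<Longrightarrow> a + b \<in> nonunits R" for a b
    using assms by (auto simp: is_local_ring_def)
  show "a \<in> R \<Longrightarrow> b \<in> nonunits R \<Longrightarrow> a * b \<in> nonunits R" using nonunits_mult[OF 1] by blast
  have neg: "- b \<in> nonunits R" if "b \<in> nonunits R" for b
    using nonunits_mult[OF 1, of "-1" b] that is_subringD[OF 1] by simp
  show 3: "a \<in> nonunits R \<Longrightarrow> b \<in> nonunits R \<Longrightarrow> a - b \<in> nonunits R" for a b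
    using 2[of a "-b"] neg by simp
  show 4: "u \<in> units_of_ring R \<Longrightarrow> b \<in> nonunits R \<Longrightarrow> u + b \<in> units_of_ring R" for u b
    using 3[of "u + b" b] is_subringD[OF 1] by (auto simp: nonunits_def units_iff)
  show "u \<in> units_of_ring R \<Longrightarrow> b \<in> nonunits R \<Longrightarrow> u - b \<in> units_of_ring R"
    using 4[of u "-b"] neg by simp
qed

lemma prime_idealD:
  assumes "is_prime_ideal A P"
  shows "P \<subseteq> A" "0 \<in> P" "a \<in> P \<Longrightarrow> b \<in> P \<Longrightarrow> a + b \<in> P" "a \<in> A \<Longrightarrow> b \<in> P \<Longrightarrow> a * b \<in> P"
    "1 \<notin> P" "a \<in> A \<Longrightarrow> b \<in> A \<Longrightarrow> a * b \<in> P \<Longrightarrow> a \<in> P \<or> b \<in> P"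
  using assms unfolding is_prime_ideal_def is_ideal_def by auto

lemma localization_iff: "q \<in> localization A P \<longleftrightarrow> (\<exists>a b. q = a / b \<and> a \<in> A \<and> b \<in> A \<and> b \<notin> P)"
  by (auto simp: localization_def)

lemma localizationI: "a \<in> A \<Longrightarrow> b \<in> A \<Longrightarrow> b \<notin> P \<Longrightarrow> a / b \<in> localization A P"
  by (auto simp: localization_iff)

lemma localization_superset:
  assumes "is_subring A" "is_prime_ideal A P" shows "A \<subseteq> localization A P"
proof
  fix a assume "a \<in> A" then have "a / 1 \<in> localization A P"
    using assms by (intro localizationI) (auto simp: is_subringD prime_idealD)
  then show "a \<in> localization A P" by simp
qed

lemma units_localization:
  assumes A: "is_subring A" and P: "is_prime_ideal A P" and ab: "a \<in> A" "b \<in> A" "b \<notin> P"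
  shows "a / b \<in> units_of_ring (localization A P) \<longleftrightarrow> a \<notin> P"
proof
  have b0: "b \<noteq> 0" using P ab by (metis prime_idealD(2))
  assume u: "a / b \<in> units_of_ring (localization A P)"
  then have "a \<noteq> 0" by (auto simp: units_iff)
  from u obtain c d where cd: "inverse (a / b) = c / d" "c \<in> A" "d \<in> A" "d \<notin> P"
    by (auto simp: units_iff localization_iff)
  then have d0: "d \<noteq> 0" using P by (metis prime_idealD(2))
  have "b * d = a * c" using cd \<open>a \<noteq> 0\<close> d0 b0 by (simp add: field_simps)
  moreover have "b * d \<notin> P" using P ab cd prime_idealD(6)[OF P] by blast
  ultimately show "a \<notin> P" using prime_idealD(4)[OF P, of c a] cd by (auto simp: mult.commute)
next
  assume a: "a \<notin> P"
  then have "a \<noteq> 0" "b \<noteq> 0" using P ab by (metis prime_idealD(2))+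
  moreover have "b / a \<in> localization A P" "a / b \<in> localization A P"
    using a ab by (auto intro: localizationI)
  ultimately show "a / b \<in> units_of_ring (localization A P)" by (auto simp: units_iff)
qed

lemma nonunits_localization:
  assumes A: "is_subring A" and P: "is_prime_ideal A P"
  shows "q \<in> nonunits (localization A P) \<longleftrightarrow> (\<exists>a b. q = a / b \<and> a \<in> P \<and> b \<in> A \<and> b \<notin> P)"
proof
  assume "q \<in> nonunits (localization A P)"
  then obtain a b where "q = a / b" "a \<in> A" "b \<in> A" "b \<notin> P" "q \<notin> units_of_ring (localization A P)"
    unfolding nonunits_def localization_def by blast
  then show "\<exists>a b. q = a / b \<and> a \<in> P \<and> b \<in> A \<and> b \<notin> P"
    using units_localization[OF A P, of a b] by blast
next
  assume "\<exists>a b. q = a / b \<and> a \<in> P \<and> b \<in> A \<and> b \<notin> P"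
  then obtain a b where q: "q = a / b" "a \<in> P" "b \<in> A" "b \<notin> P" by blast
  then have "a \<in> A" using prime_idealD(1)[OF P] by blast
  then show "q \<in> nonunits (localization A P)"
    using units_localization[OF A P, of a b] q unfolding nonunits_def localization_def by blast
qed

lemma unit_localization_iff:
  assumes A: "is_subring A" and P: "is_prime_ideal A P" and a: "a \<in> A"
  shows "a \<in> units_of_ring (localization A P) \<longleftrightarrow> a \<notin> P" "a \<in> nonunits (localization A P) \<longleftrightarrow> a \<in> P"
proof -
  show 1: "a \<in> units_of_ring (localization A P) \<longleftrightarrow> a \<notin> P"
    using units_localization[OF A P a, of 1] A P by (auto simp: is_subringD prime_idealD)
  show "a \<in> nonunits (localization A P) \<longleftrightarrow> a \<in> P"
    using 1 a localization_superset[OF A P] by (auto simp: nonunits_def)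
qed

lemma localization_local:
  assumes A: "is_subring A" and P: "is_prime_ideal A P" shows "is_local_ring (localization A P)"
proof -
  have nz: "b \<noteq> 0" if "b \<notin> P" for b using that P by (metis prime_idealD(2))
  have pm: "b * d \<notin> P" if "b \<in> A" "b \<notin> P" "d \<in> A" "d \<notin> P" for b d
    using that prime_idealD(6)[OF P] by blast
  have sr: "is_subring (localization A P)"
    unfolding is_subring_def
  proof (intro conjI ballI)
    show "0 \<in> localization A P" "1 \<in> localization A P"
      using localization_superset[OF A P] A by (auto simp: is_subringD)
    fix p q assume "p \<in> localization A P" "q \<in> localization A P"
    then obtain a b c d where e: "p = a / b" "q = c / d" "a \<in> A" "b \<in> A" "b \<notin> P" "c \<in> A" "d \<in> A" "d \<notin> P"
      by (auto simp: localization_iff)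
    have "p - q = (a * d - c * b) / (b * d)" "p * q = (a * c) / (b * d)"
      using e nz by (auto simp: field_simps)
    then show "p - q \<in> localization A P" "p * q \<in> localization A P"
      using e pm A by (auto intro!: localizationI simp: is_subringD)
  qed
  moreover have "p + q \<in> nonunits (localization A P)"
    if "p \<in> nonunits (localization A P)" "q \<in> nonunits (localization A P)" for p q
  proof -
    from that obtain a b c d where e: "p = a / b" "q = c / d" "a \<in> P" "b \<in> A" "b \<notin> P" "c \<in> P" "d \<in> A" "d \<notin> P"
      unfolding nonunits_localization[OF A P] by auto
    have "p + q = (d * a + b * c) / (b * d)" using e nz by (auto simp: field_simps)
    moreover have "d * a + b * c \<in> P" using e prime_idealD[OF P] by auto
    moreover have "b * d \<in> A" "b * d \<notin> P" using e pm A by (auto simp: is_subringD)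
    ultimately show ?thesis unfolding nonunits_localization[OF A P] by blast
  qed
  ultimately show ?thesis by (auto simp: is_local_ring_def)
qed

text \<open>
  Points of the scheme give primes of every coordinate ring that they contain.
\<close>
lemma contraction_prime:
  assumes R: "is_local_ring R" and B: "is_subring B" and BR: "B \<subseteq> R"
  shows "is_prime_ideal B (B \<inter> nonunits R)"
  unfolding is_prime_ideal_def is_ideal_def
proof (intro conjI ballI impI)
  note R1 = local_ringD[OF R]
  show "B \<inter> nonunits R \<subseteq> B" by auto
  show "0 \<in> B \<inter> nonunits R" using B BR by (auto simp: nonunits_def units_iff is_subringD)
  show "a + b \<in> B \<inter> nonunits R" if "a \<in> B \<inter> nonunits R" "b \<in> B \<inter> nonunits R" for a b
    using that R1(2) B by (auto simp: is_subringD)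
  show "a * b \<in> B \<inter> nonunits R" if "a \<in> B" "b \<in> B \<inter> nonunits R" for a b
    using that R1(3) B BR by (auto simp: is_subringD)
  show "1 \<notin> B \<inter> nonunits R" using R1(1) by (auto simp: nonunits_def units_1)
  show "a \<in> B \<inter> nonunits R \<or> b \<in> B \<inter> nonunits R" if "a \<in> B" "b \<in> B" "a * b \<in> B \<inter> nonunits R" for a b
    using that BR units_mult[OF R1(1), of a b] by (auto simp: nonunits_def)
qed

lemma localization_contraction_subset:
  assumes R: "is_local_ring R" and BR: "B \<subseteq> R"
  shows "localization B (B \<inter> nonunits R) \<subseteq> R"
proof
  fix q assume "q \<in> localization B (B \<inter> nonunits R)"
  then obtain a b where e: "q = a * inverse b" "a \<in> B" "b \<in> B" "b \<notin> nonunits R"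
    by (auto simp: localization_iff divide_inverse)
  then have "b \<in> units_of_ring R" using BR by (auto simp: nonunits_def)
  then show "q \<in> R" using e BR local_ringD(1)[OF R] by (auto simp: units_iff is_subringD)
qed

lemma inverse_localization_contraction:
  assumes R: "is_local_ring R" and BR: "B \<subseteq> R"
    and b: "b \<in> localization B (B \<inter> nonunits R)" "b \<in> units_of_ring R"
  shows "inverse b \<in> localization B (B \<inter> nonunits R)"
proof -
  note R1 = local_ringD(1)[OF R]
  from b obtain c d where cd: "b = c / d" "c \<in> B" "d \<in> B" "d \<notin> nonunits R"
    by (auto simp: localization_iff)
  have d: "d \<in> units_of_ring R" using cd BR by (auto simp: nonunits_def)
  have "b * d = c" using cd d by (auto simp: units_iff)
  then have "c \<in> units_of_ring R" using units_mult[OF R1 b(2) d] by simp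
  then have "d / c \<in> localization B (B \<inter> nonunits R)"
    using cd by (intro localizationI) (auto simp: nonunits_def)
  then show ?thesis using cd by simp
qed

text \<open>
  A change of chart. A local ring of one chart that contains the coordinate ring \<open>B\<close> of a
  second chart is a localization of \<open>B\<close> as soon as the generators of the first coordinate ring are fractions
  over \<open>B\<close> with denominators invertible in the local ring: a unit of \<open>R\<close> that is such a fraction
  has a numerator outside the contracted prime, so that its inverse is such a fraction as well.
\<close>
lemma localization_transfer:
  assumes A: "is_subring (is_subring hull G)" and P: "is_prime_ideal (is_subring hull G) P"
    and R: "R = localization (is_subring hull G) P"
    and B: "is_subring B" and BR: "B \<subseteq> R" and G: "G \<subseteq> localization B (B \<inter> nonunits R)"
  shows "R = localization B (B \<inter> nonunits R)" "R \<in> Spec B"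
proof -
  have L: "is_local_ring R" using localization_local[OF A P] R by simp
  note R1 = local_ringD[OF L]
  have Q: "is_prime_ideal B (B \<inter> nonunits R)" by (rule contraction_prime[OF L B BR])
  note loc = localization_local[OF B Q]
  have AL: "is_subring hull G \<subseteq> localization B (B \<inter> nonunits R)"
    using hull_minimal[of G _ is_subring] G local_ringD(1)[OF loc] by blast
  show "R = localization B (B \<inter> nonunits R)"
  proof
    show "localization B (B \<inter> nonunits R) \<subseteq> R" by (rule localization_contraction_subset[OF L BR])
    show "R \<subseteq> localization B (B \<inter> nonunits R)"
    proof
      fix q assume "q \<in> R"
      then obtain a b where e: "q = a * inverse b" "a \<in> is_subring hull G" "b \<in> is_subring hull G" "b \<notin> P"
        by (auto simp: R localization_iff divide_inverse)
      have "b \<in> units_of_ring R" using unit_localization_iff(1)[OF A P e(3)] e R by simp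
      then have "inverse b \<in> localization B (B \<inter> nonunits R)"
        using inverse_localization_contraction[OF L BR, of b] e AL by blast
      then show "q \<in> localization B (B \<inter> nonunits R)"
        using e AL local_ringD(1)[OF loc] by (auto simp: is_subringD)
    qed
  qed
  then show "R \<in> Spec B" using Q by (auto simp: Spec_def)
qed

lemma unit_coset_eq:
  assumes "is_subring R" "u \<in> units_of_ring R"
  shows "unit_coset R (f * u) = unit_coset R f"
proof -
  have "f * v \<in> unit_coset R (f * u)" if "v \<in> units_of_ring R" for v
  proof -
    have "f * v = (f * u) * (v / u)" using assms by (auto simp: units_iff)
    then show ?thesis unfolding unit_coset_def using units_divide[OF assms(1) that assms(2)] by blast
  qed
  then show ?thesis
    using units_mult[OF assms] by (auto simp: unit_coset_def mult.assoc)
qed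

lemma unit_coset_eq_iff:
  assumes R: "is_subring R" and "f \<noteq> 0" "g \<noteq> 0"
  shows "unit_coset R f = unit_coset R g \<longleftrightarrow> f / g \<in> units_of_ring R"
proof
  assume "unit_coset R f = unit_coset R g"
  moreover have "f \<in> unit_coset R f" using units_1[OF R] by (force simp: unit_coset_def)
  ultimately obtain u where "f = g * u" "u \<in> units_of_ring R" by (auto simp: unit_coset_def)
  then show "f / g \<in> units_of_ring R" using assms by simp
next
  assume "f / g \<in> units_of_ring R"
  from unit_coset_eq[OF R this, of g] show "unit_coset R f = unit_coset R g" using assms by simp
qed

lemma unit_coset_subset_iff:
  assumes R: "is_subring R" shows "unit_coset R f \<subseteq> R \<longleftrightarrow> f \<in> R"
  using units_1[OF R] R by (force simp: unit_coset_def units_iff is_subringD)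

section \<open>Polynomials and rational functions in three variables\<close>

type_synonym poly3 = "complex poly poly poly"

definition is_ring_hom :: "('a::comm_ring_1 \<Rightarrow> 'b::comm_ring_1) \<Rightarrow> bool" where
  "is_ring_hom h \<longleftrightarrow> h 1 = 1 \<and> (\<forall>x y. h (x + y) = h x + h y) \<and> (\<forall>x y. h (x * y) = h x * h y)"

lemma ring_homD:
  assumes "is_ring_hom h"
  shows "h 1 = 1" "h (x + y) = h x + h y" "h (x * y) = h x * h y" "h 0 = 0" "h (- x) = - h x"
    "h (x - y) = h x - h y" "h (x ^ n) = h x ^ n"
proof -
  show 1: "h 1 = 1" and a: "\<And>x y. h (x + y) = h x + h y" and m: "\<And>x y. h (x * y) = h x * h y"
    using assms by (auto simp: is_ring_hom_def)
  show z: "h 0 = 0" using a[of 0 0] by simp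
  have "h x + h (- x) = 0" for x using a[of x "- x"] z by simp
  then show u: "h (- x) = - h x" for x by (metis add.inverse_unique)
  show "h (x - y) = h x - h y" using a[of x "- y"] u by simp
  show "h (x ^ n) = h x ^ n" by (induction n) (auto simp: 1 m)
qed

definition eval_hom :: "('a::comm_ring_1 \<Rightarrow> 'b::comm_ring_1) \<Rightarrow> 'b \<Rightarrow> 'a poly \<Rightarrow> 'b" where
  "eval_hom h x p = poly (map_poly h p) x"

lemma eval_hom_pCons: "is_ring_hom h \<Longrightarrow> eval_hom h x (pCons a p) = h a + x * eval_hom h x p"
  by (simp add: eval_hom_def map_poly_pCons ring_homD)

lemma eval_hom_0 [simp]: "eval_hom h x 0 = 0"
  by (simp add: eval_hom_def)

lemma is_ring_hom_eval_hom:
  assumes h: "is_ring_hom h" shows "is_ring_hom (eval_hom h x)"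
proof -
  note E = eval_hom_pCons[OF h]
  have add: "eval_hom h x (p + q) = eval_hom h x p + eval_hom h x q" for p q
    by (induction p q rule: poly_induct2) (auto simp: E ring_homD[OF h] algebra_simps)
  have sm: "eval_hom h x (smult a p) = h a * eval_hom h x p" for a p
    by (induction p) (auto simp: E ring_homD[OF h] algebra_simps)
  have "eval_hom h x (p * q) = eval_hom h x p * eval_hom h x q" for p q
    by (induction p) (auto simp: E ring_homD[OF h] algebra_simps add sm)
  moreover have "eval_hom h x 1 = 1" using E[of x 1 0] by (simp add: ring_homD[OF h] flip: one_pCons)
  ultimately show ?thesis using add by (auto simp: is_ring_hom_def)
qed

text \<open>
  A polynomial is stored as an element of \<open>\<complex>[s][x][y]\<close>, with \<open>s\<close> innermost; \<open>a\<close>, \<open>b\<close>, \<open>c\<close>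
  are substituted for \<open>s\<close>, \<open>x\<close>, \<open>y\<close>.
\<close>
definition eval3 :: "(complex \<Rightarrow> 'r::comm_ring_1) \<Rightarrow> 'r \<Rightarrow> 'r \<Rightarrow> 'r \<Rightarrow> poly3 \<Rightarrow> 'r" where
  "eval3 h a b c = eval_hom (eval_hom (eval_hom h a) b) c"

abbreviation "C3 k \<equiv> [:[:[:k::complex:]:]:]"
abbreviation "S3 \<equiv> [:[:[:0, 1::complex:]:]:]"
abbreviation "X3 \<equiv> [:[:0, 1::complex poly:]:]"
abbreviation "Y3 \<equiv> [:0, 1::complex poly poly:]"

lemma eval3_hom: "is_ring_hom h \<Longrightarrow> is_ring_hom (eval3 h a b c)"
  by (simp add: eval3_def is_ring_hom_eval_hom)

lemma eval3_gens:
  assumes h: "is_ring_hom h"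
  shows "eval3 h a b c (C3 k) = h k" "eval3 h a b c S3 = a" "eval3 h a b c X3 = b" "eval3 h a b c Y3 = c"
proof -
  note H = h is_ring_hom_eval_hom[OF h] is_ring_hom_eval_hom[OF is_ring_hom_eval_hom[OF h]]
  note E = eval_hom_pCons[OF h] eval_hom_pCons[OF H(2)] eval_hom_pCons[OF H(3)]
  note R = ring_homD[OF H(1)] ring_homD[OF H(2)] ring_homD[OF H(3)]
  show "eval3 h a b c (C3 k) = h k" "eval3 h a b c S3 = a" "eval3 h a b c X3 = b" "eval3 h a b c Y3 = c"
    unfolding eval3_def E by (simp_all add: R)
qed

text \<open>
  The ring \<open>\<complex>[s, x, y]\<close> is generated by the constants and the variables, so a property that is
  stable under sums and products is checked on these.
\<close>
lemma poly3_induct: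
  assumes C: "\<And>k. P (C3 k)" and S: "P S3" and X: "P X3" and Y: "P Y3"
    and add: "\<And>F G. P F \<Longrightarrow> P G \<Longrightarrow> P (F + G)" and mult: "\<And>F G. P F \<Longrightarrow> P G \<Longrightarrow> P (F * G)"
  shows "P (F :: poly3)"
proof -
  have 1: "P [:[:p:]:]" for p
  proof (induction p)
    case 0 then show ?case using C[of 0] by simp
  next
    case (pCons a p)
    have "[:[:pCons a p:]:] = C3 a + S3 * [:[:p:]:]" by simp
    then show ?case using add[OF C[of a] mult[OF S pCons(2)]] by simp
  qed
  have 2: "P [:p:]" for p
  proof (induction p)
    case 0 then show ?case using C[of 0] by simp
  next
    case (pCons a p)
    have "[:pCons a p:] = [:[:a:]:] + X3 * [:p:]" by simp
    then show ?case using add[OF 1[of a] mult[OF X pCons(2)]] by simp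
  qed
  show ?thesis
  proof (induction F)
    case 0 then show ?case using C[of 0] by simp
  next
    case (pCons a p)
    have "pCons a p = [:a:] + Y3 * p" by simp
    then show ?case using add[OF 2[of a] mult[OF Y pCons(2)]] by simp
  qed
qed

lemma ring_hom_const: "is_ring_hom const"
  by (auto simp: is_ring_hom_def const_def simp flip: to_fract_mult to_fract_add one_pCons)

lemma ring_hom_id: "is_ring_hom (\<lambda>z. z)"
  by (auto simp: is_ring_hom_def)

lemma const_simps [simp]: "const 0 = 0" "const 1 = 1" "const (a + b) = const a + const b"
  "const (a * b) = const a * const b" "const (a - b) = const a - const b" "const (- a) = - const a"
  by (simp_all add: ring_homD[OF ring_hom_const])

lemma const_eq_0_iff [simp]: "const a = 0 \<longleftrightarrow> a = 0"
  by (simp add: const_def)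

lemma const_inverse: "const (inverse a) = inverse (const a)"
proof (cases "a = 0")
  case False
  then have "const a * const (inverse a) = 1" by (simp flip: const_simps)
  then show ?thesis by (metis inverse_unique)
qed simp

abbreviation "Sf \<equiv> to_fract S3"
abbreviation "Xf \<equiv> to_fract X3"
abbreviation "Yf \<equiv> to_fract Y3"

lemma eval3_coords: "eval3 const Sf Xf Yf F = to_fract F"
  by (induction F rule: poly3_induct)
    (simp_all only: eval3_gens[OF ring_hom_const] ring_homD[OF eval3_hom[OF ring_hom_const]]
      to_fract_add to_fract_mult const_def[symmetric])

type_synonym point = "complex \<times> complex \<times> complex"

text \<open>
  Numerical values: an identity between rational functions is transported to the complex
  numbers, where it holds wherever all the denominators are nonzero.
\<close>
definition pval :: "point \<Rightarrow> poly3 \<Rightarrow> complex" where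
  "pval p = eval3 (\<lambda>z. z) (fst p) (fst (snd p)) (snd (snd p))"

lemma pval_poly: "pval (a, b, c) F = poly (poly (poly F [:[:c:]:]) [:b:]) a"
  by (induction F rule: poly3_induct)
    (simp_all add: pval_def eval3_gens[OF ring_hom_id] ring_homD[OF eval3_hom[OF ring_hom_id]])

lemma pval_simps [simp]:
  "pval p (F + G) = pval p F + pval p G" "pval p (F * G) = pval p F * pval p G" "pval p (F - G) = pval p F - pval p G"
  "pval p (- F) = - pval p F" "pval p 0 = 0" "pval p 1 = 1" "pval p (F ^ n) = pval p F ^ n"
  "pval p (C3 k) = k" "pval (a, b, c) S3 = a" "pval (a, b, c) X3 = b" "pval (a, b, c) Y3 = c"
  by (simp_all only: pval_def fst_conv snd_conv eval3_gens[OF ring_hom_id] ring_homD[OF eval3_hom[OF ring_hom_id]])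

lemma poly_zero_if_infinitely_many_zeros:
  fixes F :: "'a::idom poly" assumes "infinite {x. poly F x = 0}" shows "F = 0"
  using assms poly_roots_finite by blast

lemma infinite_avoid: "infinite A \<Longrightarrow> finite {x. P x} \<Longrightarrow> \<exists>x\<in>A. \<not> P x"
  using finite_subset[of A "{x. P x}"] by blast

text \<open>Values are substituted for the variables one at a time; each time only finitely many of them
  give the zero polynomial.\<close>
lemma poly3_nonzero_value:
  assumes F: "F \<noteq> 0" and inf: "infinite A" "infinite B" "infinite C"
  obtains a b c where "a \<in> A" "b \<in> B" "c \<in> C" "pval (a, b, c) F \<noteq> 0"
proof -
  have "infinite ((\<lambda>c. [:[:c:]:] :: complex poly poly) ` C)" using inf(3) by (subst finite_image_iff) (auto intro!: inj_onI)
  moreover have "finite {x. poly F x = 0}" using F by (rule poly_roots_finite)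
  ultimately obtain c where c: "c \<in> C" "poly F [:[:c:]:] \<noteq> 0"
    using infinite_avoid[of _ "\<lambda>x. poly F x = 0"] by blast
  have "infinite ((\<lambda>c. [:c:] :: complex poly) ` B)" using inf(2) by (subst finite_image_iff) (auto intro!: inj_onI)
  moreover have "finite {x. poly (poly F [:[:c:]:]) x = 0}" using c(2) by (rule poly_roots_finite)
  ultimately obtain b where b: "b \<in> B" "poly (poly F [:[:c:]:]) [:b:] \<noteq> 0"
    using infinite_avoid[of _ "\<lambda>x. poly (poly F [:[:c:]:]) x = 0"] by blast
  have "finite {x. poly (poly (poly F [:[:c:]:]) [:b:]) x = 0}" using b(2) by (rule poly_roots_finite)
  then obtain a where "a \<in> A" "poly (poly (poly F [:[:c:]:]) [:b:]) a \<noteq> 0"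
    using inf(1) infinite_avoid[of A "\<lambda>x. poly (poly (poly F [:[:c:]:]) [:b:]) x = 0"] by blast
  then show thesis using that b(1) c(1) by (simp add: pval_poly)
qed

text \<open>
  A relation rather than a function, because a rational function has a value only at the points
  where it is regular.
\<close>
definition has_value :: "point \<Rightarrow> K \<Rightarrow> complex \<Rightarrow> bool" where
  "has_value p q v \<longleftrightarrow> (\<exists>n d. pval p d \<noteq> 0 \<and> q = to_fract n / to_fract d \<and> v = pval p n / pval p d)"

lemma has_value_poly: "has_value p (to_fract F) (pval p F)"
  unfolding has_value_def by (rule exI[of _ F], rule exI[of _ 1]) simp

lemma has_value_unique:
  assumes "has_value p q v" "has_value p q w" shows "v = w"
proof -
  obtain n d where 1: "pval p d \<noteq> 0" "q = to_fract n / to_fract d" "v = pval p n / pval p d"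
    using assms(1) by (auto simp: has_value_def)
  obtain m e where 2: "pval p e \<noteq> 0" "q = to_fract m / to_fract e" "w = pval p m / pval p e"
    using assms(2) by (auto simp: has_value_def)
  have "d \<noteq> 0" "e \<noteq> 0" using 1 2 by auto
  then have "to_fract n * to_fract e = to_fract m * to_fract d" using 1 2 by (simp add: field_simps)
  then have "n * e = m * d" by (simp flip: to_fract_mult)
  then have "pval p n * pval p e = pval p m * pval p d" by (metis pval_simps(2))
  then show ?thesis unfolding 1(3) 2(3) using 1(1) 2(1) by (simp add: field_simps)
qed

lemma has_value_const: "has_value p (const k) k"
  using has_value_poly[of p "C3 k"] by (simp add: const_def)

lemma has_value_coords: "has_value (a, b, c) Sf a" "has_value (a, b, c) Xf b" "has_value (a, b, c) Yf c"
  using has_value_poly[of "(a, b, c)" S3] has_value_poly[of "(a, b, c)" X3] has_value_poly[of "(a, b, c)" Y3] by simp_all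

lemma has_value_arith:
  assumes "has_value p q v" "has_value p r w"
  shows "has_value p (q + r) (v + w)" "has_value p (q * r) (v * w)" "has_value p (q - r) (v - w)"
proof -
  obtain n d where 1: "pval p d \<noteq> 0" "q = to_fract n / to_fract d" "v = pval p n / pval p d"
    using assms(1) by (auto simp: has_value_def)
  obtain m e where 2: "pval p e \<noteq> 0" "r = to_fract m / to_fract e" "w = pval p m / pval p e"
    using assms(2) by (auto simp: has_value_def)
  have de: "d \<noteq> 0" "e \<noteq> 0" "pval p (d * e) \<noteq> 0" using 1 2 by auto
  have dz: "to_fract d \<noteq> 0" "to_fract e \<noteq> 0" using de by simp_all
  have "q + r = to_fract (n * e + m * d) / to_fract (d * e)" "q - r = to_fract (n * e - m * d) / to_fract (d * e)"
    "q * r = to_fract (n * m) / to_fract (d * e)"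
    unfolding 1(2) 2(2) add_frac_eq[OF dz] diff_frac_eq[OF dz] times_divide_times_eq
    by (simp_all only: to_fract_mult to_fract_add to_fract_diff)
  moreover have "v + w = pval p (n * e + m * d) / pval p (d * e)" "v - w = pval p (n * e - m * d) / pval p (d * e)"
    "v * w = pval p (n * m) / pval p (d * e)"
    unfolding 1(3) 2(3) add_frac_eq[OF 1(1) 2(1)] diff_frac_eq[OF 1(1) 2(1)] times_divide_times_eq
    by (simp_all only: pval_simps)
  ultimately have e: "q + r = to_fract (n * e + m * d) / to_fract (d * e)" "v + w = pval p (n * e + m * d) / pval p (d * e)"
    "q - r = to_fract (n * e - m * d) / to_fract (d * e)" "v - w = pval p (n * e - m * d) / pval p (d * e)"
    "q * r = to_fract (n * m) / to_fract (d * e)" "v * w = pval p (n * m) / pval p (d * e)" by blast+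
  have I: "has_value p (to_fract N / to_fract (d * e)) (pval p N / pval p (d * e))" for N
    unfolding has_value_def using de(3) by blast
  show "has_value p (q + r) (v + w)" "has_value p (q * r) (v * w)" "has_value p (q - r) (v - w)"
    unfolding e by (rule I)+
qed

lemma has_value_inverse:
  assumes "has_value p q v" "v \<noteq> 0" shows "has_value p (inverse q) (inverse v)"
proof -
  obtain n d where 1: "pval p d \<noteq> 0" "q = to_fract n / to_fract d" "v = pval p n / pval p d"
    using assms(1) by (auto simp: has_value_def)
  then have "pval p n \<noteq> 0" "inverse q = to_fract d / to_fract n" "inverse v = pval p d / pval p n"
    using assms(2) by auto
  then show ?thesis unfolding has_value_def by blast
qed

lemma has_value_divide: "has_value p q v \<Longrightarrow> has_value p r w \<Longrightarrow> w \<noteq> 0 \<Longrightarrow> has_value p (q / r) (v / w)"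
  by (simp add: divide_inverse has_value_inverse has_value_arith)

lemma has_value_power: "has_value p q v \<Longrightarrow> has_value p (q ^ n) (v ^ n)"
  using has_value_const[of p 1] by (induction n) (simp_all add: has_value_arith(2))

lemma has_value_powi: "has_value p q v \<Longrightarrow> v \<noteq> 0 \<Longrightarrow> has_value p (q powi n) (v powi n)"
  by (auto simp: power_int_def intro!: has_value_power has_value_inverse)

lemma has_value_eval3:
  assumes "has_value p a a'" "has_value p b b'" "has_value p c c'"
  shows "has_value p (eval3 const a b c F) (pval (a', b', c') F)"
  by (induction F rule: poly3_induct)
    (simp_all only: eval3_gens[OF ring_hom_const] ring_homD[OF eval3_hom[OF ring_hom_const]] pval_simps
      assms has_value_arith has_value_const)

text \<open>
  The local ring of the affine space with coordinates \<open>s\<close>, \<open>x\<close>, \<open>y\<close> at the closed point \<open>p\<close>.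
\<close>
definition point_ring :: "point \<Rightarrow> K set" where
  "point_ring p = {q. \<exists>v. has_value p q v}"

lemma point_ring_units: "q \<in> units_of_ring (point_ring p) \<longleftrightarrow> (\<exists>v. has_value p q v \<and> v \<noteq> 0)"
proof
  assume "q \<in> units_of_ring (point_ring p)"
  then obtain v w where v: "has_value p q v" "has_value p (inverse q) w" "q \<noteq> 0" by (auto simp: units_iff point_ring_def)
  then have "has_value p 1 (v * w)" using has_value_arith(2)[OF v(1,2)] by simp
  then have "v * w = 1" using has_value_unique[of p 1 "v * w" 1] has_value_const[of p 1] by simp
  then show "\<exists>v. has_value p q v \<and> v \<noteq> 0" using v by auto
next
  assume "\<exists>v. has_value p q v \<and> v \<noteq> 0"
  then obtain v where v: "has_value p q v" "v \<noteq> 0" by blast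
  have "q \<noteq> 0" using has_value_unique[OF v(1), of 0] v(2) has_value_const[of p 0] by auto
  then show "q \<in> units_of_ring (point_ring p)"
    using v has_value_inverse[OF v] by (auto simp: units_iff point_ring_def)
qed

lemma point_ring_nonunits: "q \<in> nonunits (point_ring p) \<longleftrightarrow> has_value p q 0"
proof
  assume q: "q \<in> nonunits (point_ring p)"
  then obtain v where v: "has_value p q v" by (auto simp: nonunits_def point_ring_def)
  then have "v = 0" using q point_ring_units[of q p] by (auto simp: nonunits_def)
  then show "has_value p q 0" using v by simp
next
  assume v: "has_value p q 0"
  then have "q \<notin> units_of_ring (point_ring p)" using has_value_unique[OF v] by (auto simp: point_ring_units)
  then show "q \<in> nonunits (point_ring p)" using v by (auto simp: nonunits_def point_ring_def)
qed

lemma point_ring_local: "is_local_ring (point_ring p)"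
proof -
  have "is_subring (point_ring p)"
    unfolding is_subring_def
  proof (intro conjI ballI)
    show "0 \<in> point_ring p" "1 \<in> point_ring p"
      using has_value_const[of p 0] has_value_const[of p 1] by (auto simp: point_ring_def)
    show "a - b \<in> point_ring p" "a * b \<in> point_ring p" if "a \<in> point_ring p" "b \<in> point_ring p" for a b
      using that has_value_arith(2,3) unfolding point_ring_def by blast+
  qed
  then show ?thesis
    unfolding is_local_ring_def using has_value_arith(1)[of p _ 0 _ 0] by (auto simp: point_ring_nonunits)
qed

section \<open>Charts with a polynomial coordinate ring\<close>

text \<open>
  An open piece of the variety whose coordinate ring is a polynomial ring in three variables,
  given by the embedding of that ring into the function field. What is used of the polynomial ring is
  unique factorization.
\<close>
locale chart =
  fixes \<phi> :: "poly3 \<Rightarrow> K"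
  assumes hom: "is_ring_hom \<phi>"
    and inj: "\<phi> F = 0 \<Longrightarrow> F = 0"
    and frac: "\<exists>n d. d \<noteq> 0 \<and> q = \<phi> n / \<phi> d"
begin

lemmas homs = ring_homD[OF hom]

lemma eq_0_iff [simp]: "\<phi> F = 0 \<longleftrightarrow> F = 0"
  using inj homs(4) by auto

lemma eq_iff [simp]: "\<phi> F = \<phi> G \<longleftrightarrow> F = G"
  using eq_0_iff[of "F - G"] homs(6)[of F G] by auto

lemma subring_range: "is_subring (range \<phi>)"
  unfolding is_subring_def using homs(1,4) by (auto simp flip: homs(3,6) intro: range_eqI[OF sym])

lemma frac_coprime: "\<exists>n d. d \<noteq> 0 \<and> coprime n d \<and> q = \<phi> n / \<phi> d"
proof -
  obtain n d where nd: "d \<noteq> 0" "q = \<phi> n / \<phi> d" using frac by blast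
  then have "gcd n d \<noteq> 0" by simp
  then obtain n' d' where e: "n = n' * gcd n d" "d = d' * gcd n d" "coprime n' d'"
    using gcd_coprime_exists by blast
  have "\<phi> n = \<phi> n' * \<phi> (gcd n d)" "\<phi> d = \<phi> d' * \<phi> (gcd n d)"
    using arg_cong[OF e(1), of \<phi>] arg_cong[OF e(2), of \<phi>] by (simp_all add: homs)
  then have "q = \<phi> n' / \<phi> d'" using nd \<open>gcd n d \<noteq> 0\<close> by simp
  moreover have "d' \<noteq> 0" using e nd by auto
  ultimately show ?thesis using e(3) by blast
qed

text \<open>
  The local ring at the generic point of the prime divisor \<open>\<pi> = 0\<close> of the chart.
\<close>
definition dvr :: "poly3 \<Rightarrow> K set" where
  "dvr \<pi> = {\<phi> n / \<phi> d | n d. \<not> \<pi> dvd d}"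

lemma dvr_localization:
  assumes "prime_elem \<pi>"
  shows "is_prime_ideal (range \<phi>) (\<phi> ` {g. \<pi> dvd g})"
    and "dvr \<pi> = localization (range \<phi>) (\<phi> ` {g. \<pi> dvd g})"
proof -
  have m: "\<phi> F \<in> \<phi> ` {g. \<pi> dvd g} \<longleftrightarrow> \<pi> dvd F" for F by (auto simp: image_iff)
  show "is_prime_ideal (range \<phi>) (\<phi> ` {g. \<pi> dvd g})"
    unfolding is_prime_ideal_def is_ideal_def
  proof (intro conjI ballI impI)
    show "0 \<in> \<phi> ` {g. \<pi> dvd g}" using m[of 0] homs(4) by simp
    show "1 \<notin> \<phi> ` {g. \<pi> dvd g}" using m[of 1] homs(1) assms by (simp add: prime_elem_def)
    show "a + b \<in> \<phi> ` {g. \<pi> dvd g}" if ab: "a \<in> \<phi> ` {g. \<pi> dvd g}" "b \<in> \<phi> ` {g. \<pi> dvd g}" for a b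
    proof -
      obtain f g where "a = \<phi> f" "b = \<phi> g" "\<pi> dvd f" "\<pi> dvd g" using ab by blast
      then show ?thesis using m[of "f + g"] by (simp add: homs)
    qed
    show "a * b \<in> \<phi> ` {g. \<pi> dvd g}" if ab: "a \<in> range \<phi>" "b \<in> \<phi> ` {g. \<pi> dvd g}" for a b
    proof -
      obtain f g where "a = \<phi> f" "b = \<phi> g" "\<pi> dvd g" using ab by blast
      then show ?thesis using m[of "f * g"] by (simp add: homs)
    qed
    show "a \<in> \<phi> ` {g. \<pi> dvd g} \<or> b \<in> \<phi> ` {g. \<pi> dvd g}"
      if ab: "a \<in> range \<phi>" "b \<in> range \<phi>" "a * b \<in> \<phi> ` {g. \<pi> dvd g}" for a b
    proof -
      obtain f g where e: "a = \<phi> f" "b = \<phi> g" using ab by blast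
      then have "\<pi> dvd f * g" using ab(3) m[of "f * g"] by (simp add: homs)
      then show ?thesis using e assms m by (auto dest: prime_elem_dvd_multD)
    qed
  qed auto
  have "q \<in> dvr \<pi> \<longleftrightarrow> q \<in> localization (range \<phi>) (\<phi> ` {g. \<pi> dvd g})" for q
  proof -
    have "q \<in> localization (range \<phi>) (\<phi> ` {g. \<pi> dvd g}) \<longleftrightarrow> (\<exists>n d. q = \<phi> n / \<phi> d \<and> \<phi> d \<notin> \<phi> ` {g. \<pi> dvd g})"
      unfolding localization_iff by blast
    then show ?thesis unfolding m by (auto simp: dvr_def)
  qed
  then show "dvr \<pi> = localization (range \<phi>) (\<phi> ` {g. \<pi> dvd g})" by blast
qed

lemma dvr_in_Spec: "prime_elem \<pi> \<Longrightarrow> dvr \<pi> \<in> Spec (range \<phi>)"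
  using dvr_localization by (auto simp: Spec_def)

lemma dvr_local: "prime_elem \<pi> \<Longrightarrow> is_local_ring (dvr \<pi>)"
  using dvr_localization[of \<pi>] localization_local[OF subring_range] by simp

lemmas dvr_subring = local_ringD(1)[OF dvr_local]

lemma range_subset_dvr: "prime_elem \<pi> \<Longrightarrow> range \<phi> \<subseteq> dvr \<pi>"
  using dvr_localization[of \<pi>] localization_superset[OF subring_range] by simp

lemma dvr_unit_iff:
  assumes "prime_elem \<pi>"
  shows "\<phi> F \<in> units_of_ring (dvr \<pi>) \<longleftrightarrow> \<not> \<pi> dvd F" "\<phi> F \<in> nonunits (dvr \<pi>) \<longleftrightarrow> \<pi> dvd F"
proof -
  have "\<phi> F \<in> \<phi> ` {g. \<pi> dvd g} \<longleftrightarrow> \<pi> dvd F" by (auto simp: image_iff)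
  then show "\<phi> F \<in> units_of_ring (dvr \<pi>) \<longleftrightarrow> \<not> \<pi> dvd F" "\<phi> F \<in> nonunits (dvr \<pi>) \<longleftrightarrow> \<pi> dvd F"
    using unit_localization_iff[OF subring_range dvr_localization(1)[OF assms], of "\<phi> F"]
      dvr_localization(2)[OF assms] by auto
qed

lemma dvr_order:
  assumes \<pi>: "prime_elem \<pi>" and q: "q \<noteq> 0"
  obtains k :: int and u where "u \<in> units_of_ring (dvr \<pi>)" "q = \<phi> \<pi> powi k * u"
proof -
  have pnz: "\<pi> \<noteq> 0" "\<not> is_unit \<pi>" using \<pi> by (auto simp: prime_elem_def)
  have dec: "\<exists>i m. n = \<pi> ^ i * m \<and> \<not> \<pi> dvd m" if "n \<noteq> 0" for n
    using multiplicity_decompose'[OF that pnz(2)] by metis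
  obtain n d where nd: "d \<noteq> 0" "q = \<phi> n / \<phi> d" using frac by blast
  then have "n \<noteq> 0" using q by (auto simp: homs)
  obtain i m where 1: "n = \<pi> ^ i * m" "\<not> \<pi> dvd m" using dec[OF \<open>n \<noteq> 0\<close>] by blast
  obtain j e where 2: "d = \<pi> ^ j * e" "\<not> \<pi> dvd e" using dec[OF nd(1)] by blast
  have "q = \<phi> \<pi> powi (int i - int j) * (\<phi> m / \<phi> e)"
    using nd pnz unfolding 1(1) 2(1) by (simp add: homs power_int_diff)
  moreover have "\<phi> m / \<phi> e \<in> units_of_ring (dvr \<pi>)"
    using dvr_unit_iff[OF \<pi>] 1 2 by (auto intro: units_divide dvr_subring \<pi>)
  ultimately show thesis using that by blast
qed

lemma dvr_valuation:
  assumes \<pi>: "prime_elem \<pi>" and "q \<noteq> 0" shows "q \<in> dvr \<pi> \<or> inverse q \<in> dvr \<pi>"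
proof -
  obtain k u where u: "u \<in> units_of_ring (dvr \<pi>)" "q = \<phi> \<pi> powi k * u" by (rule dvr_order[OF assms])
  have p: "\<phi> \<pi> \<in> dvr \<pi>" using range_subset_dvr[OF \<pi>] by blast
  note R = is_subringD[OF dvr_subring[OF \<pi>]]
  show ?thesis
  proof (cases "k \<ge> 0")
    case True
    then show ?thesis using u p R by (auto simp: power_int_def units_iff)
  next
    case False
    then have "inverse q = \<phi> \<pi> ^ nat (- k) * inverse u" using u by (simp add: power_int_def field_simps)
    then show ?thesis using u p R by (auto simp: units_iff)
  qed
qed

text \<open>
  A function without poles along prime divisors is regular on the chart: a prime factor of the
  denominator of the reduced fraction would be a pole.
\<close>
lemma in_range_if_in_dvrs:
  assumes "\<And>\<pi>. prime_elem \<pi> \<Longrightarrow> q \<in> dvr \<pi>" shows "q \<in> range \<phi>"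
proof -
  obtain n d where nd: "d \<noteq> 0" "coprime n d" "q = \<phi> n / \<phi> d" using frac_coprime by blast
  have "is_unit d"
  proof (rule ccontr)
    assume "\<not> is_unit d"
    then obtain \<pi> where \<pi>: "\<pi> dvd d" "prime \<pi>" using prime_divisor_exists nd(1) by blast
    then have pe: "prime_elem \<pi>" by simp
    obtain a b where ab: "q = \<phi> a / \<phi> b" "\<not> \<pi> dvd b" using assms[OF pe] by (auto simp: dvr_def)
    then have "b \<noteq> 0" by auto
    have "\<phi> (n * b) = \<phi> (a * d)" using nd ab \<open>b \<noteq> 0\<close> by (simp add: homs field_simps)
    then have "\<pi> dvd n * b" using \<pi> by simp
    then have "\<pi> dvd n" using ab(2) pe by (auto dest: prime_elem_dvd_multD)
    then have "is_unit \<pi>" using nd(2) \<pi>(1) coprime_common_divisor by blast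
    then show False using pe by (auto simp: prime_elem_def)
  qed
  then obtain e where "1 = d * e" by (auto simp: dvd_def)
  then have "1 = \<phi> d * \<phi> e" using homs(1,3) by metis
  then have "inverse (\<phi> d) = \<phi> e" by (metis inverse_unique)
  then have "q = \<phi> (n * e)" using nd by (simp add: homs divide_inverse)
  then show ?thesis by blast
qed

lemma prime_ideal_contains_prime:
  assumes P: "is_prime_ideal (range \<phi>) P"
  shows "F \<noteq> 0 \<Longrightarrow> \<phi> F \<in> P \<Longrightarrow> \<exists>\<pi>. prime_elem \<pi> \<and> \<pi> dvd F \<and> \<phi> \<pi> \<in> P"
proof (induction F rule: prime_divisors_induct)
  case zero then show ?case by simp
next
  case (unit x)
  then obtain e where "1 = x * e" by (auto simp: dvd_def)
  then have "\<phi> e * \<phi> x = 1" by (simp add: homs(1) mult.commute flip: homs(3))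
  moreover have "\<phi> e * \<phi> x \<in> P" using unit by (intro prime_idealD(4)[OF P]) auto
  ultimately show ?case using prime_idealD(5)[OF P] by simp
next
  case (factor p x)
  then have "\<phi> p \<in> P \<or> \<phi> x \<in> P" using prime_idealD(6)[OF P, of "\<phi> p" "\<phi> x"] by (auto simp: homs)
  then show ?case
  proof
    assume "\<phi> p \<in> P" then show ?thesis using factor by auto
  next
    assume "\<phi> x \<in> P"
    then obtain \<pi> where "prime_elem \<pi>" "\<pi> dvd x" "\<phi> \<pi> \<in> P" using factor by auto
    then show ?thesis by auto
  qed
qed

text \<open>
  A divisor on the chart is determined by its orders along prime divisors: if a prime ideal
  contained the numerator or the denominator of the reduced fraction \<open>q\<close>, then it would contain one of
  its prime factors, along which \<open>q\<close> has nonzero order.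
\<close>
lemma unit_in_localization:
  assumes P: "is_prime_ideal (range \<phi>) P" and q: "q \<noteq> 0"
    and u: "\<And>\<pi>. prime_elem \<pi> \<Longrightarrow> \<phi> \<pi> \<in> P \<Longrightarrow> q \<in> units_of_ring (dvr \<pi>)"
  shows "q \<in> units_of_ring (localization (range \<phi>) P)"
proof -
  obtain n d where nd: "d \<noteq> 0" "coprime n d" "q = \<phi> n / \<phi> d" using frac_coprime by blast
  then have n: "n \<noteq> 0" using q by (auto simp: homs)
  have div: "\<not> \<pi> dvd n \<and> \<not> \<pi> dvd d" if \<pi>: "prime_elem \<pi>" and P: "\<phi> \<pi> \<in> P" for \<pi>
  proof -
    note U = u[OF \<pi> P] and R = dvr_subring[OF \<pi>]
    have "\<phi> n = q * \<phi> d" using nd by simp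
    then have "\<phi> n \<in> units_of_ring (dvr \<pi>) \<longleftrightarrow> \<phi> d \<in> units_of_ring (dvr \<pi>)"
      using units_mult_cancel[OF R U, of "\<phi> d"] by simp
    then have e: "\<pi> dvd n \<longleftrightarrow> \<pi> dvd d" unfolding dvr_unit_iff(1)[OF \<pi>] by simp
    have "\<not> is_unit \<pi>" using \<pi> by (simp add: prime_elem_def)
    then have "\<not> (\<pi> dvd n \<and> \<pi> dvd d)" using nd(2) coprime_common_divisor[of n d \<pi>] by blast
    then show ?thesis using e by blast
  qed
  have "\<phi> n \<notin> P" using prime_ideal_contains_prime[OF P n] div by blast
  moreover have "\<phi> d \<notin> P" using prime_ideal_contains_prime[OF P nd(1)] div by blast
  ultimately show ?thesis
    unfolding nd(3) using units_localization[OF subring_range P rangeI rangeI] by simp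
qed

lemma finite_subset_almost_all_dvrs:
  assumes "finite F" obtains b where "b \<noteq> 0" "\<And>\<pi>. prime_elem \<pi> \<Longrightarrow> \<not> \<pi> dvd b \<Longrightarrow> F \<subseteq> dvr \<pi>"
proof -
  have "\<exists>b. b \<noteq> 0 \<and> (\<forall>\<pi>. prime_elem \<pi> \<longrightarrow> \<not> \<pi> dvd b \<longrightarrow> F \<subseteq> dvr \<pi>)" using assms
  proof (induction F)
    case empty show ?case by (rule exI[of _ 1]) simp
  next
    case (insert q F)
    then obtain b where b: "b \<noteq> 0" "\<forall>\<pi>. prime_elem \<pi> \<longrightarrow> \<not> \<pi> dvd b \<longrightarrow> F \<subseteq> dvr \<pi>" by blast
    obtain n d where nd: "d \<noteq> 0" "q = \<phi> n / \<phi> d" using frac by blast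
    have "insert q F \<subseteq> dvr \<pi>" if p: "prime_elem \<pi>" "\<not> \<pi> dvd b * d" for \<pi>
    proof -
      have "\<not> \<pi> dvd b" "\<not> \<pi> dvd d" using p(2) dvd_mult dvd_mult2 by blast+
      moreover from this have "q \<in> dvr \<pi>" using nd(2) by (auto simp: dvr_def)
      ultimately show ?thesis using b(2) p(1) by blast
    qed
    moreover have "b * d \<noteq> 0" using b(1) nd(1) by simp
    ultimately show ?case by blast
  qed
  then show thesis using that by blast
qed

lemma almost_all_dvrs_unit:
  assumes "q \<noteq> 0" obtains b where "b \<noteq> 0" "\<And>\<pi>. prime_elem \<pi> \<Longrightarrow> \<not> \<pi> dvd b \<Longrightarrow> q \<in> units_of_ring (dvr \<pi>)"
proof -
  have "finite {q, inverse q}" by simp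
  from finite_subset_almost_all_dvrs[OF this] obtain b
    where b: "b \<noteq> 0" "\<And>\<pi>. prime_elem \<pi> \<Longrightarrow> \<not> \<pi> dvd b \<Longrightarrow> {q, inverse q} \<subseteq> dvr \<pi>" by blast
  show thesis
  proof (rule that[OF b(1)])
    fix \<pi> assume "prime_elem \<pi>" "\<not> \<pi> dvd b"
    then have "{q, inverse q} \<subseteq> dvr \<pi>" by (rule b(2))
    then show "q \<in> units_of_ring (dvr \<pi>)" using assms by (simp add: units_iff)
  qed
qed

text \<open>
  A ring that properly contains a discrete valuation ring contains \<open>1/\<pi>\<close>, hence the whole field.
  This identifies local rings that come from different charts: an inclusion suffices.
\<close>
lemma dvr_maximal:
  assumes \<pi>: "prime_elem \<pi>" and sub: "dvr \<pi> \<subseteq> V" and V: "is_subring V" "V \<noteq> UNIV"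
  shows "V = dvr \<pi>"
proof (rule ccontr)
  assume "V \<noteq> dvr \<pi>"
  then obtain q where q: "q \<in> V" "q \<notin> dvr \<pi>" using sub by blast
  note R = is_subringD[OF dvr_subring[OF \<pi>]] and RV = is_subringD[OF V(1)]
  have p: "\<phi> \<pi> \<in> dvr \<pi>" "\<phi> \<pi> \<noteq> 0" using range_subset_dvr[OF \<pi>] \<pi> by (auto simp: prime_elem_def)
  have q0: "q \<noteq> 0" using q R(1) by auto
  obtain k u where u: "u \<in> units_of_ring (dvr \<pi>)" "q = \<phi> \<pi> powi k * u" by (rule dvr_order[OF \<pi> q0])
  have k: "k < 0"
  proof (rule ccontr)
    assume "\<not> k < 0"
    then have "q = \<phi> \<pi> ^ nat k * u" using u(2) by (simp add: power_int_def)
    then have "q \<in> dvr \<pi>" using u(1) p(1) R(4,7) by (simp add: units_iff)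
    then show False using q(2) by simp
  qed
  have "q * (inverse u * \<phi> \<pi> ^ nat (- k - 1)) = \<phi> \<pi> powi k * \<phi> \<pi> powi (- k - 1)"
    using u k p by (simp add: power_int_def units_iff)
  also have "\<dots> = \<phi> \<pi> powi (- 1)" using p by (simp flip: power_int_add)
  finally have "q * (inverse u * \<phi> \<pi> ^ nat (- k - 1)) = inverse (\<phi> \<pi>)" by simp
  moreover have "inverse u * \<phi> \<pi> ^ nat (- k - 1) \<in> V"
    using u(1) p(1) sub R(4,7) by (auto simp: units_iff)
  ultimately have ip: "inverse (\<phi> \<pi>) \<in> V" using RV(4)[OF q(1)] by metis
  have "r \<in> V" for r
  proof (cases "r = 0")
    case False
    obtain j v where v: "v \<in> units_of_ring (dvr \<pi>)" "r = \<phi> \<pi> powi j * v" by (rule dvr_order[OF \<pi> False])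
    have "\<phi> \<pi> powi j \<in> V" using ip p(1) sub RV(7) by (auto simp: power_int_def)
    moreover have "v \<in> V" using v(1) sub by (auto simp: units_iff)
    ultimately show ?thesis unfolding v(2) by (rule RV(4))
  qed (simp add: RV(1))
  then show False using V(2) by blast
qed

lemma dvr_normalize: "dvr (normalize \<pi>) = dvr \<pi>"
  by (simp add: dvr_def)

text \<open>
  Every divisor of the chart is principal. The local equations are units away from the prime
  factors of \<open>b\<close>, so the product over these finitely many primes of their powers with the right exponents
  has the right order everywhere.
\<close>
lemma prescribed_orders:
  fixes g :: "K set \<Rightarrow> K"
  assumes g: "\<And>\<pi>. prime_elem \<pi> \<Longrightarrow> g (dvr \<pi>) \<noteq> 0" and b: "b \<noteq> 0"
    and gb: "\<And>\<pi>. prime_elem \<pi> \<Longrightarrow> \<not> \<pi> dvd b \<Longrightarrow> g (dvr \<pi>) \<in> units_of_ring (dvr \<pi>)"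
  obtains f where "f \<noteq> 0" "\<And>\<pi>. prime_elem \<pi> \<Longrightarrow> g (dvr \<pi>) / f \<in> units_of_ring (dvr \<pi>)"
proof -
  have "\<exists>f. f \<noteq> 0 \<and> (\<forall>\<pi>\<in>T. g (dvr \<pi>) / f \<in> units_of_ring (dvr \<pi>)) \<and>
      (\<forall>\<pi>. prime \<pi> \<and> \<pi> \<notin> T \<longrightarrow> f \<in> units_of_ring (dvr \<pi>))"
    if "finite T" "\<forall>\<pi>\<in>T. prime \<pi>" for T :: "poly3 set"
    using that
  proof (induction T)
    case empty
    have "1 \<in> units_of_ring (dvr \<pi>)" if "prime \<pi>" for \<pi>
      using that by (intro units_1 dvr_subring) simp
    then show ?case by (intro exI[of _ 1]) simp
  next
    case (insert p T)
    have "\<forall>\<pi>\<in>T. prime \<pi>" using insert.prems by simp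
    from insert.IH[OF this] obtain f where f: "f \<noteq> 0" "\<forall>\<pi>\<in>T. g (dvr \<pi>) / f \<in> units_of_ring (dvr \<pi>)"
      "\<forall>\<pi>. prime \<pi> \<and> \<pi> \<notin> T \<longrightarrow> f \<in> units_of_ring (dvr \<pi>)" by (elim exE conjE)
    have p: "prime p" using insert.prems by simp
    then have p': "prime_elem p" by simp
    note p = p p'
    have p0: "\<phi> p \<noteq> 0" using p(1) by auto
    obtain k u where u: "u \<in> units_of_ring (dvr p)" "g (dvr p) / f = \<phi> p powi k * u"
      by (rule dvr_order[OF p(2), of "g (dvr p) / f"]) (use g[OF p(2)] f(1) in auto)
    have pu: "\<phi> p powi k \<in> units_of_ring (dvr \<pi>)" if \<pi>: "prime \<pi>" "\<pi> \<noteq> p" for \<pi>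
    proof -
      have "\<not> \<pi> dvd p" using \<pi> p(1) primes_dvd_imp_eq by blast
      moreover have "prime_elem \<pi>" using \<pi> by simp
      ultimately show ?thesis using dvr_unit_iff(1)[of \<pi> p] by (intro units_power_int dvr_subring) simp_all
    qed
    have 1: "g (dvr \<pi>) / (f * \<phi> p powi k) \<in> units_of_ring (dvr \<pi>)" if \<pi>: "\<pi> \<in> insert p T" for \<pi>
    proof (cases "\<pi> = p")
      case True
      have "g (dvr p) / (f * \<phi> p powi k) = (g (dvr p) / f) / \<phi> p powi k" by simp
      also have "\<dots> = u" unfolding u(2) using p0 by simp
      finally show ?thesis using u(1) True by simp
    next
      case False
      then have t: "\<pi> \<in> T" "prime \<pi>" using \<pi> insert.prems by simp_all
      then have t3: "prime_elem \<pi>" by simp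
      have "(g (dvr \<pi>) / f) / \<phi> p powi k \<in> units_of_ring (dvr \<pi>)"
        by (rule units_divide[OF dvr_subring[OF t3] bspec[OF f(2) t(1)] pu[OF t(2) False]])
      then show ?thesis by simp
    qed
    have 2: "f * \<phi> p powi k \<in> units_of_ring (dvr \<pi>)" if \<pi>: "prime \<pi>" "\<pi> \<notin> insert p T" for \<pi>
      using f(3) pu[of \<pi>] \<pi> by (intro units_mult dvr_subring) simp_all
    have "f * \<phi> p powi k \<noteq> 0" using f(1) p0 by simp
    then show ?case using 1 2 by blast
  qed
  from this[of "prime_factors b"] obtain f where f: "f \<noteq> 0"
    "\<forall>\<pi>\<in>prime_factors b. g (dvr \<pi>) / f \<in> units_of_ring (dvr \<pi>)"
    "\<forall>\<pi>. prime \<pi> \<and> \<pi> \<notin> prime_factors b \<longrightarrow> f \<in> units_of_ring (dvr \<pi>)"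
    by (metis (lifting) finite_set_mset in_prime_factors_imp_prime)
  have "g (dvr \<pi>) / f \<in> units_of_ring (dvr \<pi>)" if \<pi>: "prime_elem \<pi>" for \<pi>
  proof (cases "\<pi> dvd b")
    case True
    then have "normalize \<pi> \<in> prime_factors b" using \<pi> b by (simp add: in_prime_factors_iff)
    then show ?thesis using bspec[OF f(2), of "normalize \<pi>"] by (simp add: dvr_normalize)
  next
    case False
    then have "normalize \<pi> \<notin> prime_factors b" by (auto simp: in_prime_factors_iff)
    moreover have "prime (normalize \<pi>)" using \<pi> by simp
    ultimately have "f \<in> units_of_ring (dvr (normalize \<pi>))" using f(3) by blast
    then show ?thesis using gb[OF \<pi> False] dvr_subring[OF \<pi>] by (intro units_divide) (simp_all add: dvr_normalize)
  qed
  then show thesis by (rule that[OF f(1)])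
qed

end

lemma prime_elem_var_poly: "prime_elem [:0, 1 :: 'a::idom:]"
  unfolding prime_elem_def dvd_iff_poly_eq_0 by (auto simp: is_unit_poly_iff)

lemma prime_elem_vars: "prime_elem S3" "prime_elem X3" "prime_elem Y3"
  by (intro lift_prime_elem_poly prime_elem_var_poly)+

lemma not_dvd_vars:
  "\<not> S3 dvd X3" "\<not> S3 dvd Y3" "\<not> X3 dvd S3" "\<not> X3 dvd Y3" "\<not> Y3 dvd S3" "\<not> Y3 dvd X3"
proof -
  have D: "\<not> F dvd G" if "pval p F = 0" "pval p G \<noteq> 0" for p F G
  proof
    assume "F dvd G"
    then obtain H where "G = F * H" by (rule dvdE)
    then show False using that by simp
  qed
  show "\<not> S3 dvd X3" by (rule D[of "(0, 1, 1)"]) (simp_all only: pval_simps one_neq_zero not_False_eq_True)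
  show "\<not> S3 dvd Y3" by (rule D[of "(0, 1, 1)"]) (simp_all only: pval_simps one_neq_zero not_False_eq_True)
  show "\<not> X3 dvd S3" by (rule D[of "(1, 0, 1)"]) (simp_all only: pval_simps one_neq_zero not_False_eq_True)
  show "\<not> X3 dvd Y3" by (rule D[of "(1, 0, 1)"]) (simp_all only: pval_simps one_neq_zero not_False_eq_True)
  show "\<not> Y3 dvd S3" by (rule D[of "(1, 1, 0)"]) (simp_all only: pval_simps one_neq_zero not_False_eq_True)
  show "\<not> Y3 dvd X3" by (rule D[of "(1, 1, 0)"]) (simp_all only: pval_simps one_neq_zero not_False_eq_True)
qed

lemma prime_elem_dvd_prime_elem:
  fixes p q :: "'a::{factorial_semiring}"
  assumes "prime_elem p" "prime_elem q" "p dvd q" shows "q dvd p"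
  using prime_elem_associated[OF assms(2,1,3)] by (rule associatedD2)

lemma range_eval3_eq_hull:
  "range (eval3 const a b c) = is_subring hull (range const \<union> {a, b, c})" (is "?R = ?H")
proof
  note h = ring_hom_const
  show "?R \<subseteq> ?H"
  proof
    fix q assume "q \<in> ?R"
    then obtain F where "q = eval3 const a b c F" by blast
    moreover have "eval3 const a b c F \<in> ?H"
      by (induction F rule: poly3_induct)
        (auto simp: eval3_gens[OF h] ring_homD[OF eval3_hom[OF h]] intro: hull_inc is_subringD is_subring_hull)
    ultimately show "q \<in> ?H" by simp
  qed
  have "is_subring ?R"
    unfolding is_subring_def using ring_homD(1,4)[OF eval3_hom[OF h, of a b c]]
    by (auto simp flip: ring_homD[OF eval3_hom[OF h]])
  moreover have "range const \<union> {a, b, c} \<subseteq> ?R"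
    using eval3_gens[OF h, of a b c] by (auto intro: range_eqI[OF sym])
  ultimately show "?H \<subseteq> ?R" by (intro hull_minimal)
qed

text \<open>
  Three functions that take all triples of nonzero complex values together are algebraically
  independent, because a polynomial vanishing at all such triples is zero.
\<close>
lemma chart_eval3I:
  assumes val: "\<And>a' b' c'. a' \<noteq> 0 \<Longrightarrow> b' \<noteq> 0 \<Longrightarrow> c' \<noteq> 0 \<Longrightarrow> \<exists>p. has_value p a a' \<and> has_value p b b' \<and> has_value p c c'"
    and gen: "\<And>L. is_subring L \<Longrightarrow> (\<And>q. q \<in> L \<Longrightarrow> inverse q \<in> L) \<Longrightarrow> range const \<subseteq> L \<Longrightarrow>
       a \<in> L \<Longrightarrow> b \<in> L \<Longrightarrow> c \<in> L \<Longrightarrow> Sf \<in> L \<and> Xf \<in> L \<and> Yf \<in> L"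
  shows "chart (eval3 const a b c)"
proof
  let ?\<phi> = "eval3 const a b c"
  show h: "is_ring_hom ?\<phi>" by (rule eval3_hom[OF ring_hom_const])
  note H = ring_homD[OF h]
  show z: "F = 0" if "?\<phi> F = 0" for F
  proof (rule ccontr)
    assume "F \<noteq> 0"
    have inf: "infinite (UNIV - {0 :: complex})" by (simp add: infinite_UNIV_char_0)
    obtain a' b' c' where abc: "a' \<in> UNIV - {0}" "b' \<in> UNIV - {0}" "c' \<in> UNIV - {0}" "pval (a', b', c') F \<noteq> 0"
      by (rule poly3_nonzero_value[OF \<open>F \<noteq> 0\<close> inf inf inf])
    then obtain p where "has_value p a a'" "has_value p b b'" "has_value p c c'" using val by blast
    then have "has_value p (?\<phi> F) (pval (a', b', c') F)" by (rule has_value_eval3)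
    then show False using that abc(4) has_value_unique has_value_const[of p 0] by fastforce
  qed
  let ?L = "{?\<phi> n / ?\<phi> d | n d. d \<noteq> 0}"
  have nz: "?\<phi> d \<noteq> 0" if "d \<noteq> 0" for d using z that by blast
  have LI: "?\<phi> n / ?\<phi> d \<in> ?L" if "d \<noteq> 0" for n d using that by blast
  have L: "is_subring ?L" unfolding is_subring_def
  proof (intro conjI ballI)
    show "0 \<in> ?L" "1 \<in> ?L" using LI[of 1 0] LI[of 1 1] by (simp_all add: H)
    fix q r assume "q \<in> ?L" "r \<in> ?L"
    then obtain n d m e where e: "q = ?\<phi> n / ?\<phi> d" "d \<noteq> 0" "r = ?\<phi> m / ?\<phi> e" "e \<noteq> 0" by blast
    have "q - r = ?\<phi> (n * e - m * d) / ?\<phi> (d * e)" "q * r = ?\<phi> (n * m) / ?\<phi> (d * e)"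
      unfolding e(1,3) using nz[OF e(2)] nz[OF e(4)] by (simp_all add: H field_simps)
    then show "q - r \<in> ?L" "q * r \<in> ?L" using LI[of "d * e"] e by simp_all
  qed
  have inv: "inverse q \<in> ?L" if q: "q \<in> ?L" for q
  proof -
    obtain n d where e: "q = ?\<phi> n / ?\<phi> d" "d \<noteq> 0" using q by blast
    show ?thesis
    proof (cases "n = 0")
      case True
      then have "inverse q = 0" unfolding e(1) by (simp add: H(4))
      show ?thesis unfolding \<open>inverse q = 0\<close> by (rule is_subringD(1)[OF L])
    next
      case False then show ?thesis using LI[OF False, of d] e by simp
    qed
  qed
  have base: "?\<phi> n \<in> ?L" for n using LI[of 1 n] by (simp add: H)
  have "range const \<subseteq> ?L" "a \<in> ?L" "b \<in> ?L" "c \<in> ?L"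
    using base[of "C3 _"] base[of S3] base[of X3] base[of Y3] unfolding eval3_gens[OF ring_hom_const] by auto
  note g = gen[OF L inv this]
  have "to_fract F \<in> ?L" for F
  proof (induction F rule: poly3_induct)
    case (1 k)
    have "to_fract (C3 k) = ?\<phi> (C3 k)" by (simp only: eval3_gens[OF ring_hom_const] const_def)
    then show ?case using base[of "C3 k"] by (simp only:)
  next
    case (5 F G)
    then show ?case unfolding to_fract_add by (rule is_subringD(6)[OF L])
  next
    case (6 F G)
    then show ?case unfolding to_fract_mult by (rule is_subringD(4)[OF L])
  qed (use g in blast)+
  note tf = this

  fix q :: K
  obtain n d where "q = to_fract n * inverse (to_fract d)"
    by (cases q) (simp add: Fract_conv_to_fract divide_inverse)
  then have "q \<in> ?L" using tf inv is_subringD(4)[OF L] by simp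
  then show "\<exists>n d. d \<noteq> 0 \<and> q = ?\<phi> n / ?\<phi> d" by blast
qed

section \<open>The charts of the product, and coordinates centred at a point\<close>

definition t1 :: "2 \<Rightarrow> K" where "t1 i = P1_coords $ i"
definition t2 :: "3 \<Rightarrow> K" where "t2 j = P2_coords $ j"

lemma t1_simps: "t1 1 = 1" "t1 2 = Sf" by (simp_all add: t1_def P1_coords_def)
lemma t2_simps: "t2 1 = 1" "t2 2 = Xf" "t2 3 = Yf" by (simp_all add: t2_def P2_coords_def)
lemma t1_nz: "t1 i \<noteq> 0" using exhaust_2[of i] by (auto simp: t1_simps)
lemma t2_nz: "t2 j \<noteq> 0" using exhaust_3[of j] by (auto simp: t2_simps)

definition affine_coord1 :: "2 \<Rightarrow> K" where "affine_coord1 i = (if i = 1 then Sf else inverse Sf)"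
definition affine_coord2 :: "3 \<Rightarrow> K" where
  "affine_coord2 j = (if j = 1 then Xf else if j = 2 then inverse Xf else inverse Yf)"
definition affine_coord3 :: "3 \<Rightarrow> K" where
  "affine_coord3 j = (if j = 1 then Yf else if j = 2 then Yf / Xf else Xf / Yf)"

text \<open>
  The coordinates of a chart of the product are those quotients of homogeneous coordinates that
  differ from \<open>1\<close>; the divisors at infinity are \<open>S3 = 0\<close> and \<open>X3 = 0\<close> in the charts that meet them.
\<close>
definition prod_chart :: "2 \<Rightarrow> 3 \<Rightarrow> poly3 \<Rightarrow> K" where
  "prod_chart i j = eval3 const (affine_coord1 i) (affine_coord2 j) (affine_coord3 j)"

lemma three_ne: "(1::3) \<noteq> 2" "(1::3) \<noteq> 3" "(2::3) \<noteq> 3" "(2::3) \<noteq> 1" "(3::3) \<noteq> 1" "(3::3) \<noteq> 2" "(2::2) \<noteq> 1" "(1::2) \<noteq> 2"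
  by simp_all

lemma one_in_consts: "1 \<in> range const"
  by (rule range_eqI[of _ _ 1]) simp

lemma P1xP2_chart_range: "P1xP2_chart i j = range (prod_chart i j)"
proof -
  have abs: "range const \<union> G \<union> H = range const \<union> insert 1 G \<union> insert 1 H" for G H :: "K set"
    using insert_absorb[OF one_in_consts] by (metis Un_insert_left Un_insert_right)
  have 1: "insert 1 (range (\<lambda>k. t1 k / t1 i)) = insert 1 {affine_coord1 i}"
  proof -
    consider "i = 1" | "i = 2" using exhaust_2 by blast
    then show ?thesis
      by cases (auto simp: UNIV_2 t1_simps affine_coord1_def divide_inverse)
  qed
  have 2: "insert 1 (range (\<lambda>k. t2 k / t2 j)) = insert 1 {affine_coord2 j, affine_coord3 j}"
  proof -
    have r: "range f = {f 1, f 2, f 3}" for f :: "3 \<Rightarrow> K" by (simp only: UNIV_3 image_insert image_empty)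
    consider "j = 1" | "j = 2" | "j = 3" using exhaust_3 by blast
    then show ?thesis
      by cases (simp_all only: r t2_simps affine_coord2_def affine_coord3_def inverse_eq_divide
          three_ne simp_thms if_True if_False div_by_1 divide_self[OF t2_nz[of 2, unfolded t2_simps]]
          divide_self[OF t2_nz[of 3, unfolded t2_simps]] insert_absorb2 insert_commute)
  qed
  have "range const \<union> range (\<lambda>k. t1 k / t1 i) \<union> range (\<lambda>k. t2 k / t2 j) =
      range const \<union> {affine_coord1 i} \<union> {affine_coord2 j, affine_coord3 j}"
    by (subst (1 2) abs) (simp only: 1 2)
  also have "\<dots> = range const \<union> {affine_coord1 i, affine_coord2 j, affine_coord3 j}"
    by (simp only: Un_assoc insert_is_Un[symmetric])
  finally show ?thesis
    unfolding P1xP2_chart_def prod_chart_def range_eval3_eq_hull t1_def t2_def by (simp only:)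
qed

lemma chart_prod_chart: "chart (prod_chart i j)"
  unfolding prod_chart_def
proof (rule chart_eval3I)
  fix a b c :: complex assume nz: "a \<noteq> 0" "b \<noteq> 0" "c \<noteq> 0"
  have 1: "\<exists>s. \<forall>x y. has_value (s, x, y) (affine_coord1 i) a"
  proof (cases "i = 1")
    case True
    then show ?thesis using has_value_coords(1) by (auto simp: affine_coord1_def)
  next
    case False
    have "has_value (inverse a, x, y) (inverse Sf) a" for x y
      using has_value_inverse[OF has_value_coords(1)[of "inverse a" x y]] nz by simp
    then show ?thesis using False by (auto simp: affine_coord1_def)
  qed
  have 2: "\<exists>x y. \<forall>s. has_value (s, x, y) (affine_coord2 j) b \<and> has_value (s, x, y) (affine_coord3 j) c"
  proof -
    consider "j = 1" | "j = 2" | "j = 3" using exhaust_3 by blast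
    then show ?thesis
    proof cases
      case 1 then show ?thesis using has_value_coords by (simp add: affine_coord2_def affine_coord3_def) blast
    next
      case 2
      have "has_value (s, inverse b, c / b) (inverse Xf) b \<and> has_value (s, inverse b, c / b) (Yf / Xf) c" for s
        using has_value_inverse[OF has_value_coords(2)[of s "inverse b" "c / b"]]
          has_value_divide[OF has_value_coords(3,2)[of s "inverse b" "c / b"]] nz by simp
      then show ?thesis using 2 by (simp add: affine_coord2_def affine_coord3_def) blast
    next
      case 3
      have "has_value (s, c / b, inverse b) (inverse Yf) b \<and> has_value (s, c / b, inverse b) (Xf / Yf) c" for s
        using has_value_inverse[OF has_value_coords(3)[of s "c / b" "inverse b"]]
          has_value_divide[OF has_value_coords(2,3)[of s "c / b" "inverse b"]] nz by simp
      then show ?thesis using 3 by (simp add: affine_coord2_def affine_coord3_def) blast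
    qed
  qed
  from 1 2 show "\<exists>p. has_value p (affine_coord1 i) a \<and> has_value p (affine_coord2 j) b \<and> has_value p (affine_coord3 j) c"
    by blast
next
  fix L :: "K set"
  assume L: "is_subring L" and inv: "\<And>q. q \<in> L \<Longrightarrow> inverse q \<in> L"
    and abc: "affine_coord1 i \<in> L" "affine_coord2 j \<in> L" "affine_coord3 j \<in> L"
  have "Sf \<in> L" using abc(1) inv[OF abc(1)] by (auto simp: affine_coord1_def split: if_splits)
  moreover have "Xf \<in> L \<and> Yf \<in> L"
  proof -
    consider "j = 1" | "j = 2" | "j = 3" using exhaust_3 by blast
    then show ?thesis
    proof cases
      case 1 then show ?thesis using abc by (simp add: affine_coord2_def affine_coord3_def)
    next
      case 2
      then have "Xf \<in> L" "Yf / Xf \<in> L" using abc inv[OF abc(2)] by (simp_all add: affine_coord2_def affine_coord3_def)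
      then show ?thesis using is_subringD(4)[OF L, of Xf "Yf / Xf"] by simp
    next
      case 3
      then have "Yf \<in> L" "Xf / Yf \<in> L" using abc inv[OF abc(2)] by (simp_all add: affine_coord2_def affine_coord3_def)
      then show ?thesis using is_subringD(4)[OF L, of Yf "Xf / Yf"] by simp
    qed
  qed
  ultimately show "Sf \<in> L \<and> Xf \<in> L \<and> Yf \<in> L" by blast
qed

lemma prod_chart_11: "prod_chart 1 1 = to_fract"
  by (rule ext) (simp add: prod_chart_def affine_coord1_def affine_coord2_def affine_coord3_def eval3_coords)

lemma Spec_local:
  assumes "R \<in> Spec A" "is_subring A" shows "is_local_ring R" "A \<subseteq> R" "\<exists>P. is_prime_ideal A P \<and> R = localization A P"
proof -
  obtain P where P: "is_prime_ideal A P" "R = localization A P" using assms(1) by (auto simp: Spec_def)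
  show "is_local_ring R" using P localization_local[OF assms(2)] by simp
  show "A \<subseteq> R" using P localization_superset[OF assms(2)] by simp
  show "\<exists>P. is_prime_ideal A P \<and> R = localization A P" using P by blast
qed

text \<open>
  The change of chart in the form in which it is applied: it suffices to express the
  generators of the old coordinate ring by elements of the new one and by inverses of those expressions
  that are units at the point.
\<close>
lemma Spec_transfer:
  assumes R: "R \<in> Spec (is_subring hull G)" and B: "is_subring B" "B \<subseteq> R"
    and G: "\<And>L. is_subring L \<Longrightarrow> B \<subseteq> L \<Longrightarrow> (\<And>q. q \<in> L \<Longrightarrow> q \<in> units_of_ring R \<Longrightarrow> inverse q \<in> L) \<Longrightarrow> G \<subseteq> L"
  shows "R \<in> Spec B" "R = localization B (B \<inter> nonunits R)"
proof -
  note loc = Spec_local[OF R is_subring_hull]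
  obtain P where P: "is_prime_ideal (is_subring hull G) P" "R = localization (is_subring hull G) P" using loc(3) by blast
  note Q = contraction_prime[OF loc(1) B]
  have "G \<subseteq> localization B (B \<inter> nonunits R)"
    by (rule G[OF local_ringD(1)[OF localization_local[OF B(1) Q]] localization_superset[OF B(1) Q]
          inverse_localization_contraction[OF loc(1) B(2)]])
  from localization_transfer[OF is_subring_hull P B this]
  show "R \<in> Spec B" "R = localization B (B \<inter> nonunits R)" by auto
qed

lemma P1xP2_iff: "R \<in> P1xP2 \<longleftrightarrow> (\<exists>i j. R \<in> Spec (P1xP2_chart i j))"
  by (auto simp: P1xP2_def)

lemma P1xP2_chart_subring: "is_subring (P1xP2_chart i j)"
  unfolding P1xP2_chart_def by (rule is_subring_hull)

lemma P1xP2_chart_gens: "const k \<in> P1xP2_chart i j" "t1 k1 / t1 i \<in> P1xP2_chart i j" "t2 k2 / t2 j \<in> P1xP2_chart i j"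
  unfolding P1xP2_chart_def by (auto intro!: hull_inc simp: t1_def t2_def)

lemma P1xP2_chart_subset_iff:
  assumes "is_subring L"
  shows "P1xP2_chart i j \<subseteq> L \<longleftrightarrow> range const \<subseteq> L \<and> (\<forall>k. t1 k / t1 i \<in> L) \<and> (\<forall>k. t2 k / t2 j \<in> L)"
  unfolding P1xP2_chart_def subset_hull[of is_subring, OF assms] t1_def t2_def Un_subset_iff
  by (simp only: image_subset_iff ball_UNIV) blast

text \<open>
  At a point that lies in two charts the quotient of the two dehomogenizing coordinates is a
  unit, being regular together with its inverse.
\<close>
lemma P1xP2_chart_transfer:
  assumes R: "R \<in> Spec (P1xP2_chart i j)" and sub: "P1xP2_chart i' j' \<subseteq> R"
  shows "R \<in> Spec (P1xP2_chart i' j')"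
    "R = localization (P1xP2_chart i' j') (P1xP2_chart i' j' \<inter> nonunits R)"
proof -
  let ?B = "P1xP2_chart i' j'"
  let ?G = "range const \<union> range (\<lambda>k. P1_coords $ k / P1_coords $ i) \<union> range (\<lambda>k. P2_coords $ k / P2_coords $ j)"
  have AR: "P1xP2_chart i j \<subseteq> R" using Spec_local[OF R P1xP2_chart_subring] by blast
  have G: "?G \<subseteq> L" if L: "is_subring L" "?B \<subseteq> L" and inv: "\<And>q. q \<in> L \<Longrightarrow> q \<in> units_of_ring R \<Longrightarrow> inverse q \<in> L" for L
  proof -
    have "t1 k / t1 i \<in> L" for k
    proof -
      have "t1 i / t1 i' \<in> units_of_ring R"
        using P1xP2_chart_gens(2)[of i i' j'] P1xP2_chart_gens(2)[of i' i j] sub AR t1_nz by (auto simp: units_iff)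
      moreover have "t1 i / t1 i' \<in> L" using P1xP2_chart_gens(2) L by blast
      ultimately have "inverse (t1 i / t1 i') \<in> L" by (rule inv[rotated])
      moreover have "t1 k / t1 i' \<in> L" using P1xP2_chart_gens(2) L by blast
      ultimately have "(t1 k / t1 i') * inverse (t1 i / t1 i') \<in> L" by (intro is_subringD[OF L(1)])
      then show ?thesis using t1_nz by simp
    qed
    moreover have "t2 k / t2 j \<in> L" for k
    proof -
      have "t2 j / t2 j' \<in> units_of_ring R"
        using P1xP2_chart_gens(3)[of j j' i'] P1xP2_chart_gens(3)[of j' j i] sub AR t2_nz by (auto simp: units_iff)
      moreover have "t2 j / t2 j' \<in> L" using P1xP2_chart_gens(3) L by blast
      ultimately have "inverse (t2 j / t2 j') \<in> L" by (rule inv[rotated])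
      moreover have "t2 k / t2 j' \<in> L" using P1xP2_chart_gens(3) L by blast
      ultimately have "(t2 k / t2 j') * inverse (t2 j / t2 j') \<in> L" by (intro is_subringD[OF L(1)])
      then show ?thesis using t2_nz by simp
    qed
    moreover have "range const \<subseteq> L" using P1xP2_chart_gens(1) L by blast
    ultimately show ?thesis by (auto simp: t1_def t2_def)
  qed
  from Spec_transfer[OF R[unfolded P1xP2_chart_def] P1xP2_chart_subring sub G]
  show "R \<in> Spec ?B" "R = localization ?B (?B \<inter> nonunits R)" by blast+
qed

lemma chart_11: "P1xP2_chart 1 1 = range to_fract"
  by (simp add: P1xP2_chart_range prod_chart_11)

lemma range_to_fract_subset:
  assumes "is_subring R" "range const \<subseteq> R" "Sf \<in> R" "Xf \<in> R" "Yf \<in> R" shows "range to_fract \<subseteq> R"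
proof
  fix q assume "q \<in> range (to_fract :: poly3 \<Rightarrow> K)"
  then obtain F where "q = to_fract F" by blast
  moreover have "to_fract F \<in> R"
    by (induction F rule: poly3_induct) (use assms in \<open>auto simp: is_subringD const_def\<close>)
  ultimately show "q \<in> R" by simp
qed

lemma P1xP2_local: "R \<in> P1xP2 \<Longrightarrow> is_local_ring R" "R \<in> P1xP2 \<Longrightarrow> range const \<subseteq> R"
  using Spec_local[OF _ P1xP2_chart_subring] P1xP2_chart_gens(1) unfolding P1xP2_iff by blast+



text \<open>
  The affine coordinates centred at \<open>p\<close>; the index \<open>k\<close> selects \<open>s\<close>, \<open>x\<close> or \<open>y\<close>.
\<close>
definition dev :: "point \<Rightarrow> 3 \<Rightarrow> K" where
  "dev p k = (if k = 1 then Sf - const (fst p) else if k = 2 then Xf - const (fst (snd p)) else Yf - const (snd (snd p)))"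

definition dev_poly :: "point \<Rightarrow> 3 \<Rightarrow> poly3" where
  "dev_poly p k = (if k = 1 then S3 - C3 (fst p) else if k = 2 then X3 - C3 (fst (snd p)) else Y3 - C3 (snd (snd p)))"

lemma dev_to_fract: "dev p k = to_fract (dev_poly p k)"
  unfolding dev_def dev_poly_def const_def to_fract_diff[symmetric] by simp

lemma dev_nz: "dev p k \<noteq> 0"
proof -
  obtain a b c where p: "p = (a, b, c)" by (cases p) auto
  have "pval (a + 1, b + 1, c + 1) (dev_poly p k) = 1" by (simp add: p dev_poly_def del: add_pCons diff_pCons)
  then have "dev_poly p k \<noteq> 0" using pval_simps(5)[of "(a + 1, b + 1, c + 1)"] by auto
  then show ?thesis unfolding dev_to_fract by simp
qed

lemma dev_value: "has_value p (dev p k) 0"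
proof -
  obtain a b c where p: "p = (a, b, c)" by (cases p) auto
  have "pval p (dev_poly p k) = 0" by (simp add: p dev_poly_def del: add_pCons diff_pCons)
  then show ?thesis using has_value_poly[of p "dev_poly p k"] unfolding dev_to_fract by simp
qed

text \<open>
  First order Taylor expansion: the functions vanishing at \<open>p\<close> form the ideal generated by the
  three displacements.
\<close>
lemma dev_expansion:
  "\<exists>G. to_fract F = const (pval p F) + (\<Sum>k\<in>UNIV. dev p k * to_fract (G k))"
proof -
  obtain a b c where p: "p = (a, b, c)" by (cases p) auto
  show ?thesis
  proof (induction F rule: poly3_induct)
    case (1 k)
    show ?case by (rule exI[of _ "\<lambda>_. 0"]) (simp add: const_def del: )
  next
    case 2
    show ?case unfolding p by (rule exI[of _ "\<lambda>k. if k = 1 then 1 else 0"]) (simp add: sum_3 dev_def del: const_simps)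
  next
    case 3
    show ?case unfolding p by (rule exI[of _ "\<lambda>k. if k = 2 then 1 else 0"]) (simp add: sum_3 dev_def del: const_simps)
  next
    case 4
    show ?case unfolding p by (rule exI[of _ "\<lambda>k. if k = 3 then 1 else 0"]) (simp add: sum_3 dev_def del: const_simps)
  next
    case (5 F G)
    then obtain f g where f: "to_fract F = const (pval p F) + (\<Sum>k\<in>UNIV. dev p k * to_fract (f k))"
      "to_fract G = const (pval p G) + (\<Sum>k\<in>UNIV. dev p k * to_fract (g k))" by blast
    show ?case
      by (rule exI[of _ "\<lambda>k. f k + g k"]) (simp add: f distrib_left sum.distrib)
  next
    case (6 F G)
    then obtain f g where f: "to_fract F = const (pval p F) + (\<Sum>k\<in>UNIV. dev p k * to_fract (f k))"
      "to_fract G = const (pval p G) + (\<Sum>k\<in>UNIV. dev p k * to_fract (g k))" by blast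
    have 1: "const (pval p F) * to_fract G =
        const (pval p F) * const (pval p G) + (\<Sum>k\<in>UNIV. dev p k * (const (pval p F) * to_fract (g k)))"
      by (subst f(2)) (simp add: distrib_left sum_distrib_left mult.left_commute)
    have 2: "(\<Sum>k\<in>UNIV. dev p k * to_fract (f k)) * to_fract G = (\<Sum>k\<in>UNIV. dev p k * (to_fract (f k) * to_fract G))"
      by (simp add: sum_distrib_right mult.assoc)
    have "to_fract (F * G) = const (pval p F) * to_fract G + (\<Sum>k\<in>UNIV. dev p k * to_fract (f k)) * to_fract G"
      by (simp add: f(1) distrib_right)
    also have "\<dots> = const (pval p (F * G)) + (\<Sum>k\<in>UNIV. dev p k * to_fract (C3 (pval p F) * g k + f k * G))"
      unfolding 1 2 by (simp only: to_fract_add to_fract_mult const_def[symmetric] distrib_left sum.distrib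
          pval_simps const_simps add.assoc)
    finally show ?case by (intro exI[of _ "\<lambda>k. C3 (pval p F) * g k + f k * G"])
  qed
qed

section \<open>Local rings of closed points\<close>

text \<open>
  Whichever chart is chosen to define the closed point, modulo the given ideal every function is
  congruent to its value, so that the ideal consists of the functions with value zero.
\<close>
lemma closed_point_eq_point_ring:
  assumes nz: "fst p $ 1 \<noteq> 0" "snd p $ 1 \<noteq> 0"
  shows "closed_point p = point_ring (fst p $ 2 / fst p $ 1, snd p $ 2 / snd p $ 1, snd p $ 3 / snd p $ 1)"
proof -
  define a where "a = fst p" define b where "b = snd p"
  define i where "i = (SOME i. a $ i \<noteq> 0)" define j where "j = (SOME j. b $ j \<noteq> 0)"
  define q where "q = (a $ 2 / a $ 1, b $ 2 / b $ 1, b $ 3 / b $ 1)"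
  let ?A = "P1xP2_chart i j"
  let ?G = "range (\<lambda>k. t1 k / t1 i - const (a $ k / a $ i)) \<union> range (\<lambda>k. t2 k / t2 j - const (b $ k / b $ j))"
  define I where "I = is_ideal ?A hull ?G"
  let ?O = "point_ring q"
  have nz': "a $ 1 \<noteq> 0" "b $ 1 \<noteq> 0" using nz by (auto simp: a_def b_def)
  have ij: "a $ i \<noteq> 0" "b $ j \<noteq> 0" unfolding i_def j_def using nz' by (metis (mono_tags, lifting) someI)+
  have v1: "has_value q (t1 k) (a $ k / a $ 1)" for k
    using exhaust_2[of k] has_value_const[of q 1] has_value_coords(1) nz' by (auto simp: t1_simps q_def)
  have v2: "has_value q (t2 k) (b $ k / b $ 1)" for k
    using exhaust_3[of k] has_value_const[of q 1] has_value_coords(2,3) nz' by (auto simp: t2_simps q_def)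
  have v1': "has_value q (t1 k / t1 i) (a $ k / a $ i)" for k
    using has_value_divide[OF v1[of k] v1[of i]] nz' ij by simp
  have v2': "has_value q (t2 k / t2 j) (b $ k / b $ j)" for k
    using has_value_divide[OF v2[of k] v2[of j]] nz' ij by simp
  note A = P1xP2_chart_subring[of i j]
  note O = point_ring_local[of q]
  have AO: "?A \<subseteq> ?O"
    unfolding P1xP2_chart_subset_iff[OF local_ringD(1)[OF O]]
    using has_value_const v1' v2' unfolding point_ring_def by blast
  have GA: "?G \<subseteq> ?A"
    using is_subringD(3)[OF A P1xP2_chart_gens(2) P1xP2_chart_gens(1)]
      is_subringD(3)[OF A P1xP2_chart_gens(3) P1xP2_chart_gens(1)] by blast
  have I: "is_ideal ?A I" unfolding I_def by (rule is_ideal_hull[OF GA A])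
  have Iadd: "u + v \<in> I" if "u \<in> I" "v \<in> I" for u v using I that by (auto simp: is_ideal_def)
  have Imult: "u * v \<in> I" if "u \<in> ?A" "v \<in> I" for u v using I that by (auto simp: is_ideal_def)
  have I0: "0 \<in> I" using I by (auto simp: is_ideal_def)
  have GI: "?G \<subseteq> I" unfolding I_def by (rule hull_subset)
  have Q: "is_prime_ideal ?A (?A \<inter> nonunits ?O)" by (rule contraction_prime[OF O A AO])
  have "I = ?A \<inter> nonunits ?O"
  proof
    have "has_value q (t1 k / t1 i - const (a $ k / a $ i)) 0" "has_value q (t2 l / t2 j - const (b $ l / b $ j)) 0" for k l
      using has_value_arith(3)[OF v1' has_value_const, of k "a $ k / a $ i"]
        has_value_arith(3)[OF v2' has_value_const, of l "b $ l / b $ j"] by simp_all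
    then have "?G \<subseteq> ?A \<inter> nonunits ?O"
      using GA by (auto simp: point_ring_nonunits)
    then show "I \<subseteq> ?A \<inter> nonunits ?O"
      unfolding I_def using Q by (intro hull_minimal) (auto simp: is_prime_ideal_def)
    have sub: "is_subring {g \<in> ?A. \<exists>v. has_value q g v \<and> g - const v \<in> I}" (is "is_subring ?S")
      unfolding is_subring_def
    proof (intro conjI ballI)
      show "0 \<in> ?S" using is_subringD(1)[OF A] I0 has_value_const[of q 0] by auto
      show "1 \<in> ?S" using is_subringD(2)[OF A] I0 has_value_const[of q 1] by auto
      fix g h assume "g \<in> ?S" "h \<in> ?S"
      then obtain v w where gh: "g \<in> ?A" "h \<in> ?A" "has_value q g v" "has_value q h w" "g - const v \<in> I" "h - const w \<in> I"
        by blast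
      have e: "g - h - const (v - w) = (g - const v) + (- 1) * (h - const w)"
        "g * h - const (v * w) = h * (g - const v) + const v * (h - const w)"
        by (simp_all add: algebra_simps)
      have m: "- 1 \<in> ?A" "const v \<in> ?A" using P1xP2_chart_gens(1)[of "-1" i j] P1xP2_chart_gens(1) by simp_all
      have "g - h - const (v - w) \<in> I" "g * h - const (v * w) \<in> I"
        unfolding e by (rule Iadd[OF gh(5) Imult[OF m(1) gh(6)]] Iadd[OF Imult[OF gh(2,5)] Imult[OF m(2) gh(6)]])+
      then show "g - h \<in> ?S" "g * h \<in> ?S"
        using gh is_subringD(3,4)[OF A] has_value_arith(2,3)[OF gh(3,4)] by blast+
    qed
    have "?A \<subseteq> ?S"
      unfolding P1xP2_chart_subset_iff[OF sub]
    proof (intro conjI allI)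
      show "range const \<subseteq> ?S" using has_value_const P1xP2_chart_gens(1) I0 by fastforce
      show "t1 k / t1 i \<in> ?S" for k using P1xP2_chart_gens(2) v1' GI by blast
      show "t2 k / t2 j \<in> ?S" for k using P1xP2_chart_gens(3) v2' GI by blast
    qed
    show "?A \<inter> nonunits ?O \<subseteq> I"
    proof
      fix g assume g: "g \<in> ?A \<inter> nonunits ?O"
      then obtain v where v: "has_value q g v" "g - const v \<in> I" using \<open>?A \<subseteq> ?S\<close> by blast
      have "has_value q g 0" using g by (simp add: point_ring_nonunits)
      then have "v = 0" using has_value_unique v(1) by blast
      then show "g \<in> I" using v(2) by simp
    qed
  qed
  note loc = localization_local[OF A Q]
  let ?L = "localization ?A (?A \<inter> nonunits ?O)"
  note AL = localization_superset[OF A Q]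
  have inv: "inverse g \<in> ?L" if "g \<in> ?L" "has_value q g v" "v \<noteq> 0" for g v
    using inverse_localization_contraction[OF O AO that(1)] that point_ring_units by blast
  have "?L = ?O"
  proof
    show "?L \<subseteq> ?O" by (rule localization_contraction_subset[OF O AO])
    have t1L: "t1 k \<in> ?L" for k
    proof -
      have "inverse (t1 1 / t1 i) \<in> ?L"
        using inv[OF _ v1'[of 1]] AL P1xP2_chart_gens(2) nz' ij by (simp add: subset_iff)
      moreover have "t1 k / t1 i \<in> ?L" using AL P1xP2_chart_gens(2) by blast
      ultimately have "(t1 k / t1 i) * inverse (t1 1 / t1 i) \<in> ?L" by (intro is_subringD(4)[OF local_ringD(1)[OF loc]])
      then show ?thesis using t1_nz[of i] by (simp add: t1_simps)
    qed
    have t2L: "t2 k \<in> ?L" for k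
    proof -
      have "inverse (t2 1 / t2 j) \<in> ?L"
        using inv[OF _ v2'[of 1]] AL P1xP2_chart_gens(3) nz' ij by (simp add: subset_iff)
      moreover have "t2 k / t2 j \<in> ?L" using AL P1xP2_chart_gens(3) by blast
      ultimately have "(t2 k / t2 j) * inverse (t2 1 / t2 j) \<in> ?L" by (intro is_subringD(4)[OF local_ringD(1)[OF loc]])
      then show ?thesis using t2_nz[of j] by (simp add: t2_simps)
    qed
    have "range const \<subseteq> ?L" using AL P1xP2_chart_gens(1) by blast
    then have FL: "to_fract F \<in> ?L" for F
      using range_to_fract_subset[OF local_ringD(1)[OF loc]] t1L[of 2] t2L[of 2] t2L[of 3] t1_simps t2_simps by auto
    show "?O \<subseteq> ?L"
    proof
      fix g assume "g \<in> ?O"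
      then obtain n d where e: "pval q d \<noteq> 0" "g = to_fract n * inverse (to_fract d)"
        by (auto simp: point_ring_def has_value_def divide_inverse)
      have "inverse (to_fract d) \<in> ?L" by (rule inv[OF FL has_value_poly e(1)])
      then show "g \<in> ?L" unfolding e(2) using FL is_subringD(4)[OF local_ringD(1)[OF loc]] by blast
    qed
  qed
  moreover have "closed_point p = localization ?A I"
    unfolding closed_point_def Let_def I_def a_def b_def i_def j_def t1_def t2_def by simp
  ultimately show ?thesis using \<open>I = ?A \<inter> nonunits ?O\<close> unfolding q_def a_def b_def by simp
qed

lemma poly_in_point_ring: "to_fract F \<in> point_ring p"
  unfolding point_ring_def using has_value_poly by blast

lemma const_in_point_ring: "range const \<subseteq> point_ring p"
  unfolding point_ring_def using has_value_const by blast

lemma dev_in_nonunits: "dev p k \<in> nonunits (point_ring p)"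
  by (simp add: point_ring_nonunits dev_value)

lemma point_ring_maximal_ideal:
  assumes "q \<in> nonunits (point_ring p)"
  obtains G where "\<And>k. G k \<in> point_ring p" "q = (\<Sum>k\<in>UNIV. dev p k * G k)"
proof -
  have "has_value p q 0" using assms by (simp add: point_ring_nonunits)
  then obtain n d where e: "pval p d \<noteq> 0" "q = to_fract n / to_fract d" "pval p n = 0"
    by (auto simp: has_value_def)
  obtain G where "to_fract n = const (pval p n) + (\<Sum>k\<in>UNIV. dev p k * to_fract (G k))" using dev_expansion by blast
  then have "q = (\<Sum>k\<in>UNIV. dev p k * (to_fract (G k) / to_fract d))"
    unfolding e(2,3) by (simp add: sum_divide_distrib)
  moreover have "to_fract (G k) / to_fract d \<in> point_ring p" for k
    using e(1) by (auto simp: point_ring_def has_value_def)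
  ultimately show thesis by (intro that[of "\<lambda>k. to_fract (G k) / to_fract d"])
qed

lemma is_subringD_const_unit:
  assumes "range const \<subseteq> R" "c \<noteq> 0" shows "const c \<in> units_of_ring R"
  using assms by (auto simp: units_iff simp flip: const_inverse)

text \<open>
  A local ring over the affine chart in which the displacements are nonunits dominates the local
  ring of the point, since a polynomial is congruent to its value there modulo nonunits.
\<close>
lemma point_ring_units_extend:
  assumes R: "is_local_ring R" "range const \<subseteq> R" and F: "range to_fract \<subseteq> R"
    and dev: "\<And>k. dev p k \<in> nonunits R"
  shows "point_ring p \<subseteq> R" "to_fract G \<in> nonunits R \<longleftrightarrow> pval p G = 0"
proof -
  note S = local_ringD[OF R(1)]
  have key: "to_fract G - const (pval p G) \<in> nonunits R" for G
  proof -
    obtain H where "to_fract G = const (pval p G) + (\<Sum>k\<in>UNIV. dev p k * to_fract (H k))" using dev_expansion by blast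
    then have e: "to_fract G - const (pval p G) = (\<Sum>k\<in>UNIV. to_fract (H k) * dev p k)" by (simp add: mult.commute)
    have "to_fract (H k) * dev p k \<in> nonunits R" for k using F dev S(3) by blast
    then show ?thesis unfolding e sum_3 by (intro S(2))
  qed
  have unit: "to_fract G \<in> units_of_ring R" if "pval p G \<noteq> 0" for G
    using S(5)[OF is_subringD_const_unit[OF R(2) that] key[of G]] by simp
  show "to_fract G \<in> nonunits R \<longleftrightarrow> pval p G = 0"
    using key[of G] unit[of G] by (auto simp: nonunits_def)
  show "point_ring p \<subseteq> R"
  proof
    fix q assume "q \<in> point_ring p"
    then obtain n d where e: "pval p d \<noteq> 0" "q = to_fract n * inverse (to_fract d)"
      by (auto simp: point_ring_def has_value_def divide_inverse)
    then show "q \<in> R" using unit[OF e(1)] F is_subringD(4)[OF S(1)] by (auto simp: units_iff)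
  qed
qed

text \<open>
  If \<open>z\<close> is infinite at a point, then so is \<open>z - c\<close>.
\<close>
lemma inverse_shift_in_local_ring:
  assumes R: "is_local_ring R" "range const \<subseteq> R" and z: "inverse z \<in> R" "z \<noteq> 0" "z \<notin> R"
  shows "inverse (z - const c) \<in> R"
proof -
  note S = local_ringD[OF R(1)]
  have "inverse z \<in> nonunits R" using z by (auto simp: nonunits_def units_iff)
  then have "const c * inverse z \<in> nonunits R" using S(3) R(2) by blast
  then have "1 - const c * inverse z \<in> units_of_ring R" using S(6)[OF units_1[OF S(1)]] by blast
  then have "inverse z * inverse (1 - const c * inverse z) \<in> R" using z is_subringD(4)[OF S(1)] by (auto simp: units_iff)
  moreover have "z - const c = z * (1 - const c * inverse z)" using z by (simp add: algebra_simps)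
  ultimately show ?thesis by (simp add: mult.commute)
qed

text \<open>
  At a point other than \<open>p\<close> some displacement from \<open>p\<close> has a regular inverse: it is infinite or
  nonzero there.
\<close>
lemma P1xP2_dichotomy:
  assumes R: "R \<in> P1xP2" and ninv: "\<And>k. inverse (dev p k) \<notin> R"
  shows "R = point_ring p"
proof -
  obtain i j where ij: "R \<in> Spec (P1xP2_chart i j)" using R by (auto simp: P1xP2_iff)
  have AR: "P1xP2_chart i j \<subseteq> R" using Spec_local[OF ij P1xP2_chart_subring] by blast
  note loc = P1xP2_local[OF R] and S = local_ringD[OF P1xP2_local(1)[OF R]]
  have cases1: "z \<in> R" if "z = Sf \<or> z = Xf \<or> z = Yf" "inverse z \<in> R" for z
  proof (rule ccontr)
    assume z: "z \<notin> R"
    then have "z \<noteq> 0" using is_subringD(1)[OF S(1)] by auto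
    note inverse_shift_in_local_ring[OF loc that(2) this z]
    then show False using ninv[of 1] ninv[of 2] ninv[of 3] that(1) by (auto simp: dev_def)
  qed
  have "Sf \<in> R"
  proof (cases "i = 1")
    case True
    then have "t1 2 / t1 1 \<in> R" using AR P1xP2_chart_gens(2)[of 2 i j] by auto
    then show ?thesis by (simp add: t1_simps)
  next
    case False
    then have "t1 1 / t1 2 \<in> R" using AR P1xP2_chart_gens(2)[of 1 i j] exhaust_2[of i] by auto
    then have "inverse Sf \<in> R" by (simp only: t1_simps inverse_eq_divide)
    then show ?thesis using cases1 by blast
  qed
  moreover have "Xf \<in> R \<and> Yf \<in> R"
  proof -
    have g: "t2 k / t2 j \<in> R" for k using AR P1xP2_chart_gens(3)[of k j i] by auto
    consider "j = 1" | "j = 2" | "j = 3" using exhaust_3 by blast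
    then show ?thesis
    proof cases
      case 1 then show ?thesis using g[of 2] g[of 3] by (simp add: t2_simps)
    next
      case 2
      then have "inverse Xf \<in> R" using g[of 1] by (simp only: t2_simps inverse_eq_divide)
      then have "Xf \<in> R" using cases1 by blast
      moreover have "Xf * (t2 3 / t2 2) \<in> R" using is_subringD(4)[OF S(1) \<open>Xf \<in> R\<close>] g[of 3] 2 by blast
      ultimately show ?thesis by (simp add: t2_simps)
    next
      case 3
      then have "inverse Yf \<in> R" using g[of 1] by (simp only: t2_simps inverse_eq_divide)
      then have "Yf \<in> R" using cases1 by blast
      moreover have "Yf * (t2 2 / t2 3) \<in> R" using is_subringD(4)[OF S(1) \<open>Yf \<in> R\<close>] g[of 2] 3 by blast
      ultimately show ?thesis by (simp add: t2_simps)
    qed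
  qed
  ultimately have FR: "range to_fract \<subseteq> R" using range_to_fract_subset[OF S(1) loc(2)] by blast
  then have sub: "P1xP2_chart 1 1 \<subseteq> R" by (simp add: chart_11)
  have dev: "dev p k \<in> nonunits R" for k
    using ninv[of k] FR dev_to_fract by (auto simp: nonunits_def units_iff)
  note ext = point_ring_units_extend[OF loc FR dev]
  have Req: "R = localization (range to_fract) (range to_fract \<inter> nonunits R)"
    using P1xP2_chart_transfer(2)[OF ij sub] by (simp add: chart_11)
  show ?thesis
  proof
    show "point_ring p \<subseteq> R" by (rule ext(1))
    show "R \<subseteq> point_ring p"
    proof
      fix q assume "q \<in> R"
      then obtain n d where e: "q = to_fract n / to_fract d" "to_fract d \<notin> nonunits R"
        by (subst (asm) Req) (auto simp: localization_iff)
      then have "pval p d \<noteq> 0" using ext(2) by blast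
      then show "q \<in> point_ring p" using e(1) by (auto simp: point_ring_def has_value_def)
    qed
  qed
qed

lemma not_point_ring_subset:
  assumes "fst p \<noteq> fst p'" shows "\<not> point_ring p \<subseteq> point_ring p'"
proof
  assume sub: "point_ring p \<subseteq> point_ring p'"
  obtain a b c where p: "p = (a, b, c)" by (cases p) auto
  have "has_value p (dev p' 1) (fst p - fst p')"
    unfolding p dev_def using has_value_arith(3)[OF has_value_coords(1) has_value_const] by simp
  then have "inverse (dev p' 1) \<in> point_ring p"
    using has_value_inverse assms unfolding point_ring_def by fastforce
  then have "dev p' 1 \<in> units_of_ring (point_ring p')"
    using sub dev_in_nonunits[of p' 1] dev_nz by (auto simp: units_iff nonunits_def)
  then show False using dev_in_nonunits[of p' 1] by (simp add: nonunits_def)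
qed

text \<open>
  A denominator of such a quotient would vanish on the line through \<open>p\<close> in the direction \<open>k\<close>
  away from \<open>p\<close>, hence also at \<open>p\<close>.
\<close>
lemma dev_quotient_not_regular:
  assumes "k \<noteq> l" shows "dev p k / dev p l \<notin> point_ring p"
proof
  obtain a b c where p: "p = (a, b, c)" by (cases p) auto
  assume "dev p k / dev p l \<in> point_ring p"
  then obtain n d where e: "pval p d \<noteq> 0" "dev p k / dev p l = to_fract n / to_fract d"
    by (auto simp: point_ring_def has_value_def)
  have "d \<noteq> 0" using e(1) by auto
  then have "to_fract (dev_poly p k * d) = to_fract (n * dev_poly p l)"
    using e(2) dev_nz[of p l] dev_nz[of p k] by (simp add: dev_to_fract field_simps)
  then have eq: "dev_poly p k * d = n * dev_poly p l" by (simp only: to_fract_eq_iff)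
  define \<gamma> where "\<gamma> t = (a + (if k = 1 then t else 0), b + (if k = 2 then t else 0), c + (if k = 3 then t else 0))" for t
  have "pval (\<gamma> t) (dev_poly p k) = t" "pval (\<gamma> t) (dev_poly p l) = 0" for t
    using assms exhaust_3[of k] exhaust_3[of l] by (auto simp: p dev_poly_def \<gamma>_def simp del: diff_pCons)
  then have z: "pval (\<gamma> t) d = 0" if "t \<noteq> 0" for t
    using arg_cong[OF eq, of "pval (\<gamma> t)"] that by (simp only: pval_simps) simp
  have "\<exists>P. \<forall>t. poly P t = pval (\<gamma> t) d" for d
  proof (induction d rule: poly3_induct)
    case (1 k) show ?case by (rule exI[of _ "[:k:]"]) simp
  next
    case 2 show ?case by (rule exI[of _ "[:a, if k = 1 then 1 else 0:]"]) (simp add: \<gamma>_def)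
  next
    case 3 show ?case by (rule exI[of _ "[:b, if k = 2 then 1 else 0:]"]) (simp add: \<gamma>_def)
  next
    case 4 show ?case by (rule exI[of _ "[:c, if k = 3 then 1 else 0:]"]) (simp add: \<gamma>_def)
  next
    case (5 F G)
    then obtain P Q where "\<forall>t. poly P t = pval (\<gamma> t) F" "\<forall>t. poly Q t = pval (\<gamma> t) G" by blast
    then show ?case by (intro exI[of _ "P + Q"]) simp
  next
    case (6 F G)
    then obtain P Q where "\<forall>t. poly P t = pval (\<gamma> t) F" "\<forall>t. poly Q t = pval (\<gamma> t) G" by blast
    then show ?case by (intro exI[of _ "P * Q"]) simp
  qed
  then obtain P where P: "\<And>t. poly P t = pval (\<gamma> t) d" by blast
  have "infinite (UNIV - {0 :: complex})" by (simp add: infinite_UNIV_char_0)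
  moreover have "UNIV - {0} \<subseteq> {t. poly P t = 0}" using z P by auto
  ultimately have "P = 0" using poly_zero_if_infinitely_many_zeros infinite_super by blast
  moreover have "\<gamma> 0 = p" by (simp add: \<gamma>_def p)
  ultimately show False using P[of 0] e(1) by simp
qed

text \<open>
  In a valuation ring one of \<open>q\<close> and \<open>1/q\<close> is regular, but neither of the quotients of two
  displacements is regular at a closed point.
\<close>
lemma (in chart) dvr_not_point_ring: "prime_elem \<pi> \<Longrightarrow> dvr \<pi> \<noteq> point_ring p"
  using dvr_valuation[of \<pi> "dev p 1 / dev p 2"] dev_nz[of p] dev_quotient_not_regular[of 1 2 p]
    dev_quotient_not_regular[of 2 1 p] by auto

section \<open>The charts of the blowup\<close>

text \<open>The two indices different from \<open>j\<close>, in increasing order.\<close>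
definition other1 :: "3 \<Rightarrow> 3" where "other1 j = (if j = 1 then 2 else 1)"
definition other2 :: "3 \<Rightarrow> 3" where "other2 j = (if j = 3 then 2 else 3)"

lemma others: "k = j \<or> k = other1 j \<or> k = other2 j" "other1 j \<noteq> j" "other2 j \<noteq> j" "other1 j \<noteq> other2 j"
  using exhaust_3[of k] exhaust_3[of j] by (auto simp: other1_def other2_def)

text \<open>
  The chart of the blowup of \<open>p\<close> in which the \<open>j\<close>-th displacement is an equation of the exceptional
  divisor; the other two coordinates are directions at \<open>p\<close>.
\<close>
definition blow_chart :: "point \<Rightarrow> 3 \<Rightarrow> poly3 \<Rightarrow> K" where
  "blow_chart p j = eval3 const (dev p j) (dev p (other1 j) / dev p j) (dev p (other2 j) / dev p j)"

lemma dev_value_shift: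
  "has_value (fst p + v 1, fst (snd p) + v 2, snd (snd p) + v 3) (dev p k) (v k)"
proof -
  let ?q = "(fst p + v 1, fst (snd p) + v 2, snd (snd p) + v 3)"
  note 1 = has_value_arith(3)[OF has_value_coords(1) has_value_const, of "fst p + v 1" "fst (snd p) + v 2" "snd (snd p) + v 3" "fst p"]
  note 2 = has_value_arith(3)[OF has_value_coords(2) has_value_const, of "fst p + v 1" "fst (snd p) + v 2" "snd (snd p) + v 3" "fst (snd p)"]
  note 3 = has_value_arith(3)[OF has_value_coords(3) has_value_const, of "fst p + v 1" "fst (snd p) + v 2" "snd (snd p) + v 3" "snd (snd p)"]
  show ?thesis using exhaust_3[of k] 1 2 3 by (auto simp: dev_def)
qed

lemma chart_blow_chart: "chart (blow_chart p j)"
  unfolding blow_chart_def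
proof (rule chart_eval3I)
  fix a b c :: complex assume nz: "a \<noteq> 0" "b \<noteq> 0" "c \<noteq> 0"
  define v where "v k = (if k = j then a else if k = other1 j then a * b else a * c)" for k
  have v: "v j = a" "v (other1 j) = a * b" "v (other2 j) = a * c"
    using others(2-)[of j] by (auto simp: v_def)
  define q where "q = (fst p + v 1, fst (snd p) + v 2, snd (snd p) + v 3)"
  note val = dev_value_shift[of p v, folded q_def]
  have "has_value q (dev p j) a" using val[of j] v by simp
  moreover have "has_value q (dev p (other1 j) / dev p j) b"
    using has_value_divide[OF val[of "other1 j"] val[of j]] v nz by simp
  moreover have "has_value q (dev p (other2 j) / dev p j) c"
    using has_value_divide[OF val[of "other2 j"] val[of j]] v nz by simp
  ultimately show "\<exists>q. has_value q (dev p j) a \<and> has_value q (dev p (other1 j) / dev p j) b \<and>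
      has_value q (dev p (other2 j) / dev p j) c" by blast
next
  fix L :: "K set"
  assume L: "is_subring L" and c: "range const \<subseteq> L" and abc: "dev p j \<in> L" "dev p (other1 j) / dev p j \<in> L"
    "dev p (other2 j) / dev p j \<in> L"
  have d: "dev p k \<in> L" for k
    using is_subringD(4)[OF L abc(1,2)] is_subringD(4)[OF L abc(1,3)] abc(1) others(1)[of k j] dev_nz[of p j] by auto
  have "dev p 1 + const (fst p) \<in> L" "dev p 2 + const (fst (snd p)) \<in> L" "dev p 3 + const (snd (snd p)) \<in> L"
    using d c by (auto intro!: is_subringD(6)[OF L])
  then show "Sf \<in> L \<and> Xf \<in> L \<and> Yf \<in> L" by (simp add: dev_def)
qed

lemma blow_chart_subset_iff:
  assumes L: "is_subring L"
  shows "range (blow_chart p j) \<subseteq> L \<longleftrightarrow> range const \<subseteq> L \<and> dev p j \<in> L \<and> (\<forall>k. dev p k / dev p j \<in> L)"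
proof -
  have "dev p j / dev p j \<in> L" using is_subringD(2)[OF L] dev_nz by simp
  then have "(\<forall>k. dev p k / dev p j \<in> L) \<longleftrightarrow> dev p (other1 j) / dev p j \<in> L \<and> dev p (other2 j) / dev p j \<in> L"
    using others(1)[of _ j] by metis
  then show ?thesis
    unfolding blow_chart_def range_eval3_eq_hull subset_hull[of is_subring, OF L] by blast
qed

lemma blow_chart_subring: "is_subring (range (blow_chart p j))"
  by (rule chart.subring_range[OF chart_blow_chart])

lemma blow_chart_gens:
  "range const \<subseteq> range (blow_chart p j)" "dev p k / dev p j \<in> range (blow_chart p j)" "dev p k \<in> range (blow_chart p j)"
  "range to_fract \<subseteq> range (blow_chart p j)"
proof -
  note B = blow_chart_subring[of p j]
  have *: "range const \<subseteq> range (blow_chart p j) \<and> dev p j \<in> range (blow_chart p j) \<and> (\<forall>k. dev p k / dev p j \<in> range (blow_chart p j))"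
    using blow_chart_subset_iff[OF B, of p j] by blast
  then show c: "range const \<subseteq> range (blow_chart p j)" and q: "dev p k / dev p j \<in> range (blow_chart p j)" for k by blast+
  have d: "dev p k \<in> range (blow_chart p j)" for k
    using is_subringD(4)[OF B _ q[of k], of "dev p j"] * dev_nz[of p j] by simp
  then show "dev p k \<in> range (blow_chart p j)" .
  have "dev p 1 + const (fst p) \<in> range (blow_chart p j)" "dev p 2 + const (fst (snd p)) \<in> range (blow_chart p j)"
    "dev p 3 + const (snd (snd p)) \<in> range (blow_chart p j)"
    using d c by (auto intro!: is_subringD(6)[OF B])
  then show "range to_fract \<subseteq> range (blow_chart p j)"
    using range_to_fract_subset[OF B c] by (simp add: dev_def)
qed

lemma blow_chart_hull:
  "range (blow_chart p j) = is_subring hull (range const \<union> {dev p j, dev p (other1 j) / dev p j, dev p (other2 j) / dev p j})"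
  by (simp only: blow_chart_def range_eval3_eq_hull)

text \<open>
  The coordinate ring of the chart \<open>D(u)\<close> of the blowup of the maximal ideal.
\<close>
definition blow_ring :: "K set \<Rightarrow> K \<Rightarrow> K set" where
  "blow_ring R u = is_subring hull (R \<union> {x / u | x. x \<in> nonunits R})"

lemma blow_ring_subring: "is_subring (blow_ring R u)"
  unfolding blow_ring_def by (rule is_subring_hull)

lemma blow_ring_gens: "R \<subseteq> blow_ring R u" "x \<in> nonunits R \<Longrightarrow> x / u \<in> blow_ring R u"
  unfolding blow_ring_def by (auto intro: hull_inc)

lemma point_ring_subset_inverse_closed:
  assumes L: "is_subring L" "range to_fract \<subseteq> L" "\<And>q. q \<in> L \<Longrightarrow> q \<in> units_of_ring T \<Longrightarrow> inverse q \<in> L"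
    and T: "point_ring p \<subseteq> T"
  shows "point_ring p \<subseteq> L"
proof
  fix q assume "q \<in> point_ring p"
  then obtain n d where e: "pval p d \<noteq> 0" "q = to_fract n * inverse (to_fract d)"
    by (auto simp: point_ring_def has_value_def divide_inverse)
  have "to_fract d \<in> units_of_ring (point_ring p)" using point_ring_units has_value_poly e(1) by blast
  then have "to_fract d \<in> units_of_ring T" using units_mono[OF T] by blast
  then have "inverse (to_fract d) \<in> L" using L(2,3) by blast
  then show "q \<in> L" unfolding e(2) using L(1,2) is_subringD(4) by blast
qed

text \<open>
  The points of the blowup away from the exceptional divisor are points of the product.
\<close>
lemma Spec_blow_ring_unit:
  assumes T: "T \<in> Spec (blow_ring (point_ring p) u)" and u: "u \<in> nonunits (point_ring p)" "u \<in> units_of_ring T"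
  shows "T \<in> Spec (range to_fract)" "point_ring p \<subseteq> T" "T \<noteq> point_ring p"
proof -
  have OT: "point_ring p \<subseteq> T" using Spec_local(2)[OF T blow_ring_subring] blow_ring_gens(1) by blast
  then show "point_ring p \<subseteq> T" .
  show "T \<noteq> point_ring p" using u by (auto simp: nonunits_def)
  have FT: "range to_fract \<subseteq> T" using OT poly_in_point_ring by blast
  show "T \<in> Spec (range to_fract)"
  proof (rule Spec_transfer(1)[OF T[unfolded blow_ring_def] _ FT])
    show "is_subring (range to_fract :: K set)" using P1xP2_chart_subring[of 1 1] by (simp add: chart_11)
    fix L assume L: "is_subring L" "range to_fract \<subseteq> L" and inv: "\<And>q. q \<in> L \<Longrightarrow> q \<in> units_of_ring T \<Longrightarrow> inverse q \<in> L"
    have OL: "point_ring p \<subseteq> L" by (rule point_ring_subset_inverse_closed[OF L inv OT])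
    have uL: "u \<in> L" using u(1) OL by (auto simp: nonunits_def)
    have "x / u \<in> L" if "x \<in> nonunits (point_ring p)" for x
    proof -
      have "x \<in> L" using that OL by (auto simp: nonunits_def)
      then show ?thesis unfolding divide_inverse using inv[OF uL u(2)] is_subringD(4)[OF L(1)] by blast
    qed
    then show "point_ring p \<union> {x / u |x. x \<in> nonunits (point_ring p)} \<subseteq> L" using OL by blast
  qed
qed

text \<open>
  On the exceptional divisor, \<open>u\<close> is a combination of the three displacements with regular
  coefficients. Dividing by \<open>u\<close> shows that some quotient \<open>dev p j / u\<close> is a unit, so the point lies in one of
  the three standard charts.
\<close>
lemma Spec_blow_ring_nonunit:
  assumes T: "T \<in> Spec (blow_ring (point_ring p) u)" and u: "u \<in> nonunits (point_ring p)" "u \<notin> units_of_ring T" "u \<noteq> 0"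
  obtains j where "T \<in> Spec (range (blow_chart p j))" "dev p j \<in> nonunits T"
proof -
  note loc = Spec_local[OF T blow_ring_subring]
  note S = local_ringD[OF loc(1)]
  have OT: "point_ring p \<subseteq> T" using loc(2) blow_ring_gens(1) by blast
  have xu: "x / u \<in> T" if "x \<in> nonunits (point_ring p)" for x using loc(2) blow_ring_gens(2)[OF that] by blast
  have un: "u \<in> nonunits T" using u OT by (auto simp: nonunits_def)
  obtain G where G: "\<And>k. G k \<in> point_ring p" "u = (\<Sum>k\<in>UNIV. dev p k * G k)"
    using point_ring_maximal_ideal[OF u(1)] by blast
  have du: "dev p k / u \<in> T" for k using xu dev_in_nonunits by blast
  have "\<exists>j. dev p j / u \<in> units_of_ring T"
  proof (rule ccontr)
    assume "\<not> ?thesis"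
    then have "dev p k / u \<in> nonunits T" for k using du by (auto simp: nonunits_def)
    then have 1: "G k * (dev p k / u) \<in> nonunits T" for k using S(3) G(1) OT by blast
    have "1 = (\<Sum>k\<in>UNIV. dev p k * G k) / u" using G(2) u(3) by simp
    also have "\<dots> = (\<Sum>k\<in>UNIV. G k * (dev p k / u))" by (simp add: sum_divide_distrib mult.commute)
    also have "\<dots> \<in> nonunits T" unfolding sum_3 by (intro S(2) 1)
    finally show False using units_1[OF S(1)] by (simp add: nonunits_def)
  qed
  then obtain j where j: "dev p j / u \<in> units_of_ring T" by blast
  have dj: "dev p j \<in> nonunits T" using S(3)[OF du[of j] un] u(3) by simp
  have cT: "range const \<subseteq> T" using const_in_point_ring OT by blast
  have ud: "inverse (dev p j / u) \<in> T" using j by (simp add: units_iff)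
  have "(dev p k / u) * inverse (dev p j / u) \<in> T" for k using is_subringD(4)[OF S(1) du ud] .
  then have kj: "dev p k / dev p j \<in> T" for k using u(3) by simp
  have BT: "range (blow_chart p j) \<subseteq> T"
    unfolding blow_chart_subset_iff[OF S(1)] using cT kj dj by (auto simp: nonunits_def)
  have "T \<in> Spec (range (blow_chart p j))"
  proof (rule Spec_transfer(1)[OF T[unfolded blow_ring_def] blow_chart_subring BT])
    fix L assume L: "is_subring L" "range (blow_chart p j) \<subseteq> L" and inv: "\<And>q. q \<in> L \<Longrightarrow> q \<in> units_of_ring T \<Longrightarrow> inverse q \<in> L"
    note SL = is_subringD[OF L(1)]
    have FL: "range to_fract \<subseteq> L" using blow_chart_gens(4) L(2) by blast
    have OL: "point_ring p \<subseteq> L" by (rule point_ring_subset_inverse_closed[OF L(1) FL inv OT])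
    have q: "x / dev p j \<in> L" if x: "x \<in> nonunits (point_ring p)" for x
    proof -
      obtain H where H: "\<And>k. H k \<in> point_ring p" "x = (\<Sum>k\<in>UNIV. dev p k * H k)"
        using point_ring_maximal_ideal[OF x] by blast
      have "x / dev p j = (\<Sum>k\<in>UNIV. (dev p k / dev p j) * H k)"
        unfolding H(2) by (simp add: sum_divide_distrib)
      moreover have "(dev p k / dev p j) * H k \<in> L" for k using SL(4) blow_chart_gens(2) L(2) H(1) OL by blast
      ultimately show ?thesis by (simp only: is_subring_sum[OF L(1)])
    qed
    have "inverse (dev p j / u) \<in> units_of_ring T" using j by (rule units_inverse)
    then have "inverse (u / dev p j) \<in> L" using inv[OF q[OF u(1)]] by (simp add: units_iff)
    then have "(x / dev p j) * inverse (u / dev p j) \<in> L" if "x \<in> nonunits (point_ring p)" for x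
      using q[OF that] SL(4) by blast
    then have "x / u \<in> L" if "x \<in> nonunits (point_ring p)" for x using that dev_nz[of p j] by simp
    then show "point_ring p \<union> {x / u |x. x \<in> nonunits (point_ring p)} \<subseteq> L" using OL by blast
  qed
  then show thesis using that dj by blast
qed

lemma blow_chart_devs_nonunits:
  assumes T: "is_local_ring T" "range (blow_chart p j) \<subseteq> T" and dj: "dev p j \<in> nonunits T"
  shows "dev p k \<in> nonunits T"
proof -
  have "dev p k / dev p j \<in> T" using blow_chart_gens(2) T(2) by blast
  then have "(dev p k / dev p j) * dev p j \<in> nonunits T" using local_ringD(3)[OF T(1)] dj by blast
  then show ?thesis using dev_nz[of p j] by simp
qed

lemma blow_chart_nonunit_dominates:
  assumes T: "is_local_ring T" "range (blow_chart p j) \<subseteq> T" and dj: "dev p j \<in> nonunits T"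
  shows "point_ring p \<subseteq> T"
  using point_ring_units_extend(1)[OF T(1), of p] blow_chart_gens(1,4) T(2) blow_chart_devs_nonunits[OF assms] by blast

lemma Spec_blow_chart_nonunit:
  assumes T: "T \<in> Spec (range (blow_chart p j))" and dj: "dev p j \<in> nonunits T"
  shows "T \<in> Spec (blow_ring (point_ring p) (dev p j))"
proof -
  note loc = Spec_local[OF T blow_chart_subring]
  note S = local_ringD[OF loc(1)]
  have OT: "point_ring p \<subseteq> T" by (rule blow_chart_nonunit_dominates[OF loc(1,2) dj])
  have q: "x / dev p j \<in> T" if x: "x \<in> nonunits (point_ring p)" for x
  proof -
    obtain H where H: "\<And>k. H k \<in> point_ring p" "x = (\<Sum>k\<in>UNIV. dev p k * H k)"
      using point_ring_maximal_ideal[OF x] by blast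
    have "x / dev p j = (\<Sum>k\<in>UNIV. (dev p k / dev p j) * H k)"
      unfolding H(2) by (simp add: sum_divide_distrib)
    moreover have "(dev p k / dev p j) * H k \<in> T" for k using is_subringD(4)[OF S(1)] blow_chart_gens(2) loc(2) H(1) OT by blast
    ultimately show ?thesis by (simp only: is_subring_sum[OF S(1)])
  qed
  have BT: "blow_ring (point_ring p) (dev p j) \<subseteq> T"
    unfolding blow_ring_def using OT q S(1) by (intro hull_minimal) auto
  show ?thesis
  proof (rule Spec_transfer(1)[OF T[unfolded blow_chart_hull] blow_ring_subring BT])
    fix L assume L: "is_subring L" "blow_ring (point_ring p) (dev p j) \<subseteq> L"
    have "dev p k / dev p j \<in> L" for k using blow_ring_gens(2)[OF dev_in_nonunits] L(2) by blast
    moreover have "range const \<subseteq> L" "dev p j \<in> L"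
      using blow_ring_gens(1) const_in_point_ring dev_in_nonunits[of p j] L(2) unfolding nonunits_def by blast+
    ultimately show "range const \<union> {dev p j, dev p (other1 j) / dev p j, dev p (other2 j) / dev p j} \<subseteq> L" by blast
  qed
qed

lemma Spec_blow_chart_unit:
  assumes T: "T \<in> Spec (range (blow_chart p j))" and dj: "dev p j \<notin> nonunits T"
  shows "T \<in> Spec (range to_fract)"
proof -
  note loc = Spec_local[OF T blow_chart_subring]
  have FT: "range to_fract \<subseteq> T" using loc(2) blow_chart_gens(4) by blast
  have u: "dev p j \<in> units_of_ring T" using dj loc(2) blow_chart_gens(3)[of p j j] by (auto simp: nonunits_def)
  show ?thesis
  proof (rule Spec_transfer(1)[OF T[unfolded blow_chart_hull] _ FT])
    show "is_subring (range to_fract :: K set)" using P1xP2_chart_subring[of 1 1] by (simp add: chart_11)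
    fix L assume L: "is_subring L" "range to_fract \<subseteq> L" and inv: "\<And>q. q \<in> L \<Longrightarrow> q \<in> units_of_ring T \<Longrightarrow> inverse q \<in> L"
    have d: "dev p k \<in> L" for k unfolding dev_to_fract using L(2) by blast
    have "dev p k / dev p j \<in> L" for k
      unfolding divide_inverse using d inv[OF d u] is_subringD(4)[OF L(1)] by blast
    moreover have "range const \<subseteq> L" using L(2) unfolding const_def by blast
    ultimately show "range const \<union> {dev p j, dev p (other1 j) / dev p j, dev p (other2 j) / dev p j} \<subseteq> L" using d by blast
  qed
qed

section \<open>The blowup\<close>

text \<open>
  The points are taken in the affine chart, with distinct images in the projective line.
\<close>
locale three_points =
  fixes pt :: "3 \<Rightarrow> point"
  assumes distinct: "i \<noteq> j \<Longrightarrow> fst (pt i) \<noteq> fst (pt j)"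
begin

definition X :: "K set set" where "X = blowup P1xP2 (range (\<lambda>i. point_ring (pt i)))"

lemma X_alt: "X = (P1xP2 - range (\<lambda>i. point_ring (pt i))) \<union>
    (\<Union>i. \<Union>u\<in>nonunits (point_ring (pt i)) - {0}. Spec (blow_ring (point_ring (pt i)) u))"
  unfolding X_def blowup_def blow_ring_def by blast

lemma to_fract_Spec_P1xP2: "T \<in> Spec (range to_fract) \<Longrightarrow> T \<in> P1xP2"
  unfolding P1xP2_iff using chart_11 by metis

text \<open>
  Every point of the blowup lies in one of the six charts of the product or in one of the nine
  charts around the exceptional divisors, all of which have polynomial coordinate rings.
\<close>
lemma X_cases:
  assumes T: "T \<in> X"
  obtains (base) i j where "T \<in> Spec (range (prod_chart i j))" "\<And>k. T \<noteq> point_ring (pt k)"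
  | (exc) i j where "T \<in> Spec (range (blow_chart (pt i) j))" "dev (pt i) j \<in> nonunits T"
proof -
  consider "T \<in> P1xP2" "\<And>k. T \<noteq> point_ring (pt k)"
    | i u where "u \<in> nonunits (point_ring (pt i))" "u \<noteq> 0" "T \<in> Spec (blow_ring (point_ring (pt i)) u)"
    using T unfolding X_alt by blast
  then show thesis
  proof cases
    case 1 then show thesis using base unfolding P1xP2_iff P1xP2_chart_range by blast
  next
    case (2 i u)
    show thesis
    proof (cases "u \<in> units_of_ring T")
      case True
      note t = Spec_blow_ring_unit[OF 2(3,1) True]
      have "T \<noteq> point_ring (pt k)" for k
      proof (cases "k = i")
        case False
        then show ?thesis using t(2) not_point_ring_subset[OF distinct[of i k]] by auto
      qed (use t(3) in simp)
      then show thesis using base[of 1 1] t(1) by (simp add: prod_chart_11)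
    next
      case False
      then show thesis using Spec_blow_ring_nonunit[OF 2(3,1) False 2(2)] exc by blast
    qed
  qed
qed

lemma X_exceptional: "T \<in> Spec (range (blow_chart (pt i) j)) \<Longrightarrow> dev (pt i) j \<in> nonunits T \<Longrightarrow> T \<in> X"
  using Spec_blow_chart_nonunit[of T "pt i" j] dev_in_nonunits[of "pt i" j] dev_nz[of "pt i" j] unfolding X_alt by blast

lemma X_base: "T \<in> P1xP2 \<Longrightarrow> (\<And>k. T \<noteq> point_ring (pt k)) \<Longrightarrow> T \<in> X"
  unfolding X_alt by (rule UnI1) auto

lemma dvr_in_X_prod:
  assumes "prime_elem \<pi>" shows "chart.dvr (prod_chart i j) \<pi> \<in> X"
proof -
  interpret C: chart "prod_chart i j" by (rule chart_prod_chart)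
  have "C.dvr \<pi> \<in> P1xP2" using C.dvr_in_Spec[OF assms] unfolding P1xP2_iff P1xP2_chart_range by blast
  then show ?thesis by (rule X_base) (rule C.dvr_not_point_ring[OF assms])
qed

lemma dvr_in_X_blow:
  assumes "prime_elem \<pi>" shows "chart.dvr (blow_chart (pt i) j) \<pi> \<in> X"
proof -
  interpret C: chart "blow_chart (pt i) j" by (rule chart_blow_chart)
  note T = C.dvr_in_Spec[OF assms]
  show ?thesis
  proof (cases "dev (pt i) j \<in> nonunits (C.dvr \<pi>)")
    case True
    then show ?thesis using X_exceptional[OF T] by blast
  next
    case False
    have "C.dvr \<pi> \<in> P1xP2" using to_fract_Spec_P1xP2[OF Spec_blow_chart_unit[OF T False]] .
    then show ?thesis by (rule X_base) (rule C.dvr_not_point_ring[OF assms])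
  qed
qed

lemma X_local: assumes "T \<in> X" shows "is_local_ring T" "range const \<subseteq> T"
proof -
  have "is_local_ring T \<and> range const \<subseteq> T" using assms
  proof (cases rule: X_cases)
    case (base i j)
    then show ?thesis using P1xP2_local[of T] unfolding P1xP2_iff P1xP2_chart_range by blast
  next
    case (exc i j)
    then show ?thesis using Spec_local[OF exc(1) blow_chart_subring] blow_chart_gens(1) by blast
  qed
  then show "is_local_ring T" "range const \<subseteq> T" by auto
qed

end

section \<open>Local equations of the hyperplane classes and of the exceptional divisors\<close>

text \<open>
  Two admissible dehomogenizing coordinates differ by a unit.
\<close>
lemma hyperplane_divisor_eq:
  fixes t :: "K ^ 'n::{finite,one}"
  assumes R: "R \<in> X" "is_subring R" and k: "t $ k \<noteq> 0" "\<And>l. t $ l / t $ k \<in> R"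
  shows "hyperplane_divisor X t R = unit_coset R (t $ 1 / t $ k)"
proof -
  have "unit_coset R (t $ 1 / t $ l) = unit_coset R (t $ 1 / t $ k)"
    if l: "t $ l \<noteq> 0" "\<forall>m. t $ m / t $ l \<in> R" for l
  proof -
    have "inverse (t $ k / t $ l) = t $ l / t $ k" by simp
    then have "t $ k / t $ l \<in> units_of_ring R" unfolding units_iff using k l by simp
    from unit_coset_eq[OF R(2) this, of "t $ 1 / t $ k"] show ?thesis using k(1) by simp
  qed
  note eq = this
  let ?S = "{l. t $ l \<noteq> 0 \<and> (\<forall>m. t $ m / t $ l \<in> R)}"
  have "(\<Union>l\<in>?S. unit_coset R (t $ 1 / t $ l)) = unit_coset R (t $ 1 / t $ k)"
  proof
    show "(\<Union>l\<in>?S. unit_coset R (t $ 1 / t $ l)) \<subseteq> unit_coset R (t $ 1 / t $ k)"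
      by (rule UN_least) (use eq in blast)
    have "k \<in> ?S" using k by blast
    then show "unit_coset R (t $ 1 / t $ k) \<subseteq> (\<Union>l\<in>?S. unit_coset R (t $ 1 / t $ l))" by (rule UN_upper)
  qed
  then show ?thesis unfolding hyperplane_divisor_def using R(1) by (simp only: if_False not_True_eq_False)
qed

lemma idealD: "is_ideal A I \<Longrightarrow> I \<subseteq> A" "is_ideal A I \<Longrightarrow> a \<in> A \<Longrightarrow> b \<in> I \<Longrightarrow> a * b \<in> I"
  unfolding is_ideal_def by blast+

context three_points
begin

abbreviation "\<O> k \<equiv> point_ring (pt k)"

definition H1 :: "K divisor" where "H1 = hyperplane_divisor X P1_coords"
definition H2 :: "K divisor" where "H2 = hyperplane_divisor X P2_coords"
definition E :: "3 \<Rightarrow> K divisor" where "E i = exceptional_divisor X (\<O> i)"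

lemmas X_subring = local_ringD(1)[OF X_local(1)]

lemma H1_local:
  assumes R: "R \<in> X"
  shows "Sf \<in> R \<Longrightarrow> H1 R = unit_coset R 1" "inverse Sf \<in> R \<Longrightarrow> H1 R = unit_coset R (inverse Sf)"
proof -
  note 1 = hyperplane_divisor_eq[OF R X_subring[OF R], of P1_coords, folded t1_def H1_def, OF t1_nz]
  show "H1 R = unit_coset R 1" if "Sf \<in> R"
  proof -
    have "t1 l / t1 1 \<in> R" for l using exhaust_2[of l] that is_subringD(2)[OF X_subring[OF R]] by (auto simp: t1_simps)
    then show ?thesis using 1[of 1] by (simp add: t1_simps)
  qed
  show "H1 R = unit_coset R (inverse Sf)" if "inverse Sf \<in> R"
  proof -
    have "t1 l / t1 2 \<in> R" for l
      using exhaust_2[of l] that is_subringD(2)[OF X_subring[OF R]] t1_nz[of 2] by (auto simp: t1_simps divide_inverse)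
    then show ?thesis using 1[of 2] by (simp only: t1_simps divide_inverse mult_1)
  qed
qed

lemma H2_local:
  assumes R: "R \<in> X" and j: "\<And>l. t2 l / t2 j \<in> R"
  shows "H2 R = unit_coset R (inverse (t2 j))"
  using hyperplane_divisor_eq[OF R X_subring[OF R], of P2_coords, folded t2_def H2_def, OF t2_nz j]
  by (simp only: t2_simps divide_inverse mult_1)

lemma H2_local_affine: "R \<in> X \<Longrightarrow> Xf \<in> R \<Longrightarrow> Yf \<in> R \<Longrightarrow> H2 R = unit_coset R 1"
proof -
  assume R: "R \<in> X" "Xf \<in> R" "Yf \<in> R"
  have "t2 l / t2 1 \<in> R" for l
    using exhaust_3[of l] R is_subringD(2)[OF X_subring[OF R(1)]] by (auto simp: t2_simps)
  from H2_local[OF R(1) this] show ?thesis by (simp add: t2_simps)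
qed

text \<open>
  Where a displacement is invertible, the maximal ideal of the point generates the unit ideal.
\<close>
lemma exceptional_unit:
  assumes R: "R \<in> X" and k: "inverse (dev (pt i) k) \<in> R"
  shows "E i R = unit_coset R 1"
proof -
  have u1: "unit_coset R 1 = units_of_ring R" by (auto simp: unit_coset_def)
  show ?thesis
  proof (cases "\<O> i \<subseteq> R")
    case False
    then show ?thesis using R by (simp add: E_def exceptional_divisor_def u1)
  next
    case True
    note S = is_subringD[OF X_subring[OF R]]
    have N: "nonunits (\<O> i) \<subseteq> R" using True by (auto simp: nonunits_def)
    note I = is_ideal_hull[OF N X_subring[OF R]]
    have sub: "is_ideal R hull nonunits (\<O> i) \<subseteq> R" by (rule idealD(1)[OF I])
    have "dev (pt i) k \<in> is_ideal R hull nonunits (\<O> i)" by (rule hull_inc[OF dev_in_nonunits])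
    then have "inverse (dev (pt i) k) * dev (pt i) k \<in> is_ideal R hull nonunits (\<O> i)" by (rule idealD(2)[OF I k])
    then have "1 \<in> is_ideal R hull nonunits (\<O> i)" using dev_nz[of "pt i" k] by simp
    then have "r * 1 \<in> is_ideal R hull nonunits (\<O> i)" if "r \<in> R" for r using that by (intro idealD(2)[OF I])
    then have hull: "is_ideal R hull nonunits (\<O> i) = R" using sub by auto
    have "(\<lambda>r. g * r) ` R = R \<longleftrightarrow> g \<in> units_of_ring R" if "g \<noteq> 0" for g
    proof
      assume e: "(\<lambda>r. g * r) ` R = R"
      then have "1 \<in> (\<lambda>r. g * r) ` R" "g * 1 \<in> R" using S(2) by blast+
      then obtain r where "1 = g * r" "r \<in> R" by blast
      then show "g \<in> units_of_ring R" using \<open>g * 1 \<in> R\<close> that by (auto simp: units_iff inverse_unique)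
    next
      assume g: "g \<in> units_of_ring R"
      then have "r = g * (inverse g * r)" "inverse g * r \<in> R" if "r \<in> R" for r using that S(4) by (auto simp: units_iff)
      then have "R \<subseteq> (\<lambda>r. g * r) ` R" by blast
      then show "(\<lambda>r. g * r) ` R = R" using g S(4) by (auto simp: units_iff)
    qed
    then have "g \<noteq> 0 \<and> (\<lambda>r. g * r) ` R = R \<longleftrightarrow> g \<in> units_of_ring R" for g
      using units_iff[of g R] by blast
    then have "{g. g \<noteq> 0 \<and> (\<lambda>r. g * r) ` R = R} = units_of_ring R" by blast
    then show ?thesis using R True by (simp add: E_def exceptional_divisor_def u1 hull)
  qed
qed

text \<open>
  The maximal ideal of the point is generated by the displacements, all of which are multiples of
  the \<open>j\<close>-th one in this chart.
\<close>
lemma exceptional_chart: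
  assumes R: "R \<in> X" and B: "range (blow_chart (pt i) j) \<subseteq> R"
  shows "E i R = unit_coset R (dev (pt i) j)"
proof (cases "dev (pt i) j \<in> nonunits R")
  case False
  then have u: "dev (pt i) j \<in> units_of_ring R" using B blow_chart_gens(3)[of "pt i" j j] by (auto simp: nonunits_def)
  then have "E i R = unit_coset R 1" using exceptional_unit[OF R] by (auto simp: units_iff)
  also have "\<dots> = unit_coset R (dev (pt i) j)" using unit_coset_eq[OF X_subring[OF R] u, of 1] by simp
  finally show ?thesis .
next
  case True
  let ?w = "dev (pt i) j"
  note L = X_local(1)[OF R]
  note S = is_subringD[OF X_subring[OF R]]
  have OR: "\<O> i \<subseteq> R" by (rule blow_chart_nonunit_dominates[OF L B True])
  have N: "nonunits (\<O> i) \<subseteq> R" using OR by (auto simp: nonunits_def)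
  note I = is_ideal_hull[OF N X_subring[OF R]]
  have hull: "is_ideal R hull nonunits (\<O> i) = (\<lambda>r. ?w * r) ` R"
  proof
    have ideal: "is_ideal R ((\<lambda>r. ?w * r) ` R)"
      unfolding is_ideal_def
    proof (intro conjI ballI)
      show "(\<lambda>r. ?w * r) ` R \<subseteq> R" using True S(4) by (auto simp: nonunits_def)
      show "0 \<in> (\<lambda>r. ?w * r) ` R" using S(1) by (auto intro!: image_eqI[of _ _ 0])
      show "a + b \<in> (\<lambda>r. ?w * r) ` R" if ab: "a \<in> (\<lambda>r. ?w * r) ` R" "b \<in> (\<lambda>r. ?w * r) ` R" for a b
      proof -
        obtain r s where "a = ?w * r" "b = ?w * s" "r \<in> R" "s \<in> R" using ab by blast
        then show ?thesis using S(6) by (intro image_eqI[of _ _ "r + s"]) (auto simp: distrib_left)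
      qed
      show "a * b \<in> (\<lambda>r. ?w * r) ` R" if ab: "a \<in> R" "b \<in> (\<lambda>r. ?w * r) ` R" for a b
      proof -
        obtain s where "b = ?w * s" "s \<in> R" using ab by blast
        then show ?thesis using S(4) ab(1) by (intro image_eqI[of _ _ "a * s"]) auto
      qed
    qed
    have "x \<in> (\<lambda>r. ?w * r) ` R" if x: "x \<in> nonunits (\<O> i)" for x
    proof -
      obtain H where H: "\<And>k. H k \<in> \<O> i" "x = (\<Sum>k\<in>UNIV. dev (pt i) k * H k)"
        using point_ring_maximal_ideal[OF x] by blast
      have "x = ?w * (\<Sum>k\<in>UNIV. (dev (pt i) k / ?w) * H k)"
        unfolding H(2) using dev_nz[of "pt i" j] by (simp add: sum_distrib_left)
      moreover have "(dev (pt i) k / ?w) * H k \<in> R" for k using S(4) blow_chart_gens(2) B H(1) OR by blast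
      ultimately show ?thesis using is_subring_sum[OF X_subring[OF R], of UNIV "\<lambda>k. (dev (pt i) k / ?w) * H k"] by blast
    qed
    then show "is_ideal R hull nonunits (\<O> i) \<subseteq> (\<lambda>r. ?w * r) ` R"
      using hull_minimal[of "nonunits (\<O> i)" "(\<lambda>r. ?w * r) ` R" "is_ideal R"] ideal by blast
    have "?w \<in> is_ideal R hull nonunits (\<O> i)" by (rule hull_inc[OF dev_in_nonunits])
    then have "r * ?w \<in> is_ideal R hull nonunits (\<O> i)" if "r \<in> R" for r using that by (intro idealD(2)[OF I])
    then show "(\<lambda>r. ?w * r) ` R \<subseteq> is_ideal R hull nonunits (\<O> i)" by (auto simp: mult.commute)
  qed
  have A: "(\<lambda>r. g * r) ` R = (\<lambda>r. ?w * r) ` R \<longleftrightarrow> g \<in> unit_coset R ?w" if g: "g \<noteq> 0" for g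
  proof
    assume e: "(\<lambda>r. g * r) ` R = (\<lambda>r. ?w * r) ` R"
    then have "g * 1 \<in> (\<lambda>r. ?w * r) ` R" "?w * 1 \<in> (\<lambda>r. g * r) ` R" using S(2) by blast+
    then obtain r s where rs: "g = ?w * r" "r \<in> R" "?w = g * s" "s \<in> R" unfolding mult_1_right by (elim imageE)
    then have "?w * (r * s) = ?w * 1" by (metis mult.assoc mult_1_right)
    then have "r * s = 1" using dev_nz[of "pt i" j] mult_left_cancel by blast
    then have "inverse r = s" "r \<noteq> 0" by (auto intro: inverse_unique)
    then have "r \<in> units_of_ring R" using rs by (simp add: units_iff)
    then show "g \<in> unit_coset R ?w" using rs(1) by (auto simp: unit_coset_def)
  next
    assume "g \<in> unit_coset R ?w"
    then have "\<exists>u\<in>units_of_ring R. g = ?w * u" unfolding unit_coset_def image_iff .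
    then obtain u where u': "g = ?w * u" "u \<in> units_of_ring R" by (elim bexE)
    have u: "g = ?w * u" "u \<in> R" "u \<noteq> 0" "inverse u \<in> R" using u' unfolding units_iff by simp_all
    show "(\<lambda>r. g * r) ` R = (\<lambda>r. ?w * r) ` R"
    proof
      show "(\<lambda>r. g * r) ` R \<subseteq> (\<lambda>r. ?w * r) ` R" using u S(4) by (auto simp: mult.assoc)
      have e: "?w * r = g * (inverse u * r)" for r using u by simp
      show "(\<lambda>r. ?w * r) ` R \<subseteq> (\<lambda>r. g * r) ` R"
      proof (rule image_subsetI)
        fix r assume "r \<in> R"
        then have "inverse u * r \<in> R" by (rule S(4)[OF u(4)])
        then show "?w * r \<in> (\<lambda>r. g * r) ` R" unfolding e[of r] by (rule imageI)
      qed
    qed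
  qed
  have B: "g \<noteq> 0" if "g \<in> unit_coset R ?w" for g using that dev_nz[of "pt i" j] by (auto simp: unit_coset_def units_iff)
  have "g \<noteq> 0 \<and> (\<lambda>r. g * r) ` R = (\<lambda>r. ?w * r) ` R \<longleftrightarrow> g \<in> unit_coset R ?w" for g
    using A[of g] B[of g] by argo
  then have "{g. g \<noteq> 0 \<and> (\<lambda>r. g * r) ` R = (\<lambda>r. ?w * r) ` R} = unit_coset R ?w"
    by (simp only: Collect_mem_eq)
  then show ?thesis using R OR by (simp add: E_def exceptional_divisor_def hull)
qed

lemma inverse_dev_other:
  assumes T: "is_local_ring T" "range const \<subseteq> T" and d: "dev (pt i) 1 \<in> nonunits T" and ik: "k \<noteq> i"
  shows "inverse (dev (pt k) 1) \<in> T"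
proof -
  have "const (fst (pt i) - fst (pt k)) \<in> units_of_ring T"
    using distinct[of i k] ik by (intro is_subringD_const_unit[OF T(2)]) auto
  from local_ringD(5)[OF T(1) this d] have "dev (pt k) 1 \<in> units_of_ring T"
    by (simp add: dev_def algebra_simps)
  then show ?thesis by (simp add: units_iff)
qed

text \<open>
  The hypotheses of the two preceding descriptions of the exceptional divisor cover the blowup.
  On another exceptional divisor, over \<open>p\<^sub>a\<close>, the displacement from \<open>p\<^sub>i\<close> in the direction of the projective line
  is a unit, since the points have distinct images there.
\<close>
lemma E_dichotomy:
  assumes R: "R \<in> X"
  obtains (away) k where "inverse (dev (pt i) k) \<in> R" | (over) j where "range (blow_chart (pt i) j) \<subseteq> R"
  using R
proof (cases rule: X_cases)
  case (base a b)
  then have "R \<in> P1xP2" unfolding P1xP2_iff P1xP2_chart_range by blast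
  then show thesis using P1xP2_dichotomy[of R "pt i"] base(2) away by blast
next
  case (exc a j)
  note loc = Spec_local[OF exc(1) blow_chart_subring]
  show thesis
  proof (cases "a = i")
    case True
    then show thesis using over loc(2) by blast
  next
    case False
    have "dev (pt a) 1 \<in> nonunits R" by (rule blow_chart_devs_nonunits[OF loc(1,2) exc(2)])
    then show thesis using inverse_dev_other[OF X_local[OF R], of a i] False away by auto
  qed
qed

lemma H1_dichotomy:
  assumes R: "R \<in> X" obtains "Sf \<in> R" | "inverse Sf \<in> R"
  using R
proof (cases rule: X_cases)
  case (base i j)
  then have "P1xP2_chart i j \<subseteq> R" using Spec_local(2)[of R, OF _ P1xP2_chart_subring] by (simp add: P1xP2_chart_range)
  then have g: "t1 k / t1 i \<in> R" for k using P1xP2_chart_gens(2) by blast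
  from exhaust_2[of i] show thesis
  proof
    assume "i = 1" then show thesis using g[of 2] that(1) by (simp add: t1_simps)
  next
    assume "i = 2" then show thesis using g[of 1] that(2) by (simp only: t1_simps divide_inverse mult_1)
  qed
next
  case (exc i j)
  then have "range to_fract \<subseteq> R" using Spec_local(2)[OF exc(1) blow_chart_subring] blow_chart_gens(4) by blast
  then show thesis using that(1) by blast
qed

lemma H2_dichotomy:
  assumes R: "R \<in> X" obtains j where "\<And>l. t2 l / t2 j \<in> R"
  using R
proof (cases rule: X_cases)
  case (base i j)
  then have "P1xP2_chart i j \<subseteq> R" using Spec_local(2)[of R, OF _ P1xP2_chart_subring] by (simp add: P1xP2_chart_range)
  then show thesis using P1xP2_chart_gens(3) that[of j] by blast
next
  case (exc i j)
  then have F: "range to_fract \<subseteq> R" using Spec_local(2)[OF exc(1) blow_chart_subring] blow_chart_gens(4) by blast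
  have "t2 l \<in> R" for l
    using exhaust_3[of l] F is_subringD(2)[OF X_subring[OF R]] by (auto simp: t2_simps)
  then show thesis using that[of 1] by (simp add: t2_simps)
qed

end

section \<open>Generic points of prime divisors\<close>

text \<open>
  The local ring at \<open>\<pi> = 0\<close> is contained in the one at \<open>\<rho> = 0\<close>, because \<open>\<rho>\<close> lies in the
  contracted prime; both are maximal subrings of the field.
\<close>
lemma dvr_eqI:
  assumes c: "chart \<phi>" "chart \<psi>" and \<pi>: "prime_elem \<pi>" and \<rho>: "prime_elem \<rho>"
    and loc: "chart.dvr \<phi> \<pi> = localization (range \<psi>) (range \<psi> \<inter> nonunits (chart.dvr \<phi> \<pi>))"
    and n: "\<psi> \<rho> \<in> nonunits (chart.dvr \<phi> \<pi>)"
  shows "chart.dvr \<phi> \<pi> = chart.dvr \<psi> \<rho>"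
proof -
  interpret C: chart \<phi> by (rule c(1))
  interpret D: chart \<psi> by (rule c(2))
  let ?V = "C.dvr \<pi>"
  have sub: "?V \<subseteq> D.dvr \<rho>"
  proof
    fix q assume "q \<in> ?V"
    then obtain a b where q: "q = a / b" "a \<in> range \<psi>" "b \<in> range \<psi>" "b \<notin> range \<psi> \<inter> nonunits ?V"
      by (subst (asm) loc) (auto simp only: localization_iff)
    then obtain n d where nd: "a = \<psi> n" "b = \<psi> d" by blast
    have "\<not> \<rho> dvd d"
    proof
      assume "\<rho> dvd d"
      then obtain e where e: "d = \<rho> * e" by (rule dvdE)
      have "\<psi> e / 1 \<in> localization (range \<psi>) (range \<psi> \<inter> nonunits ?V)"
        using D.homs(1) local_ringD(1)[OF C.dvr_local[OF \<pi>]]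
        by (intro localizationI) (auto simp: nonunits_def units_1 intro: range_eqI[of _ _ 1])
      then have "\<psi> e \<in> ?V" using loc by simp
      then have "\<psi> e * \<psi> \<rho> \<in> nonunits ?V" by (rule local_ringD(3)[OF C.dvr_local[OF \<pi>] _ n])
      then show False using q(3,4) nd(2) e by (simp add: D.homs mult.commute)
    qed
    then show "q \<in> D.dvr \<rho>" unfolding q(1) nd D.dvr_def by blast
  qed
  have "inverse (\<psi> \<rho>) \<notin> D.dvr \<rho>"
  proof
    assume "inverse (\<psi> \<rho>) \<in> D.dvr \<rho>"
    then have "\<psi> \<rho> \<in> units_of_ring (D.dvr \<rho>)"
      using D.range_subset_dvr[OF \<rho>] \<rho> by (auto simp: units_iff prime_elem_def)
    then show False using D.dvr_unit_iff(1)[OF \<rho>, of \<rho>] by simp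
  qed
  then have "D.dvr \<rho> \<noteq> UNIV" by blast
  from C.dvr_maximal[OF \<pi> sub D.dvr_subring[OF \<rho>] this] show ?thesis by simp
qed

lemma chart_to_fract: "chart (to_fract :: poly3 \<Rightarrow> K)"
  using chart_prod_chart[of 1 1] by (simp add: prod_chart_11)

lemma prod_chart_vars:
  "prod_chart i j S3 = affine_coord1 i" "prod_chart i j X3 = affine_coord2 j" "prod_chart i j Y3 = affine_coord3 j"
  unfolding prod_chart_def by (rule eval3_gens[OF ring_hom_const])+

lemma blow_chart_vars:
  "blow_chart p j S3 = dev p j" "blow_chart p j X3 = dev p (other1 j) / dev p j" "blow_chart p j Y3 = dev p (other2 j) / dev p j"
  unfolding blow_chart_def by (rule eval3_gens[OF ring_hom_const])+

lemma affine_coord_simps: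
  "affine_coord1 1 = Sf" "affine_coord1 2 = inverse Sf"
  "affine_coord2 1 = Xf" "affine_coord2 2 = inverse Xf" "affine_coord2 3 = inverse Yf"
  "affine_coord3 1 = Yf" "affine_coord3 2 = Yf / Xf" "affine_coord3 3 = Xf / Yf"
  by (simp_all only: affine_coord1_def affine_coord2_def affine_coord3_def if_True if_False three_ne simp_thms)

lemma prod_chart_subset_iff:
  assumes L: "is_subring L"
  shows "range (prod_chart i j) \<subseteq> L \<longleftrightarrow>
    range const \<subseteq> L \<and> affine_coord1 i \<in> L \<and> affine_coord2 j \<in> L \<and> affine_coord3 j \<in> L"
  unfolding prod_chart_def range_eval3_eq_hull subset_hull[of is_subring, OF L] by blast

lemma to_fract_subset_iff:
  assumes L: "is_subring L"
  shows "range to_fract \<subseteq> L \<longleftrightarrow> range const \<subseteq> L \<and> Sf \<in> L \<and> Xf \<in> L \<and> Yf \<in> L"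
  using prod_chart_subset_iff[OF L, of 1 1] by (simp only: prod_chart_11 affine_coord_simps)

lemma prime_not_dvd_other_var:
  assumes "prime_elem (\<pi>::poly3)" "\<pi> dvd v" "prime_elem v" "\<not> v dvd w" shows "\<not> \<pi> dvd w"
  using prime_elem_dvd_prime_elem[OF assms(1,3,2)] assms(4) dvd_trans by blast

text \<open>
  The local rings at the generic points of the prime divisors that are missing from the affine
  chart: the fibre at infinity
  of the projection to the line, the preimage of the line at infinity of the plane, and the exceptional divisors.
\<close>
definition V1 :: "K set" where "V1 = chart.dvr (prod_chart 2 1) S3"
definition V2 :: "K set" where "V2 = chart.dvr (prod_chart 1 2) X3"
definition VE :: "point \<Rightarrow> K set" where "VE p = chart.dvr (blow_chart p 1) S3"

text \<open>
  If a coordinate is infinite along a prime divisor of a chart, then the prime divisor is the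
  corresponding boundary divisor, and the remaining coordinates, being different variables of the chart, are
  units along it. This allows the change to the chart in which the boundary divisor was defined.
\<close>
lemma dvr_prod_chart_cases:
  assumes \<pi>: "prime_elem \<pi>" and V: "V = chart.dvr (prod_chart i j) \<pi>"
  shows "V \<in> Spec (range to_fract) \<or> V = V1 \<or> V = V2"
proof (cases "range to_fract \<subseteq> V")
  case True
  interpret C: chart "prod_chart i j" by (rule chart_prod_chart)
  have "V \<in> Spec (P1xP2_chart i j)" using C.dvr_in_Spec[OF \<pi>] V by (simp add: P1xP2_chart_range)
  then have "V \<in> Spec (P1xP2_chart 1 1)" by (rule P1xP2_chart_transfer(1)) (simp add: chart_11 True)
  then show ?thesis by (simp add: chart_11)
next
  case False
  interpret C: chart "prod_chart i j" by (rule chart_prod_chart)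
  have VS: "V \<in> Spec (P1xP2_chart i j)" using C.dvr_in_Spec[OF \<pi>] V by (simp add: P1xP2_chart_range)
  have S: "is_subring V" using C.dvr_subring[OF \<pi>] V by simp
  note L = C.dvr_local[OF \<pi>, folded V]
  have BV: "range (prod_chart i j) \<subseteq> V" using C.range_subset_dvr[OF \<pi>] V by simp
  note in_V = BV[unfolded prod_chart_subset_iff[OF S]]
  have cV: "range const \<subseteq> V" and a1: "affine_coord1 i \<in> V" and a2: "affine_coord2 j \<in> V" and a3: "affine_coord3 j \<in> V"
    using in_V by blast+
  have transfer: "V = chart.dvr (prod_chart i' j') \<rho>"
    if sub: "range (prod_chart i' j') \<subseteq> V" and \<rho>: "prime_elem \<rho>" and n: "prod_chart i' j' \<rho> \<in> nonunits V" for i' j' \<rho>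
    unfolding V
  proof (rule dvr_eqI[OF chart_prod_chart chart_prod_chart \<pi> \<rho>])
    show "C.dvr \<pi> = localization (range (prod_chart i' j')) (range (prod_chart i' j') \<inter> nonunits (C.dvr \<pi>))"
      using P1xP2_chart_transfer(2)[OF VS, of i' j'] sub V by (simp only: P1xP2_chart_range)
    show "prod_chart i' j' \<rho> \<in> nonunits (C.dvr \<pi>)" using n V by simp
  qed
  have nu: "inverse z \<in> nonunits V" if "inverse z \<in> V" "z \<notin> V" for z
    using that by (auto simp: nonunits_def units_iff)
  have jc: "j = 1 \<or> j = 2 \<or> j = 3" by (rule exhaust_3)
  have YX: "Yf \<in> V" if "Xf \<in> V" "j = 2"
    using is_subringD(4)[OF S that(1), of "Yf / Xf"] a3 that(2) by (simp add: affine_coord_simps)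
  have XY: "Xf \<in> V" if "Yf \<in> V" "j = 3"
    using is_subringD(4)[OF S that(1), of "Xf / Yf"] a3 that(2) by (simp add: affine_coord_simps)
  show ?thesis
  proof (cases "Sf \<in> V")
    case False
    then have i: "i = 2" using a1 exhaust_2[of i] by (auto simp: affine_coord_simps)
    have inS: "inverse Sf \<in> V" using a1 unfolding i affine_coord_simps .
    have n: "inverse Sf \<in> nonunits V" by (rule nu[OF inS False])
    then have "prod_chart i j S3 \<in> nonunits (C.dvr \<pi>)" using i V by (simp only: prod_chart_vars affine_coord_simps)
    then have d: "\<pi> dvd S3" using C.dvr_unit_iff(2)[OF \<pi>] by blast
    have "\<not> \<pi> dvd X3" by (rule prime_not_dvd_other_var[OF \<pi> d prime_elem_vars(1) not_dvd_vars(1)])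
    then have "prod_chart i j X3 \<in> units_of_ring (C.dvr \<pi>)" using C.dvr_unit_iff(1)[OF \<pi>] by blast
    then have "inverse (affine_coord2 j) \<in> V" using V by (simp add: prod_chart_vars units_iff)
    then have "Xf \<in> V \<and> Yf \<in> V"
      using jc a2 a3 YX XY by (auto simp: affine_coord_simps)
    then have "range (prod_chart 2 1) \<subseteq> V"
      unfolding prod_chart_subset_iff[OF S] using cV inS by (simp add: affine_coord_simps)
    from transfer[OF this prime_elem_vars(1)] show ?thesis
      using n unfolding V1_def prod_chart_vars affine_coord_simps by blast
  next
    case True
    then have notXY: "\<not> (Xf \<in> V \<and> Yf \<in> V)" using False to_fract_subset_iff[OF S] cV by blast
    have sub: "range (prod_chart 1 j) \<subseteq> V"
      unfolding prod_chart_subset_iff[OF S] using cV True a2 a3 by (simp add: affine_coord_simps)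
    have "j \<noteq> 1" using notXY a2 a3 by (auto simp: affine_coord_simps)
    with jc show ?thesis
    proof (elim disjE)
      assume j: "j = 2"
      have "inverse Xf \<in> nonunits V" using nu[of Xf] a2 notXY YX j by (auto simp: affine_coord_simps)
      from transfer[OF sub[unfolded j] prime_elem_vars(2)] this show ?thesis
        unfolding V2_def prod_chart_vars affine_coord_simps by blast
    next
      assume j: "j = 3"
      \<comment> \<open>The divisor appears as \<open>1/y = 0\<close>. Along it \<open>x/y\<close> is a unit, so that \<open>1/x = 0\<close> is an equation as well.\<close>
      have n: "inverse Yf \<in> nonunits V" using nu[of Yf] a2 notXY XY j by (auto simp: affine_coord_simps)
      then have V3: "V = chart.dvr (prod_chart 1 3) X3"
        using transfer[OF sub[unfolded j] prime_elem_vars(2)] unfolding prod_chart_vars affine_coord_simps by blast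
      interpret D: chart "prod_chart 1 3" by (rule chart_prod_chart)
      have "prod_chart 1 3 Y3 \<in> units_of_ring V"
        unfolding V3 D.dvr_unit_iff(1)[OF prime_elem_vars(2)] by (rule not_dvd_vars)
      then have "inverse (Xf / Yf) \<in> V" unfolding prod_chart_vars affine_coord_simps units_iff by blast
      then have YX': "Yf / Xf \<in> V" by simp
      have "(Yf / Xf) * inverse Yf \<in> nonunits V" by (rule local_ringD(3)[OF L YX' n])
      then have n': "inverse Xf \<in> nonunits V" by (simp add: field_simps)
      then have "range (prod_chart 1 2) \<subseteq> V"
        unfolding prod_chart_subset_iff[OF S] affine_coord_simps using cV True YX' by (auto simp: nonunits_def)
      from transfer[OF this prime_elem_vars(2)] n' show ?thesis
        unfolding V2_def prod_chart_vars affine_coord_simps by blast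
    qed (use \<open>j \<noteq> 1\<close> in simp)
  qed
qed

lemma dvr_blow_chart_cases:
  assumes \<pi>: "prime_elem \<pi>" and V: "V = chart.dvr (blow_chart p j) \<pi>"
  shows "V \<in> Spec (range to_fract) \<or> V = VE p"
proof -
  interpret C: chart "blow_chart p j" by (rule chart_blow_chart)
  have VS: "V \<in> Spec (range (blow_chart p j))" using C.dvr_in_Spec[OF \<pi>] V by simp
  have S: "is_subring V" using C.dvr_subring[OF \<pi>] V by simp
  have BV: "range (blow_chart p j) \<subseteq> V" using C.range_subset_dvr[OF \<pi>] V by simp
  show ?thesis
  proof (cases "dev p j \<in> nonunits V")
    case False
    then show ?thesis using Spec_blow_chart_unit[OF VS] by blast
  next
    case True
    then have d: "\<pi> dvd S3" using C.dvr_unit_iff(2)[OF \<pi>, of S3] V by (simp only: blow_chart_vars)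
    have u: "dev p 1 / dev p j \<in> units_of_ring V"
    proof (cases "j = 1")
      case True
      then show ?thesis using units_1[OF S] dev_nz[of p 1] by simp
    next
      case False
      have "\<not> \<pi> dvd X3" by (rule prime_not_dvd_other_var[OF \<pi> d prime_elem_vars(1) not_dvd_vars(1)])
      then have "blow_chart p j X3 \<in> units_of_ring V" using C.dvr_unit_iff(1)[OF \<pi>] V by blast
      then show ?thesis using False by (simp add: blow_chart_vars other1_def)
    qed
    have q: "dev p k / dev p j \<in> V" for k using BV blow_chart_gens(2) by blast
    have iu: "inverse (dev p 1 / dev p j) \<in> V" using u by (simp add: units_iff)
    have "(dev p k / dev p j) * inverse (dev p 1 / dev p j) \<in> V" for k by (rule is_subringD(4)[OF S q iu])
    then have q1: "dev p k / dev p 1 \<in> V" for k using dev_nz[of p j] by simp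
    have sub: "range (blow_chart p 1) \<subseteq> V"
      unfolding blow_chart_subset_iff[OF S] using q1 BV blow_chart_gens(1)[of p j] blow_chart_gens(3)[of p 1 j] by blast
    have "V = localization (range (blow_chart p 1)) (range (blow_chart p 1) \<inter> nonunits V)"
    proof (rule Spec_transfer(2)[OF VS[unfolded blow_chart_hull] blow_chart_subring sub])
      fix L assume L: "is_subring L" "range (blow_chart p 1) \<subseteq> L" and inv: "\<And>q. q \<in> L \<Longrightarrow> q \<in> units_of_ring V \<Longrightarrow> inverse q \<in> L"
      have "dev p j / dev p 1 \<in> L" using blow_chart_gens(2) L(2) by blast
      moreover have "dev p j / dev p 1 \<in> units_of_ring V" using units_inverse[OF u] by simp
      ultimately have iL: "inverse (dev p j / dev p 1) \<in> L" by (rule inv)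
      have "dev p k / dev p 1 \<in> L" for k using blow_chart_gens(2) L(2) by blast
      then have "(dev p k / dev p 1) * inverse (dev p j / dev p 1) \<in> L" for k using iL by (intro is_subringD(4)[OF L(1)])
      then have "dev p k / dev p j \<in> L" for k using dev_nz[of p 1] by simp
      moreover have "range const \<subseteq> L" "dev p j \<in> L" using blow_chart_gens(1)[of p 1] blow_chart_gens(3)[of p j 1] L(2) by blast+
      ultimately show "range const \<union> {dev p j, dev p (other1 j) / dev p j, dev p (other2 j) / dev p j} \<subseteq> L" by blast
    qed
    moreover have "blow_chart p 1 S3 \<in> nonunits V"
    proof -
      have "(dev p 1 / dev p j) * dev p j \<in> nonunits V"
        using local_ringD(3)[OF C.dvr_local[OF \<pi>, folded V] q True] .
      then show ?thesis using dev_nz[of p j] by (simp add: blow_chart_vars)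
    qed
    ultimately have "V = VE p"
      unfolding VE_def V by (intro dvr_eqI[OF chart_blow_chart chart_blow_chart \<pi> prime_elem_vars(1)])
    then show ?thesis by blast
  qed
qed

section \<open>Cartier divisors as local equations, and their numerical classes\<close>

context three_points
begin

text \<open>
  The divisor with local equation \<open>g R\<close> at the point \<open>R\<close>.
\<close>
definition dv :: "(K set \<Rightarrow> K) \<Rightarrow> K divisor" where
  "dv g = (\<lambda>R. if R \<in> X then unit_coset R (g R) else {})"

text \<open>
  The condition on a family of local equations that makes \<open>dv g\<close> a Cartier divisor: near every
  point one equation serves up to units.
\<close>
definition cart :: "(K set \<Rightarrow> K) \<Rightarrow> bool" where
  "cart g \<longleftrightarrow> (\<forall>R\<in>X. g R \<noteq> 0 \<and> (\<exists>F f. finite F \<and> F \<subseteq> R \<and> f \<noteq> 0 \<and>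
     (\<forall>S\<in>X. F \<subseteq> S \<longrightarrow> g S / f \<in> units_of_ring S)))"

definition eqn :: "K divisor \<Rightarrow> K set \<Rightarrow> K" where
  "eqn D R = (SOME f. f \<in> D R)"

lemma cartD:
  assumes "cart g" "R \<in> X"
  shows "g R \<noteq> 0"
    "\<exists>F f. finite F \<and> F \<subseteq> R \<and> f \<noteq> 0 \<and> (\<forall>S\<in>X. F \<subseteq> S \<longrightarrow> g S / f \<in> units_of_ring S)"
  using assms unfolding cart_def by blast+

lemma cartier_divisorI:
  assumes "\<And>R. R \<notin> X \<Longrightarrow> D R = {}"
    and "\<And>R. R \<in> X \<Longrightarrow> \<exists>F f. finite F \<and> F \<subseteq> R \<and> f \<noteq> 0 \<and> (\<forall>S\<in>X. F \<subseteq> S \<longrightarrow> D S = unit_coset S f)"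
  shows "cartier_divisor X D"
  unfolding cartier_divisor_def by (intro conjI allI impI ballI assms)

lemma cartier_dv: assumes "cart g" shows "cartier_divisor X (dv g)"
proof (rule cartier_divisorI)
  fix R assume "R \<in> X"
  from cartD(2)[OF assms this] obtain F f where F: "finite F" "F \<subseteq> R" "f \<noteq> 0"
    "\<forall>S\<in>X. F \<subseteq> S \<longrightarrow> g S / f \<in> units_of_ring S" by (elim exE conjE)
  have "dv g S = unit_coset S f" if "S \<in> X" "F \<subseteq> S" for S
    unfolding dv_def using that F(4) unit_coset_eq_iff[OF X_subring[OF that(1)] cartD(1)[OF assms that(1)] F(3)] by simp
  then show "\<exists>F f. finite F \<and> F \<subseteq> R \<and> f \<noteq> 0 \<and> (\<forall>S\<in>X. F \<subseteq> S \<longrightarrow> dv g S = unit_coset S f)"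
    using F(1-3) by blast
qed (simp add: dv_def)

lemma eqn_local:
  assumes R: "R \<in> X" and D: "D R = unit_coset R f" and f: "f \<noteq> 0"
  shows "eqn D R / f \<in> units_of_ring R" "eqn D R \<noteq> 0"
proof -
  have "f * 1 \<in> D R" unfolding D unit_coset_def by (rule imageI[OF units_1[OF X_subring[OF R]]])
  then have "eqn D R \<in> D R" unfolding eqn_def by (rule someI)
  then have "\<exists>u\<in>units_of_ring R. eqn D R = f * u" unfolding D unit_coset_def image_iff .
  then obtain u where "u \<in> units_of_ring R" "eqn D R = f * u" by (elim bexE)
  then show "eqn D R / f \<in> units_of_ring R" "eqn D R \<noteq> 0" using f by (simp_all add: units_iff)
qed

lemma cart_eqn: assumes D: "cartier_divisor X D" shows "cart (eqn D)" "dv (eqn D) = D"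
proof -
  have 1: "\<exists>F f. finite F \<and> F \<subseteq> R \<and> f \<noteq> 0 \<and> (\<forall>S\<in>X. F \<subseteq> S \<longrightarrow> D S = unit_coset S f)" if "R \<in> X" for R
    using D[unfolded cartier_divisor_def, THEN conjunct2, rule_format, OF that] .
  have loc: "\<exists>f. f \<noteq> 0 \<and> D R = unit_coset R f" if "R \<in> X" for R
    using 1[OF that] that by blast
  show "cart (eqn D)" unfolding cart_def
  proof (intro ballI conjI)
    fix R assume R: "R \<in> X"
    obtain f where "f \<noteq> 0" "D R = unit_coset R f" using loc[OF R] by blast
    then show "eqn D R \<noteq> 0" using eqn_local(2)[where D=D, OF R] by blast
    obtain F f where F: "finite F" "F \<subseteq> R" "f \<noteq> 0" "\<forall>S\<in>X. F \<subseteq> S \<longrightarrow> D S = unit_coset S f"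
      using 1[OF R] by (elim exE conjE)
    have "eqn D S / f \<in> units_of_ring S" if "S \<in> X" "F \<subseteq> S" for S
      using eqn_local(1)[where D=D, OF that(1) _ F(3)] F(4) that by blast
    then show "\<exists>F f. finite F \<and> F \<subseteq> R \<and> f \<noteq> 0 \<and> (\<forall>S\<in>X. F \<subseteq> S \<longrightarrow> eqn D S / f \<in> units_of_ring S)"
      using F(1-3) by blast
  qed
  show "dv (eqn D) = D"
  proof
    fix R
    show "dv (eqn D) R = D R"
    proof (cases "R \<in> X")
      case True
      obtain f where f: "f \<noteq> 0" "D R = unit_coset R f" using loc[OF True] by blast
      show ?thesis
        unfolding dv_def using True f unit_coset_eq_iff[OF X_subring[OF True] eqn_local(2)[where D=D, OF True f(2,1)] f(1)]
          eqn_local(1)[where D=D, OF True f(2,1)] by simp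
    next
      case False
      then show ?thesis using D by (simp add: dv_def cartier_divisor_def)
    qed
  qed
qed

lemma cart_const: "f \<noteq> 0 \<Longrightarrow> cart (\<lambda>_. f)"
  unfolding cart_def
proof (intro ballI conjI)
  fix R assume f: "f \<noteq> 0" and "R \<in> X"
  have "f / f \<in> units_of_ring S" if "S \<in> X" for S
    unfolding divide_self[OF f] by (rule units_1[OF X_subring[OF that]])
  then show "\<exists>F f'. finite F \<and> F \<subseteq> R \<and> f' \<noteq> 0 \<and> (\<forall>S\<in>X. F \<subseteq> S \<longrightarrow> f / f' \<in> units_of_ring S)"
    using f by (intro exI[of _ "{}"] exI[of _ f] conjI) blast+
qed

lemma cart_mult: assumes "cart g" "cart h" shows "cart (\<lambda>R. g R * h R)"
  unfolding cart_def
proof (intro ballI conjI)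
  fix R assume R: "R \<in> X"
  show "g R * h R \<noteq> 0" using assms R by (simp add: cartD(1))
  obtain F f where F: "finite F" "F \<subseteq> R" "f \<noteq> 0" "\<forall>S\<in>X. F \<subseteq> S \<longrightarrow> g S / f \<in> units_of_ring S"
    using cartD(2)[OF assms(1) R] by (elim exE conjE)
  obtain F' f' where F': "finite F'" "F' \<subseteq> R" "f' \<noteq> 0" "\<forall>S\<in>X. F' \<subseteq> S \<longrightarrow> h S / f' \<in> units_of_ring S"
    using cartD(2)[OF assms(2) R] by (elim exE conjE)
  have "g S * h S / (f * f') \<in> units_of_ring S" if S: "S \<in> X" "F \<union> F' \<subseteq> S" for S
  proof -
    have "g S / f \<in> units_of_ring S" "h S / f' \<in> units_of_ring S" using S F(4) F'(4) by blast+
    then have "(g S / f) * (h S / f') \<in> units_of_ring S" by (rule units_mult[OF X_subring[OF S(1)]])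
    then show ?thesis by (simp only: times_divide_times_eq)
  qed
  then show "\<exists>F f. finite F \<and> F \<subseteq> R \<and> f \<noteq> 0 \<and> (\<forall>S\<in>X. F \<subseteq> S \<longrightarrow> g S * h S / f \<in> units_of_ring S)"
    using F(1-3) F'(1-3) by (intro exI[of _ "F \<union> F'"] exI[of _ "f * f'"] conjI ballI impI) simp_all
qed

lemma cart_inverse: assumes "cart g" shows "cart (\<lambda>R. inverse (g R))"
  unfolding cart_def
proof (intro ballI conjI)
  fix R assume R: "R \<in> X"
  show "inverse (g R) \<noteq> 0" using assms R by (simp add: cartD(1))
  obtain F f where F: "finite F" "F \<subseteq> R" "f \<noteq> 0" "\<forall>S\<in>X. F \<subseteq> S \<longrightarrow> g S / f \<in> units_of_ring S"
    using cartD(2)[OF assms(1) R] by (elim exE conjE)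
  have "inverse (g S) / inverse f \<in> units_of_ring S" if S: "S \<in> X" "F \<subseteq> S" for S
  proof -
    have "g S / f \<in> units_of_ring S" using S F(4) by blast
    then have "inverse (g S / f) \<in> units_of_ring S" by (rule units_inverse)
    moreover have "inverse (g S / f) = inverse (g S) / inverse f"
      unfolding divide_inverse inverse_mult_distrib ..
    ultimately show ?thesis by (simp only:)
  qed
  then show "\<exists>F f. finite F \<and> F \<subseteq> R \<and> f \<noteq> 0 \<and> (\<forall>S\<in>X. F \<subseteq> S \<longrightarrow> inverse (g S) / f \<in> units_of_ring S)"
    using F(1-3) by (intro exI[of _ F] exI[of _ "inverse f"] conjI ballI impI) simp_all
qed

lemma cart_power: "cart g \<Longrightarrow> cart (\<lambda>R. g R ^ n)"
  by (induction n) (simp_all add: cart_const cart_mult)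

lemma cart_powi: "cart g \<Longrightarrow> cart (\<lambda>R. g R powi n)"
  by (cases "n \<ge> 0") (simp_all add: power_int_def cart_power cart_inverse)

lemma cart_prod: "(\<And>i. i \<in> I \<Longrightarrow> cart (g i)) \<Longrightarrow> cart (\<lambda>R. \<Prod>i\<in>I. g i R)"
  by (induction I rule: infinite_finite_induct) (simp_all add: cart_const cart_mult)

lemma dv_cong:
  assumes "cart g" "cart h" "\<And>R. R \<in> X \<Longrightarrow> g R / h R \<in> units_of_ring R" shows "dv g = dv h"
proof
  fix R show "dv g R = dv h R"
    using unit_coset_eq_iff[OF X_subring cartD(1)[OF assms(1)] cartD(1)[OF assms(2)]] assms(3)
    unfolding dv_def by (cases "R \<in> X") simp_all
qed

lemma divisor_add_dv: "divisor_add (dv g) (dv h) = dv (\<lambda>R. g R * h R)"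
proof
  fix R show "divisor_add (dv g) (dv h) R = dv (\<lambda>R. g R * h R) R"
  proof (cases "R \<in> X")
    case True
    note S = X_subring[OF True]
    have "{a * b | a b. a \<in> unit_coset R (g R) \<and> b \<in> unit_coset R (h R)} = unit_coset R (g R * h R)"
    proof
      show "{a * b | a b. a \<in> unit_coset R (g R) \<and> b \<in> unit_coset R (h R)} \<subseteq> unit_coset R (g R * h R)"
      proof
        fix q assume "q \<in> {a * b | a b. a \<in> unit_coset R (g R) \<and> b \<in> unit_coset R (h R)}"
        then obtain a b where ab: "q = a * b" "\<exists>u\<in>units_of_ring R. a = g R * u" "\<exists>v\<in>units_of_ring R. b = h R * v"
          unfolding unit_coset_def mem_Collect_eq image_iff by (elim exE conjE)
        then obtain u v where uv: "u \<in> units_of_ring R" "a = g R * u" "v \<in> units_of_ring R" "b = h R * v"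
          by (elim bexE)
        then have uv: "q = (g R * u) * (h R * v)" "u \<in> units_of_ring R" "v \<in> units_of_ring R"
          using ab(1) by (simp_all only:)
        then have "q = (g R * h R) * (u * v)" by (simp add: mult_ac)
        then show "q \<in> unit_coset R (g R * h R)" unfolding unit_coset_def using units_mult[OF S uv(2,3)] by (rule image_eqI)
      qed
      show "unit_coset R (g R * h R) \<subseteq> {a * b | a b. a \<in> unit_coset R (g R) \<and> b \<in> unit_coset R (h R)}"
      proof
        fix q assume "q \<in> unit_coset R (g R * h R)"
        then obtain u where u: "q = (g R * h R) * u" "u \<in> units_of_ring R"
          unfolding unit_coset_def image_iff by (elim bexE)
        have "q = (g R * 1) * (h R * u)" using u(1) by (simp add: mult_ac)
        moreover have "g R * 1 \<in> unit_coset R (g R)" "h R * u \<in> unit_coset R (h R)"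
          unfolding unit_coset_def by (rule imageI[OF units_1[OF S]], rule imageI[OF u(2)])
        ultimately show "q \<in> {a * b | a b. a \<in> unit_coset R (g R) \<and> b \<in> unit_coset R (h R)}" by blast
      qed
    qed
    then show ?thesis using True by (simp add: divisor_add_def dv_def)
  qed (simp add: divisor_add_def dv_def)
qed

text \<open>
  For the divisor of \<open>f\<close> the rational section \<open>1/f\<close> of the associated line bundle has no zeros or poles
  on any curve, so that its degree is an empty sum.
\<close>
lemma numerically_trivial_principal:
  assumes f: "f \<noteq> 0" shows "numerically_trivial X (dv (\<lambda>_. f))"
  unfolding numerically_trivial_def
proof (intro conjI ballI)
  show "cartier_divisor X (dv (\<lambda>_. f))" by (rule cartier_dv[OF cart_const[OF f]])
  fix C assume "C \<in> curves X"
  then have C: "C \<in> X" by (simp add: curves_def)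
  have "f * 1 \<in> unit_coset C f" unfolding unit_coset_def by (rule imageI[OF units_1[OF X_subring[OF C]]])
  then have fC: "f \<in> dv (\<lambda>_. f) C" using C by (simp add: dv_def)
  have "section_order (dv (\<lambda>_. f)) f (R, v) = 0" if q: "(R, v) \<in> normalization_points X C" for R v
  proof -
    from q have R: "R \<in> X" "R \<subseteq> C" and v: "curve_valuation C v" and pos: "\<forall>f\<in>R \<inter> units_of_ring C. 0 \<le> v f"
      by (auto simp: normalization_points_def)
    have "dv (\<lambda>_. f) R = unit_coset R f" using R by (simp add: dv_def)
    from eqn_local(1)[where D="dv (\<lambda>_. f)", OF R(1) this f] have u: "eqn (dv (\<lambda>_. f)) R / f \<in> units_of_ring R" (is "?u \<in> _") .
    have uR: "?u \<in> R" "inverse ?u \<in> R" "?u \<noteq> 0" using u by (simp_all add: units_iff)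
    have uC: "?u \<in> units_of_ring C" "inverse ?u \<in> units_of_ring C"
      using u units_inverse[OF u] units_mono[OF R(2)] by blast+
    have "v (?u * inverse ?u) = v ?u + v (inverse ?u)" using v uC unfolding curve_valuation_def by blast
    moreover have "?u * inverse ?u = const 1" using uR(3) by simp
    moreover have "v (const 1) = 0" using v unfolding curve_valuation_def by blast
    moreover have "0 \<le> v ?u" "0 \<le> v (inverse ?u)" using pos uR uC by blast+
    ultimately have "v ?u = 0" by simp
    then show ?thesis by (simp add: section_order_def eqn_def)
  qed
  then have e: "{q \<in> normalization_points X C. section_order (dv (\<lambda>_. f)) f q \<noteq> 0} = {}" by auto
  show "intersection_number X (dv (\<lambda>_. f)) C 0"
    unfolding intersection_number_def by (rule bexI[OF _ fC], unfold e) simp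
qed

text \<open>
  Equality of classes in the real Neron-Severi space, expressed on representatives.
\<close>
definition same_class :: "(K divisor \<Rightarrow>\<^sub>0 real) \<Rightarrow> (K divisor \<Rightarrow>\<^sub>0 real) \<Rightarrow> bool" (infix \<open>\<sim>\<close> 50) where
  "v \<sim> w \<longleftrightarrow> v - w \<in> num_relations X"

lemma subspace_num_relations: "subspace (num_relations X)"
  unfolding num_relations_def by (rule subspace_span)

lemma same_class_refl: "v \<sim> v"
  using subspace_0[OF subspace_num_relations] by (simp add: same_class_def)

lemma same_class_sym: "v \<sim> w \<Longrightarrow> w \<sim> v"
  using subspace_neg[OF subspace_num_relations, of "v - w"] by (simp add: same_class_def)

lemma same_class_trans: "u \<sim> v \<Longrightarrow> v \<sim> w \<Longrightarrow> u \<sim> w"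
  using subspace_add[OF subspace_num_relations, of "u - v" "v - w"] by (simp add: same_class_def)

lemma same_class_add: "v \<sim> w \<Longrightarrow> v' \<sim> w' \<Longrightarrow> v + v' \<sim> w + w'"
  using subspace_add[OF subspace_num_relations, of "v - w" "v' - w'"] by (simp add: same_class_def algebra_simps)

lemma same_class_scale: "v \<sim> w \<Longrightarrow> c *\<^sub>R v \<sim> c *\<^sub>R w"
  using subspace_scale[OF subspace_num_relations, of "v - w" c] by (simp add: same_class_def scaleR_diff_right)

lemma num_class_eq_iff: "num_class X v = num_class X w \<longleftrightarrow> v \<sim> w"
proof
  assume "num_class X v = num_class X w"
  moreover have "v \<in> num_class X v" using same_class_refl[of v] by (simp add: num_class_def same_class_def)
  ultimately show "v \<sim> w" by (simp add: num_class_def same_class_def)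
next
  assume vw: "v \<sim> w"
  show "num_class X v = num_class X w"
    unfolding num_class_def using vw same_class_trans same_class_sym unfolding same_class_def by blast
qed

lemma class_mult: assumes "cart g" "cart h" shows "formal (dv (\<lambda>R. g R * h R)) \<sim> formal (dv g) + formal (dv h)"
proof -
  have "formal (divisor_add (dv g) (dv h)) - formal (dv g) - formal (dv h) \<in> num_relations X"
    unfolding num_relations_def using cartier_dv[OF assms(1)] cartier_dv[OF assms(2)] by (intro span_base) blast
  then show ?thesis by (simp add: same_class_def divisor_add_dv diff_diff_eq)
qed

lemma class_const: assumes "f \<noteq> 0" shows "formal (dv (\<lambda>_. f)) \<sim> 0"
proof -
  have "formal (dv (\<lambda>_. f)) \<in> num_relations X"
    unfolding num_relations_def using numerically_trivial_principal[OF assms] by (intro span_base) blast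
  then show ?thesis by (simp add: same_class_def)
qed

lemma class_inverse: assumes g: "cart g" shows "formal (dv (\<lambda>R. inverse (g R))) \<sim> - formal (dv g)"
proof -
  have "dv (\<lambda>R. inverse (g R) * g R) = dv (\<lambda>_. 1)"
    using cartD(1)[OF g] units_1[OF X_subring]
    by (intro dv_cong cart_mult cart_inverse g cart_const) simp_all
  then have 1: "formal (dv (\<lambda>_. 1)) \<sim> formal (dv (\<lambda>R. inverse (g R))) + formal (dv g)"
    using class_mult[OF cart_inverse[OF g] g] by (simp only:)
  have "formal (dv (\<lambda>R. inverse (g R))) + formal (dv g) \<sim> 0"
    by (rule same_class_trans[OF same_class_sym[OF 1] class_const]) simp
  then show ?thesis by (simp add: same_class_def)
qed

lemma class_power: assumes g: "cart g" shows "formal (dv (\<lambda>R. g R ^ n)) \<sim> real n *\<^sub>R formal (dv g)"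
proof (induction n)
  case 0 show ?case using class_const[of 1] by simp
next
  case (Suc n)
  have "formal (dv (\<lambda>R. g R * g R ^ n)) \<sim> formal (dv g) + real n *\<^sub>R formal (dv g)"
    by (rule same_class_trans[OF class_mult[OF g cart_power[OF g]] same_class_add[OF same_class_refl Suc]])
  then show ?case by (simp add: scaleR_add_left)
qed

lemma class_powi: assumes g: "cart g" shows "formal (dv (\<lambda>R. g R powi n)) \<sim> real_of_int n *\<^sub>R formal (dv g)"
proof (cases "n \<ge> 0")
  case True
  then show ?thesis using class_power[OF g, of "nat n"] by (simp add: power_int_def)
next
  case False
  have "formal (dv (\<lambda>R. inverse (g R) ^ nat (- n))) \<sim> real (nat (- n)) *\<^sub>R (- formal (dv g))"
    by (rule same_class_trans[OF class_power[OF cart_inverse[OF g]] same_class_scale[OF class_inverse[OF g]]])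
  then show ?thesis using False by (simp add: power_int_def)
qed

end

section \<open>Divisors of rational functions with prescribed behaviour at the boundary\<close>

context three_points
begin

text \<open>
  The descriptions of the divisors by one local equation hold wherever finitely many given functions
  are regular, which is an open condition.
\<close>
lemma cartier_H1: "cartier_divisor X H1"
proof (rule cartier_divisorI)
  fix R assume R: "R \<in> X"
  from H1_dichotomy[OF R] show "\<exists>F f. finite F \<and> F \<subseteq> R \<and> f \<noteq> 0 \<and> (\<forall>S\<in>X. F \<subseteq> S \<longrightarrow> H1 S = unit_coset S f)"
  proof cases
    case 1
    have "\<forall>S\<in>X. {Sf} \<subseteq> S \<longrightarrow> H1 S = unit_coset S 1" using H1_local(1) by simp
    then show ?thesis using 1 by (intro exI[of _ "{Sf}"] exI[of _ 1] conjI) simp_all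
  next
    case 2
    have "\<forall>S\<in>X. {inverse Sf} \<subseteq> S \<longrightarrow> H1 S = unit_coset S (inverse Sf)" using H1_local(2) by simp
    then show ?thesis using 2 by (intro exI[of _ "{inverse Sf}"] exI[of _ "inverse Sf"] conjI) simp_all
  qed
qed (simp add: H1_def hyperplane_divisor_def)

lemma cartier_H2: "cartier_divisor X H2"
proof (rule cartier_divisorI)
  fix R assume R: "R \<in> X"
  obtain j where j: "\<And>l. t2 l / t2 j \<in> R" using H2_dichotomy[OF R] by blast
  let ?F = "range (\<lambda>l. t2 l / t2 j)"
  have "H2 S = unit_coset S (inverse (t2 j))" if "S \<in> X" "?F \<subseteq> S" for S
    using that by (intro H2_local) auto
  then show "\<exists>F f. finite F \<and> F \<subseteq> R \<and> f \<noteq> 0 \<and> (\<forall>S\<in>X. F \<subseteq> S \<longrightarrow> H2 S = unit_coset S f)"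
    using j t2_nz[of j] by (intro exI[of _ ?F] exI[of _ "inverse (t2 j)"] conjI ballI impI) (simp_all add: image_subset_iff)
qed (simp add: H2_def hyperplane_divisor_def)

lemma cartier_E: "cartier_divisor X (E i)"
proof (rule cartier_divisorI)
  fix R assume R: "R \<in> X"
  show "\<exists>F f. finite F \<and> F \<subseteq> R \<and> f \<noteq> 0 \<and> (\<forall>S\<in>X. F \<subseteq> S \<longrightarrow> E i S = unit_coset S f)"
    using R
  proof (cases rule: E_dichotomy[where i=i])
    case (away k)
    let ?F = "{inverse (dev (pt i) k)}"
    have "E i S = unit_coset S 1" if "S \<in> X" "?F \<subseteq> S" for S using that by (intro exceptional_unit[of S i k]) simp_all
    then show ?thesis using away by (intro exI[of _ ?F] exI[of _ 1] conjI ballI impI) simp_all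
  next
    case (over j)
    let ?F = "insert (dev (pt i) j) (range (\<lambda>k. dev (pt i) k / dev (pt i) j))"
    have "E i S = unit_coset S (dev (pt i) j)" if S: "S \<in> X" "?F \<subseteq> S" for S
    proof (rule exceptional_chart[OF S(1)])
      show "range (blow_chart (pt i) j) \<subseteq> S"
        unfolding blow_chart_subset_iff[OF X_subring[OF S(1)]] using X_local(2)[OF S(1)] S(2) by blast
    qed
    moreover have "?F \<subseteq> R" using over blow_chart_gens(2)[of "pt i" _ j] blow_chart_gens(3)[of "pt i" j j] by blast
    ultimately show ?thesis
      using dev_nz[of "pt i" j] by (intro exI[of _ ?F] exI[of _ "dev (pt i) j"] conjI ballI impI) simp_all
  qed
qed (simp add: E_def exceptional_divisor_def)

abbreviation "h1 \<equiv> eqn H1"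
abbreviation "h2 \<equiv> eqn H2"
abbreviation "e i \<equiv> eqn (E i)"

lemmas cart_h1 = cart_eqn[OF cartier_H1] and cart_h2 = cart_eqn[OF cartier_H2] and cart_e = cart_eqn[OF cartier_E]

lemma h1_value: "R \<in> X \<Longrightarrow> Sf \<in> R \<Longrightarrow> h1 R / 1 \<in> units_of_ring R"
  "R \<in> X \<Longrightarrow> inverse Sf \<in> R \<Longrightarrow> h1 R / inverse Sf \<in> units_of_ring R"
  using eqn_local(1)[where D=H1, of R 1] eqn_local(1)[where D=H1, of R "inverse Sf"] H1_local[of R] by simp_all

lemma h2_value: "R \<in> X \<Longrightarrow> (\<And>l. t2 l / t2 j \<in> R) \<Longrightarrow> h2 R / inverse (t2 j) \<in> units_of_ring R"
  using eqn_local(1)[where D=H2, of R "inverse (t2 j)"] H2_local[of R j] t2_nz[of j] by simp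

lemma h2_value_affine: "R \<in> X \<Longrightarrow> Xf \<in> R \<Longrightarrow> Yf \<in> R \<Longrightarrow> h2 R / 1 \<in> units_of_ring R"
  using eqn_local(1)[where D=H2, of R 1] H2_local_affine[of R] by simp

lemma e_value_away: "R \<in> X \<Longrightarrow> inverse (dev (pt i) k) \<in> R \<Longrightarrow> e i R / 1 \<in> units_of_ring R"
  using eqn_local(1)[where D="E i", of R 1] exceptional_unit[of R i k] by simp

lemma e_value_over: "R \<in> X \<Longrightarrow> range (blow_chart (pt i) j) \<subseteq> R \<Longrightarrow> e i R / dev (pt i) j \<in> units_of_ring R"
  using eqn_local(1)[where D="E i", of R "dev (pt i) j"] exceptional_chart[of R i j] dev_nz[of "pt i" j] by simp

text \<open>
  The exceptional divisors are disjoint: at most one of them has a nontrivial equation at a point.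
\<close>
lemma e_cases:
  assumes R: "R \<in> X"
  obtains (away) "\<And>i. e i R / 1 \<in> units_of_ring R"
  | (over) i j where "range (blow_chart (pt i) j) \<subseteq> R" "e i R / dev (pt i) j \<in> units_of_ring R"
    "\<And>k. k \<noteq> i \<Longrightarrow> e k R / 1 \<in> units_of_ring R"
proof (cases "\<forall>i. \<exists>k. inverse (dev (pt i) k) \<in> R")
  case True
  then show thesis using away e_value_away[OF R] by blast
next
  case False
  then obtain i where i: "\<And>k. inverse (dev (pt i) k) \<notin> R" by blast
  then obtain j where j: "range (blow_chart (pt i) j) \<subseteq> R" using E_dichotomy[OF R, of i] by blast
  have "dev (pt i) 1 \<in> R" using j blow_chart_gens(3)[of "pt i" 1 j] by blast
  then have "dev (pt i) 1 \<in> nonunits R" using i[of 1] by (simp add: nonunits_def units_iff)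
  then have "e k R / 1 \<in> units_of_ring R" if "k \<noteq> i" for k
    using inverse_dev_other[OF X_local[OF R] _ that] e_value_away[OF R] by blast
  then show thesis using over j e_value_over[OF R j] by blast
qed

text \<open>
  Local equations of the divisor \<open>div f + a H\<^sub>1 + b H\<^sub>2 - \<Sum> m\<^sub>i E\<^sub>i\<close>.
\<close>
definition combo :: "K \<Rightarrow> int \<Rightarrow> int \<Rightarrow> (3 \<Rightarrow> int) \<Rightarrow> K set \<Rightarrow> K" where
  "combo f a b m R = f * (h1 R powi a * (h2 R powi b * (\<Prod>i\<in>UNIV. e i R powi (- m i))))"

lemma cart_combo: "f \<noteq> 0 \<Longrightarrow> cart (combo f a b m)"
  unfolding combo_def by (intro cart_mult cart_powi cart_prod cart_const cart_h1 cart_h2 cart_e)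

lemma class_prod:
  assumes "\<And>i. cart (g i)" "finite I"
  shows "formal (dv (\<lambda>R. \<Prod>i\<in>I. g i R)) \<sim> (\<Sum>i\<in>I. formal (dv (g i)))"
  using assms(2)
proof (induction I)
  case empty show ?case using class_const[of 1] by simp
next
  case (insert i I)
  have "formal (dv (\<lambda>R. g i R * (\<Prod>i\<in>I. g i R))) \<sim> formal (dv (g i)) + (\<Sum>i\<in>I. formal (dv (g i)))"
    by (rule same_class_trans[OF class_mult[OF assms(1) cart_prod[OF assms(1)]] same_class_add[OF same_class_refl insert.IH]])
  then show ?case using insert.hyps by simp
qed

lemma same_class_sum: "finite I \<Longrightarrow> (\<And>i. i \<in> I \<Longrightarrow> v i \<sim> w i) \<Longrightarrow> (\<Sum>i\<in>I. v i) \<sim> (\<Sum>i\<in>I. w i)"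
  by (induction I rule: finite_induct) (simp_all add: same_class_refl same_class_add)

lemma class_combo:
  assumes f: "f \<noteq> 0"
  shows "formal (dv (combo f a b m)) \<sim>
    real_of_int a *\<^sub>R formal H1 + real_of_int b *\<^sub>R formal H2 - (\<Sum>i\<in>UNIV. real_of_int (m i) *\<^sub>R formal (E i))"
proof -
  let ?pe = "\<lambda>R. \<Prod>i\<in>UNIV. e i R powi (- m i)"
  have pe: "formal (dv ?pe) \<sim> (\<Sum>i\<in>UNIV. real_of_int (- m i) *\<^sub>R formal (E i))"
  proof (rule same_class_trans[OF class_prod])
    show "(\<Sum>i\<in>UNIV. formal (dv (\<lambda>R. e i R powi (- m i)))) \<sim> (\<Sum>i\<in>UNIV. real_of_int (- m i) *\<^sub>R formal (E i))"
    proof (rule same_class_sum)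
      show "formal (dv (\<lambda>R. e i R powi (- m i))) \<sim> real_of_int (- m i) *\<^sub>R formal (E i)" for i
        using class_powi[OF cart_e(1)[of i], of "- m i"] unfolding cart_e(2) .
    qed simp
  qed (simp_all add: cart_powi cart_e(1))
  have cpe: "cart ?pe" by (intro cart_prod cart_powi cart_e)
  have c2: "cart (\<lambda>R. h2 R powi b * ?pe R)" by (intro cart_mult cart_powi cart_h2 cpe)
  have c1: "cart (\<lambda>R. h1 R powi a * (h2 R powi b * ?pe R))" by (intro cart_mult[OF _ c2] cart_powi cart_h1)
  have H1: "formal (dv (\<lambda>R. h1 R powi a)) \<sim> real_of_int a *\<^sub>R formal H1"
    using class_powi[OF cart_h1(1)] unfolding cart_h1(2) .
  have H2: "formal (dv (\<lambda>R. h2 R powi b)) \<sim> real_of_int b *\<^sub>R formal H2"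
    using class_powi[OF cart_h2(1)] unfolding cart_h2(2) .
  have "formal (dv (combo f a b m)) \<sim> 0 + (real_of_int a *\<^sub>R formal H1 + (real_of_int b *\<^sub>R formal H2 +
      (\<Sum>i\<in>UNIV. real_of_int (- m i) *\<^sub>R formal (E i))))"
    unfolding combo_def
    by (rule same_class_trans[OF class_mult[OF cart_const[OF f] c1] same_class_add[OF class_const[OF f]]],
        rule same_class_trans[OF class_mult[OF cart_powi[OF cart_h1(1)] c2] same_class_add[OF H1]],
        rule same_class_trans[OF class_mult[OF cart_powi[OF cart_h2(1)] cpe] same_class_add[OF H2 pe]])
  then show ?thesis by (simp add: sum_negf add_diff_eq)
qed

lemma units_powi_divide:
  assumes "is_subring R" "x / y \<in> units_of_ring R" shows "x powi n / y powi n \<in> units_of_ring R"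
  using units_power_int[OF assms, of n] by (simp add: power_int_divide_distrib)

lemma combo_over:
  assumes R: "R \<in> X" and h: "h1 R / x \<in> units_of_ring R" "h2 R / y \<in> units_of_ring R"
    and e: "e i R / w \<in> units_of_ring R" "\<And>k. k \<noteq> i \<Longrightarrow> e k R / 1 \<in> units_of_ring R" and f: "f \<noteq> 0"
  shows "combo f a b m R / (f * x powi a * y powi b * w powi (- m i)) \<in> units_of_ring R"
proof -
  note S = X_subring[OF R]
  have others: "(\<Prod>k\<in>UNIV - {i}. e k R powi (- m k)) \<in> units_of_ring R"
  proof -
    have "(\<Prod>k\<in>I. e k R powi (- m k)) \<in> units_of_ring R" if "finite I" "i \<notin> I" for I
      using that
    proof (induction I rule: finite_induct)
      case empty then show ?case by (simp add: units_1[OF S])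
    next
      case (insert k I)
      have "e k R \<in> units_of_ring R" using e(2)[of k] insert.prems by auto
      then have "e k R powi (- m k) \<in> units_of_ring R" by (rule units_power_int[OF S])
      then show ?case using insert by (simp add: units_mult[OF S])
    qed
    then show ?thesis by simp
  qed
  have p: "(\<Prod>k\<in>UNIV. e k R powi (- m k)) = e i R powi (- m i) * (\<Prod>k\<in>UNIV - {i}. e k R powi (- m k))"
    by (rule prod.remove) simp_all
  have "(h1 R powi a / x powi a) * ((h2 R powi b / y powi b) *
      ((e i R powi (- m i) / w powi (- m i)) * (\<Prod>k\<in>UNIV - {i}. e k R powi (- m k)))) \<in> units_of_ring R"
    by (intro units_mult[OF S] units_powi_divide[OF S] h e others)
  then show ?thesis using f unfolding combo_def p by (simp add: mult_ac)
qed

lemma combo_away: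
  assumes R: "R \<in> X" and h: "h1 R / x \<in> units_of_ring R" "h2 R / y \<in> units_of_ring R"
    and e: "\<And>i. e i R / 1 \<in> units_of_ring R" and f: "f \<noteq> 0"
  shows "combo f a b m R / (f * x powi a * y powi b) \<in> units_of_ring R"
  using combo_over[OF R h e e f, of a b m] by simp

lemma effective_dv_iff:
  assumes g: "cart g" shows "effective_divisor X (dv g) \<longleftrightarrow> (\<forall>R\<in>X. g R \<in> R)"
  unfolding effective_divisor_def using cartier_dv[OF g] unit_coset_subset_iff[OF X_subring] by (simp add: dv_def)

lemma mem_if_unit_quotient:
  assumes "is_subring R" "q / r \<in> units_of_ring R" "r \<noteq> 0" shows "q \<in> R \<longleftrightarrow> r \<in> R"
proof -
  have u: "q / r \<in> R" "q / r \<noteq> 0" "inverse (q / r) \<in> R" using assms(2) unfolding units_iff by blast+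
  have e: "q = (q / r) * r" "r = inverse (q / r) * q" using u(2) assms(3) by auto
  show ?thesis
  proof
    assume "q \<in> R" from is_subringD(4)[OF assms(1) u(3) this] show "r \<in> R" using e(2) by simp
  next
    assume "r \<in> R" from is_subringD(4)[OF assms(1) u(1) this] show "q \<in> R" using e(1) by simp
  qed
qed

end

section \<open>The generators are effective\<close>

context three_points
begin

lemma effective_comboI:
  assumes "f \<noteq> 0" "\<And>R. R \<in> X \<Longrightarrow> combo f a b m R \<in> R"
  shows "effective_divisor X (dv (combo f a b m))"
  using effective_dv_iff[OF cart_combo[OF assms(1)]] assms(2) by simp

lemma h_self: "R \<in> X \<Longrightarrow> h1 R / h1 R \<in> units_of_ring R" "R \<in> X \<Longrightarrow> h2 R / h2 R \<in> units_of_ring R"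
  using cartD(1)[OF cart_h1(1)] cartD(1)[OF cart_h2(1)] units_1[OF X_subring] by simp_all

lemma effective_E: "\<exists>D. effective_divisor X D \<and> formal (E i) \<sim> formal D"
proof -
  define m where "m k = (if k = i then - 1 else 0 :: int)" for k
  have "combo 1 0 0 m R \<in> R" if R: "R \<in> X" for R
  proof -
    note S = X_subring[OF R]
    show ?thesis
      using R
    proof (cases rule: e_cases)
      case away
      have "combo 1 0 0 m R / (1 * h1 R powi 0 * h2 R powi 0) \<in> units_of_ring R"
        by (rule combo_away[OF R h_self[OF R] away]) simp
      then show ?thesis by (simp add: units_iff)
    next
      case (over k j)
      have "combo 1 0 0 m R / (1 * h1 R powi 0 * h2 R powi 0 * dev (pt k) j powi (- m k)) \<in> units_of_ring R"
        by (rule combo_over[OF R h_self[OF R] over(2,3)]) simp_all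
      then have u: "combo 1 0 0 m R / dev (pt k) j powi (- m k) \<in> units_of_ring R" by simp
      have "dev (pt k) j \<in> R" using over(1) blow_chart_gens(3)[of "pt k" j j] by blast
      then have "dev (pt k) j powi (- m k) \<in> R" using is_subringD(2)[OF S] by (cases "k = i") (simp_all add: m_def)
      then show ?thesis using mem_if_unit_quotient[OF S u] dev_nz by simp
    qed
  qed
  then have "effective_divisor X (dv (combo 1 0 0 m))" by (intro effective_comboI) simp_all
  moreover have "formal (E i) \<sim> formal (dv (combo 1 0 0 m))"
  proof -
    have "(\<Sum>k\<in>UNIV. real_of_int (m k) *\<^sub>R formal (E k)) = - formal (E i)"
      by (simp add: m_def if_distrib[of real_of_int] if_distrib[of "\<lambda>x. x *\<^sub>R _"] cong: if_cong)
    then show ?thesis using same_class_sym[OF class_combo[of 1 0 0 m]] by simp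
  qed
  ultimately show ?thesis by blast
qed

text \<open>
  The strict transform of the fibre through the point, with equation \<open>s - s\<^sub>i\<close> in the affine chart.
\<close>
lemma effective_H1_minus_E: "\<exists>D. effective_divisor X D \<and> formal H1 - formal (E i) \<sim> formal D"
proof -
  define m where "m k = (if k = i then 1 else 0 :: int)" for k
  let ?f = "dev (pt i) 1"
  have "combo ?f 1 0 m R \<in> R" if R: "R \<in> X" for R
  proof -
    note S = X_subring[OF R] and c = X_local(2)[OF R]
    have cR: "const k \<in> R" for k using c by blast
    show ?thesis
      using R
    proof (cases rule: e_cases)
      case away
      from H1_dichotomy[OF R] show ?thesis
      proof cases
        case 1
        have "combo ?f 1 0 m R / (?f * 1 powi 1 * h2 R powi 0) \<in> units_of_ring R"
          by (rule combo_away[OF R h1_value(1)[OF R 1] h_self(2)[OF R] away dev_nz])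
        then have u: "combo ?f 1 0 m R / ?f \<in> units_of_ring R" by simp
        have "?f \<in> R" using is_subringD(3)[OF S 1 cR] by (simp add: dev_def)
        then show ?thesis using mem_if_unit_quotient[OF S u dev_nz] by simp
      next
        case 2
        have "combo ?f 1 0 m R / (?f * inverse Sf powi 1 * h2 R powi 0) \<in> units_of_ring R"
          by (rule combo_away[OF R h1_value(2)[OF R 2] h_self(2)[OF R] away dev_nz])
        then have u: "combo ?f 1 0 m R / (?f * inverse Sf) \<in> units_of_ring R" by simp
        have "1 - const (fst (pt i)) * inverse Sf \<in> R"
          using is_subringD(3)[OF S is_subringD(2)[OF S] is_subringD(4)[OF S cR 2]] .
        moreover have "?f * inverse Sf = 1 - const (fst (pt i)) * inverse Sf"
          by (simp add: dev_def left_diff_distrib)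
        ultimately have "?f * inverse Sf \<in> R" by (simp only:)
        then show ?thesis using mem_if_unit_quotient[OF S u] dev_nz[of "pt i" 1] by simp
      qed
    next
      case (over k j)
      have F: "range to_fract \<subseteq> R" using over(1) blow_chart_gens(4) by blast
      then have "Sf \<in> R" by blast
      have "combo ?f 1 0 m R / (?f * 1 powi 1 * h2 R powi 0 * dev (pt k) j powi (- m k)) \<in> units_of_ring R"
        by (rule combo_over[OF R h1_value(1)[OF R \<open>Sf \<in> R\<close>] h_self(2)[OF R] over(2,3) dev_nz])
      then have u: "combo ?f 1 0 m R / (?f * dev (pt k) j powi (- m k)) \<in> units_of_ring R" by simp
      have "?f * dev (pt k) j powi (- m k) \<in> R"
      proof (cases "k = i")
        case True
        have "dev (pt i) 1 / dev (pt i) j \<in> R" using over(1) blow_chart_gens(2)[of "pt i" 1 j] True by blast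
        then show ?thesis using True by (simp add: m_def divide_inverse)
      next
        case False
        then show ?thesis using F dev_to_fract[of "pt i" 1] by (simp add: m_def) blast
      qed
      then show ?thesis using mem_if_unit_quotient[OF S u] dev_nz by simp
    qed
  qed
  then have "effective_divisor X (dv (combo ?f 1 0 m))" by (intro effective_comboI dev_nz)
  moreover have "formal H1 - formal (E i) \<sim> formal (dv (combo ?f 1 0 m))"
  proof -
    have "(\<Sum>k\<in>UNIV. real_of_int (m k) *\<^sub>R formal (E k)) = formal (E i)"
      by (simp add: m_def if_distrib[of real_of_int] if_distrib[of "\<lambda>x. x *\<^sub>R _"] cong: if_cong)
    then show ?thesis using same_class_sym[OF class_combo[OF dev_nz[of "pt i" 1], of 1 0 m]] by simp
  qed
  ultimately show ?thesis by blast
qed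

lemma line_through_two_points:
  fixes x1 y1 x2 y2 :: complex
  obtains \<alpha> \<beta> \<gamma> where "\<beta> \<noteq> 0 \<or> \<gamma> \<noteq> 0" "\<alpha> + \<beta> * x1 + \<gamma> * y1 = 0" "\<alpha> + \<beta> * x2 + \<gamma> * y2 = 0"
proof (cases "x1 = x2 \<and> y1 = y2")
  case True
  then show thesis using that[of 1 0 "- x1"] by simp
next
  case False
  then show thesis using that[of "y1 - y2" "x2 - x1" "- ((y1 - y2) * x1 + (x2 - x1) * y1)"] by (auto simp: algebra_simps)
qed

text \<open>
  The strict transform of the preimage of a line in the plane through the images of the two
  points. The images may coincide here, in which case any line through them will do.
\<close>
lemma effective_H2_minus_E_minus_E:
  assumes ij: "i \<noteq> j" shows "\<exists>D. effective_divisor X D \<and> formal H2 - formal (E i) - formal (E j) \<sim> formal D"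
proof -
  define m where "m k = (if k = i then 1 else 0) + (if k = j then 1 else 0 :: int)" for k
  obtain \<alpha> \<beta> \<gamma> where abc: "\<beta> \<noteq> 0 \<or> \<gamma> \<noteq> 0" "\<alpha> + \<beta> * fst (snd (pt i)) + \<gamma> * snd (snd (pt i)) = 0"
    "\<alpha> + \<beta> * fst (snd (pt j)) + \<gamma> * snd (snd (pt j)) = 0" by (rule line_through_two_points)
  define l where "l = const \<alpha> * t2 1 + const \<beta> * t2 2 + const \<gamma> * t2 3"
  have val: "has_value (s, x, y) l (\<alpha> * 1 + \<beta> * x + \<gamma> * y)" for s x y
    unfolding l_def t2_simps using has_value_const[of _ 1]
    by (intro has_value_arith has_value_coords has_value_const) simp
  have l0: "l \<noteq> 0"
  proof
    assume "l = 0"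
    then have "\<alpha> + \<beta> * x + \<gamma> * y = 0" for x y
      using has_value_unique[OF val[of 0 x y]] has_value_const[of "(0, x, y)" 0] by simp
    from this[of 0 0] this[of 1 0] this[of 0 1] abc(1) show False by simp
  qed
  have l_dev: "l = const \<beta> * dev (pt k) 2 + const \<gamma> * dev (pt k) 3" if "k = i \<or> k = j" for k
  proof -
    have "\<alpha> + (\<beta> * fst (snd (pt k)) + \<gamma> * snd (snd (pt k))) = 0"
      using that abc(2,3) by (auto simp: add.assoc)
    then have \<alpha>: "\<alpha> = - (\<beta> * fst (snd (pt k)) + \<gamma> * snd (snd (pt k)))" by (simp only: eq_neg_iff_add_eq_0)
    show ?thesis unfolding l_def \<alpha> by (simp add: dev_def t2_simps algebra_simps)
  qed
  have "combo l 0 1 m R \<in> R" if R: "R \<in> X" for R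
  proof -
    note S = X_subring[OF R] and c = X_local(2)[OF R]
    have cR: "const k \<in> R" for k using c by blast
    show ?thesis
      using R
    proof (cases rule: e_cases)
      case away
      obtain w where w: "\<And>k. t2 k / t2 w \<in> R" using H2_dichotomy[OF R] by blast
      have "combo l 0 1 m R / (l * h1 R powi 0 * inverse (t2 w) powi 1) \<in> units_of_ring R"
        by (rule combo_away[OF R h_self(1)[OF R] h2_value[OF R w] away l0])
      then have u: "combo l 0 1 m R / (l * inverse (t2 w)) \<in> units_of_ring R" by simp
      have "l * inverse (t2 w) = const \<alpha> * (t2 1 / t2 w) + const \<beta> * (t2 2 / t2 w) + const \<gamma> * (t2 3 / t2 w)"
        unfolding l_def divide_inverse by (simp only: distrib_right mult.assoc)
      also have "\<dots> \<in> R" by (intro is_subringD(4,6)[OF S] cR w)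
      finally show ?thesis using mem_if_unit_quotient[OF S u] l0 t2_nz[of w] by simp
    next
      case (over k w)
      have F: "range to_fract \<subseteq> R" using over(1) blow_chart_gens(4) by blast
      then have XY: "Xf \<in> R" "Yf \<in> R" by blast+
      have "combo l 0 1 m R / (l * h1 R powi 0 * 1 powi 1 * dev (pt k) w powi (- m k)) \<in> units_of_ring R"
        by (rule combo_over[OF R h_self(1)[OF R] h2_value_affine[OF R XY] over(2,3) l0])
      then have u: "combo l 0 1 m R / (l * dev (pt k) w powi (- m k)) \<in> units_of_ring R" by simp
      have "l * dev (pt k) w powi (- m k) \<in> R"
      proof (cases "k = i \<or> k = j")
        case True
        then have "m k = 1" using ij by (auto simp: m_def)
        have q: "dev (pt k) o' / dev (pt k) w \<in> R" for o' using over(1) blow_chart_gens(2)[of "pt k" o' w] by blast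
        have "l * inverse (dev (pt k) w) = const \<beta> * (dev (pt k) 2 / dev (pt k) w) + const \<gamma> * (dev (pt k) 3 / dev (pt k) w)"
          unfolding l_dev[OF True] divide_inverse by (simp only: distrib_right mult.assoc)
        also have "\<dots> \<in> R" by (intro is_subringD(4,6)[OF S] cR q)
        finally show ?thesis using \<open>m k = 1\<close> by simp
      next
        case False
        have "l \<in> R" unfolding l_def t2_simps by (intro is_subringD(2,4,6)[OF S] cR XY)
        then show ?thesis using False by (simp add: m_def)
      qed
      then show ?thesis using mem_if_unit_quotient[OF S u] dev_nz l0 by simp
    qed
  qed
  then have "effective_divisor X (dv (combo l 0 1 m))" by (intro effective_comboI l0)
  moreover have "formal H2 - formal (E i) - formal (E j) \<sim> formal (dv (combo l 0 1 m))"
  proof -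
    have "(\<Sum>k\<in>UNIV. real_of_int (m k) *\<^sub>R formal (E k)) = formal (E i) + formal (E j)"
      by (simp add: m_def scaleR_add_left sum.distrib if_distrib[of real_of_int] if_distrib[of "\<lambda>x. x *\<^sub>R _"] cong: if_cong)
    then show ?thesis using same_class_sym[OF class_combo[OF l0, of 0 1 m]] by (simp add: diff_diff_eq)
  qed
  ultimately show ?thesis by blast
qed

end

section \<open>The equation of an effective divisor\<close>

context three_points
begin

text \<open>
  Near \<open>R\<close> a single function \<open>f\<close> serves as equation. It is a unit along all prime divisors through
  \<open>R\<close>, hence at \<open>R\<close> by factoriality.
\<close>
lemma cart_unit_from_dvrs:
  assumes q: "cart q" and R: "R \<in> X" and c: "chart \<phi>" and RS: "R \<in> Spec (range \<phi>)"
    and X: "\<And>\<pi>. prime_elem \<pi> \<Longrightarrow> chart.dvr \<phi> \<pi> \<in> X"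
    and u: "\<And>\<pi>. prime_elem \<pi> \<Longrightarrow> q (chart.dvr \<phi> \<pi>) \<in> units_of_ring (chart.dvr \<phi> \<pi>)"
  shows "q R \<in> units_of_ring R"
proof -
  interpret C: chart \<phi> by (rule c)
  obtain P where P: "is_prime_ideal (range \<phi>) P" "R = localization (range \<phi>) P"
    using Spec_local(3)[OF RS C.subring_range] by blast
  obtain F f where F: "finite F" "F \<subseteq> R" "f \<noteq> 0" "\<forall>S\<in>X. F \<subseteq> S \<longrightarrow> q S / f \<in> units_of_ring S"
    using cartD(2)[OF q R] by (elim exE conjE)
  have "f \<in> units_of_ring R" unfolding P(2)
  proof (rule C.unit_in_localization[OF P(1) F(3)])
    fix \<pi> assume \<pi>: "prime_elem \<pi>" "\<phi> \<pi> \<in> P"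
    have "R \<subseteq> C.dvr \<pi>"
    proof
      fix r assume "r \<in> R"
      then obtain a b where r: "r = a / b" "a \<in> range \<phi>" "b \<in> range \<phi>" "b \<notin> P" unfolding P(2) localization_iff by blast
      then obtain n d where nd: "a = \<phi> n" "b = \<phi> d" by blast
      have "\<not> \<pi> dvd d"
      proof
        assume "\<pi> dvd d"
        then obtain g where "d = g * \<pi>" by (metis dvdE mult.commute)
        then have "b = \<phi> g * \<phi> \<pi>" using nd(2) by (simp add: C.homs)
        then show False using prime_idealD(4)[OF P(1) rangeI \<pi>(2)] r(4) by simp
      qed
      then show "r \<in> C.dvr \<pi>" unfolding r(1) nd C.dvr_def by blast
    qed
    then have "q (C.dvr \<pi>) / f \<in> units_of_ring (C.dvr \<pi>)" using F(2,4) X[OF \<pi>(1)] by blast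
    then have "q (C.dvr \<pi>) / (q (C.dvr \<pi>) / f) \<in> units_of_ring (C.dvr \<pi>)"
      by (rule units_divide[OF C.dvr_subring[OF \<pi>(1)] u[OF \<pi>(1)]])
    moreover have "q (C.dvr \<pi>) \<noteq> 0" by (rule cartD(1)[OF q X[OF \<pi>(1)]])
    ultimately show "f \<in> units_of_ring (C.dvr \<pi>)" by simp
  qed
  moreover have "q R / f \<in> units_of_ring R" using F(2,4) R by blast
  ultimately have "f * (q R / f) \<in> units_of_ring R" by (rule units_mult[OF X_subring[OF R]])
  then show ?thesis using F(3) by simp
qed

abbreviation dvrA :: "poly3 \<Rightarrow> K set" where "dvrA \<equiv> chart.dvr to_fract"

lemma dvrA_in_X: "prime_elem \<pi> \<Longrightarrow> dvrA \<pi> \<in> X"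
  using dvr_in_X_prod[of \<pi> 1 1] by (simp add: prod_chart_11)

text \<open>
  Two Cartier divisors with the same orders along the prime divisors of the affine chart and along the
  boundary divisors are equal: apply this to the quotient of their equations.
\<close>
lemma cart_unit_everywhere:
  assumes q: "cart q" and A: "\<And>\<pi>. prime_elem \<pi> \<Longrightarrow> q (dvrA \<pi>) \<in> units_of_ring (dvrA \<pi>)"
    and V: "q V1 \<in> units_of_ring V1" "q V2 \<in> units_of_ring V2" "\<And>i. q (VE (pt i)) \<in> units_of_ring (VE (pt i))"
    and R: "R \<in> X"
  shows "q R \<in> units_of_ring R"
proof -
  have aff: "q S \<in> units_of_ring S" if "S \<in> X" "S \<in> Spec (range to_fract)" for S
    by (rule cart_unit_from_dvrs[OF q that(1) chart_to_fract that(2) dvrA_in_X A])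
  have prod: "q (chart.dvr (prod_chart i j) \<pi>) \<in> units_of_ring (chart.dvr (prod_chart i j) \<pi>)" if "prime_elem \<pi>" for i j \<pi>
    using dvr_prod_chart_cases[OF that refl, of i j] aff[OF dvr_in_X_prod[OF that]] V(1,2) by metis
  have blow: "q (chart.dvr (blow_chart (pt i) j) \<pi>) \<in> units_of_ring (chart.dvr (blow_chart (pt i) j) \<pi>)" if "prime_elem \<pi>" for i j \<pi>
    using dvr_blow_chart_cases[OF that refl, of "pt i" j] aff[OF dvr_in_X_blow[OF that]] V(3) by metis
  show ?thesis
    using R
  proof (cases rule: X_cases)
    case (base i j)
    show ?thesis by (rule cart_unit_from_dvrs[OF q R chart_prod_chart base(1) dvr_in_X_prod prod])
  next
    case (exc i j)
    show ?thesis by (rule cart_unit_from_dvrs[OF q R chart_blow_chart exc(1) dvr_in_X_blow blow])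
  qed
qed

lemma UNIV_in_X: "UNIV \<in> X"
proof (rule X_base)
  interpret C: chart "to_fract :: poly3 \<Rightarrow> K" by (rule chart_to_fract)
  have P: "is_prime_ideal (range to_fract) {0 :: K}"
    unfolding is_prime_ideal_def is_ideal_def by (auto intro: range_eqI[of _ _ 0])
  have "localization (range to_fract) {0} = (UNIV :: K set)"
  proof -
    have "q \<in> localization (range to_fract) {0}" for q :: K
    proof -
      obtain n d where "d \<noteq> 0" "q = to_fract n / to_fract d" using C.frac by blast
      then show ?thesis unfolding localization_iff by (intro exI[of _ "to_fract n"] exI[of _ "to_fract d"]) simp
    qed
    then show ?thesis by blast
  qed
  then have "UNIV \<in> Spec (range (to_fract :: poly3 \<Rightarrow> K))" unfolding Spec_def using P by blast
  then show "UNIV \<in> P1xP2" by (rule to_fract_Spec_P1xP2)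
  show "UNIV \<noteq> point_ring (pt k)" for k using dev_quotient_not_regular[of 1 2 "pt k"] by auto
qed

lemma base_dvr_away:
  assumes \<pi>: "prime_elem \<pi>" and V: "V = chart.dvr (prod_chart a b) \<pi>"
  shows "V \<in> X" "e i V / 1 \<in> units_of_ring V" "range (prod_chart a b) \<subseteq> V"
proof -
  interpret C: chart "prod_chart a b" by (rule chart_prod_chart)
  show VX: "V \<in> X" unfolding V by (rule dvr_in_X_prod[OF \<pi>])
  have "V \<in> P1xP2" using C.dvr_in_Spec[OF \<pi>] V unfolding P1xP2_iff P1xP2_chart_range by blast
  then have "\<exists>k. inverse (dev (pt i) k) \<in> V" using P1xP2_dichotomy[of V "pt i"] C.dvr_not_point_ring[OF \<pi>] V by blast
  then show "e i V / 1 \<in> units_of_ring V" using e_value_away[OF VX] by blast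
  show "range (prod_chart a b) \<subseteq> V" using C.range_subset_dvr[OF \<pi>] V by simp
qed

lemma blow_dvr_values:
  assumes \<pi>: "prime_elem \<pi>" and V: "V = chart.dvr (blow_chart (pt i) 1) \<pi>"
  shows "V \<in> X" "e i V / dev (pt i) 1 \<in> units_of_ring V" "k \<noteq> i \<Longrightarrow> e k V / 1 \<in> units_of_ring V"
    "h1 V / 1 \<in> units_of_ring V" "h2 V / 1 \<in> units_of_ring V"
proof -
  interpret C: chart "blow_chart (pt i) 1" by (rule chart_blow_chart)
  show VX: "V \<in> X" unfolding V by (rule dvr_in_X_blow[OF \<pi>])
  have B: "range (blow_chart (pt i) 1) \<subseteq> V" using C.range_subset_dvr[OF \<pi>] V by simp
  have VS: "V \<in> Spec (range (blow_chart (pt i) 1))" using C.dvr_in_Spec[OF \<pi>] V by simp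
  show "e i V / dev (pt i) 1 \<in> units_of_ring V" by (rule e_value_over[OF VX B])
  have F: "range to_fract \<subseteq> V" using B blow_chart_gens(4) by blast
  have SXY: "Sf \<in> V" "Xf \<in> V" "Yf \<in> V" using F by blast+
  show "h1 V / 1 \<in> units_of_ring V" "h2 V / 1 \<in> units_of_ring V"
    using h1_value(1)[OF VX] h2_value_affine[OF VX] SXY by blast+
  show "e k V / 1 \<in> units_of_ring V" if "k \<noteq> i"
  proof (cases "dev (pt i) 1 \<in> nonunits V")
    case True
    then show ?thesis using e_value_away[OF VX inverse_dev_other[OF X_local[OF VX] True that]] by blast
  next
    case False
    have "V \<in> P1xP2" by (rule to_fract_Spec_P1xP2[OF Spec_blow_chart_unit[OF VS False]])
    then have "\<exists>l. inverse (dev (pt k) l) \<in> V" using P1xP2_dichotomy[of V "pt k"] C.dvr_not_point_ring[OF \<pi>] V by blast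
    then show ?thesis using e_value_away[OF VX] by blast
  qed
qed

lemma base_dvr_values:
  assumes \<pi>: "prime_elem \<pi>"
  shows "V = chart.dvr (prod_chart 1 j) \<pi> \<Longrightarrow> h1 V / 1 \<in> units_of_ring V"
    "V = chart.dvr (prod_chart 2 j) \<pi> \<Longrightarrow> h1 V / inverse Sf \<in> units_of_ring V"
    "V = chart.dvr (prod_chart i 1) \<pi> \<Longrightarrow> h2 V / 1 \<in> units_of_ring V"
    "V = chart.dvr (prod_chart i j) \<pi> \<Longrightarrow> h2 V / inverse (t2 j) \<in> units_of_ring V"
proof -
  note gens = prod_chart_subset_iff[OF X_subring]
  show "h1 V / 1 \<in> units_of_ring V" if V: "V = chart.dvr (prod_chart 1 j) \<pi>"
    using base_dvr_away[OF \<pi> V] h1_value(1)[of V] gens[of V 1 j] by (simp add: affine_coord_simps)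
  show "h1 V / inverse Sf \<in> units_of_ring V" if V: "V = chart.dvr (prod_chart 2 j) \<pi>"
    using base_dvr_away[OF \<pi> V] h1_value(2)[of V] gens[of V 2 j] by (simp add: affine_coord_simps)
  show "h2 V / 1 \<in> units_of_ring V" if V: "V = chart.dvr (prod_chart i 1) \<pi>"
    using base_dvr_away[OF \<pi> V] h2_value_affine[of V] gens[of V i 1] by (simp add: affine_coord_simps)
  show "h2 V / inverse (t2 j) \<in> units_of_ring V" if V: "V = chart.dvr (prod_chart i j) \<pi>"
  proof (rule h2_value)
    show "V \<in> X" using base_dvr_away[OF \<pi> V] by blast
    show "t2 l / t2 j \<in> V" for l
      using base_dvr_away(3)[OF \<pi> V] P1xP2_chart_gens(3)[of l j i] by (auto simp: P1xP2_chart_range)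
  qed
qed

text \<open>
  The divisor class group. The orders of \<open>D\<close> along the prime divisors of the affine chart define a function
  \<open>f\<close> up to constants, and the orders of \<open>D - div f\<close> along the boundary divisors define \<open>a\<close>, \<open>b\<close> and \<open>m\<close>. Then
  \<open>D\<close> and \<open>div f + a H\<^sub>1 + b H\<^sub>2 - \<Sum> m\<^sub>i E\<^sub>i\<close> have the same orders, so they agree. As \<open>D\<close> is effective, its equation
  is regular on every chart. On the affine chart this makes \<open>f\<close> a polynomial \<open>F\<close>; on the charts at infinity it
  bounds the bidegree of \<open>F\<close> by \<open>(a, b)\<close>; on the charts of the blowup it says that \<open>F\<close> vanishes to order \<open>m\<^sub>i\<close>
  at the \<open>i\<close>-th point.
\<close>
theorem effective_divisor_equation:
  assumes D: "effective_divisor X D"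
  obtains F a b m G1 G2 G3 H where "F \<noteq> 0"
    "formal D \<sim> real_of_int a *\<^sub>R formal H1 + real_of_int b *\<^sub>R formal H2 - (\<Sum>i\<in>UNIV. real_of_int (m i) *\<^sub>R formal (E i))"
    "to_fract F * inverse Sf powi a = prod_chart 2 1 G1"
    "to_fract F * inverse Xf powi b = prod_chart 1 2 G2"
    "to_fract F * inverse Yf powi b = prod_chart 1 3 G3"
    "\<And>i. to_fract F * dev (pt i) 1 powi (- m i) = blow_chart (pt i) 1 (H i)"
proof -
  interpret A: chart "to_fract :: poly3 \<Rightarrow> K" by (rule chart_to_fract)
  interpret C1: chart "prod_chart 2 1" by (rule chart_prod_chart)
  interpret C2: chart "prod_chart 1 2" by (rule chart_prod_chart)
  interpret C3: chart "prod_chart 1 3" by (rule chart_prod_chart)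
  define g where "g = eqn D"
  have cD: "cartier_divisor X D" using D by (simp add: effective_divisor_def)
  have g: "cart g" "dv g = D" unfolding g_def using cart_eqn[OF cD] by auto
  have g_eff: "g R \<in> R" if "R \<in> X" for R using D effective_dv_iff[OF g(1)] g(2) that by simp
  have g0: "g R \<noteq> 0" if "R \<in> X" for R by (rule cartD(1)[OF g(1) that])
  \<comment> \<open>The equation \<open>f0\<close> at the generic point is valid near almost all prime divisors, so \<open>D\<close> has nonzero order
    along finitely many of them only.\<close>
  obtain B f0 where B: "finite B" "f0 \<noteq> 0" "\<forall>S\<in>X. B \<subseteq> S \<longrightarrow> g S / f0 \<in> units_of_ring S"
    using cartD(2)[OF g(1) UNIV_in_X] by (elim exE conjE)
  obtain b1 where b1: "b1 \<noteq> 0" "\<And>\<pi>. prime_elem \<pi> \<Longrightarrow> \<not> \<pi> dvd b1 \<Longrightarrow> B \<subseteq> A.dvr \<pi>"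
    using A.finite_subset_almost_all_dvrs[OF B(1)] by blast
  obtain b2 where b2: "b2 \<noteq> 0" "\<And>\<pi>. prime_elem \<pi> \<Longrightarrow> \<not> \<pi> dvd b2 \<Longrightarrow> f0 \<in> units_of_ring (A.dvr \<pi>)"
    using A.almost_all_dvrs_unit[OF B(2)] by blast
  obtain f where f: "f \<noteq> 0" "\<And>\<pi>. prime_elem \<pi> \<Longrightarrow> g (A.dvr \<pi>) / f \<in> units_of_ring (A.dvr \<pi>)"
  proof (rule A.prescribed_orders[of g "b1 * b2"])
    show "g (A.dvr \<pi>) \<noteq> 0" if "prime_elem \<pi>" for \<pi> using g0 dvrA_in_X that by blast
    show "b1 * b2 \<noteq> 0" using b1 b2 by simp
    show "g (A.dvr \<pi>) \<in> units_of_ring (A.dvr \<pi>)" if \<pi>: "prime_elem \<pi>" "\<not> \<pi> dvd b1 * b2" for \<pi>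
    proof -
      have n: "\<not> \<pi> dvd b1" "\<not> \<pi> dvd b2" using \<pi>(2) dvd_mult dvd_mult2 by blast+
      have "g (A.dvr \<pi>) / f0 \<in> units_of_ring (A.dvr \<pi>)" using B(3) dvrA_in_X[OF \<pi>(1)] b1(2)[OF \<pi>(1) n(1)] by blast
      from units_mult[OF A.dvr_subring[OF \<pi>(1)] this b2(2)[OF \<pi>(1) n(2)]] show ?thesis using B(2) by simp
    qed
  qed (use that in blast)
  \<comment> \<open>The orders along the boundary divisors give the coefficients.\<close>
  have V1X: "V1 \<in> X" and V2X: "V2 \<in> X" and VEX: "VE (pt i) \<in> X" for i
    unfolding V1_def V2_def VE_def by (intro dvr_in_X_prod dvr_in_X_blow prime_elem_vars)+
  have nz: "g V1 / f \<noteq> 0" "g V2 / f \<noteq> 0" "g (VE (pt i)) / f \<noteq> 0" for i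
    using g0[OF V1X] g0[OF V2X] g0[OF VEX] f(1) by simp_all
  have "\<exists>a u. u \<in> units_of_ring V1 \<and> g V1 / f = inverse Sf powi a * u"
    by (rule C1.dvr_order[OF prime_elem_vars(1) nz(1), folded V1_def, unfolded prod_chart_vars affine_coord_simps]) blast
  then obtain a u1 where u1: "u1 \<in> units_of_ring V1" "g V1 / f = inverse Sf powi a * u1" by blast
  have "\<exists>b u. u \<in> units_of_ring V2 \<and> g V2 / f = inverse Xf powi b * u"
    by (rule C2.dvr_order[OF prime_elem_vars(2) nz(2), folded V2_def, unfolded prod_chart_vars affine_coord_simps]) blast
  then obtain b u2 where u2: "u2 \<in> units_of_ring V2" "g V2 / f = inverse Xf powi b * u2" by blast
  have "\<exists>k u. u \<in> units_of_ring (VE (pt i)) \<and> g (VE (pt i)) / f = dev (pt i) 1 powi k * u" for i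
  proof -
    interpret Ci: chart "blow_chart (pt i) 1" by (rule chart_blow_chart)
    show ?thesis
      by (rule Ci.dvr_order[OF prime_elem_vars(1) nz(3), folded VE_def, unfolded blow_chart_vars]) blast
  qed
  then obtain k uE where uE: "\<And>i. uE i \<in> units_of_ring (VE (pt i))" "\<And>i. g (VE (pt i)) / f = dev (pt i) 1 powi k i * uE i"
    by metis
  define m where "m i = - k i" for i
  let ?D = "combo f a b m"
  note cD' = cart_combo[OF f(1), of a b m]
  have quot: "g R / ?D R \<in> units_of_ring R"
    if R: "R \<in> X" and 1: "?D R / r \<in> units_of_ring R" and 2: "g R / r \<in> units_of_ring R" and r: "r \<noteq> 0" for R r
  proof -
    have "(g R / r) / (?D R / r) \<in> units_of_ring R" by (rule units_divide[OF X_subring[OF R] 2 1])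
    then show ?thesis using r by simp
  qed
  have unit: "g R / ?D R \<in> units_of_ring R" if "R \<in> X" for R
  proof (rule cart_unit_everywhere[where q="\<lambda>R. g R / ?D R", OF _ _ _ _ _ that])
    show "cart (\<lambda>R. g R / ?D R)" unfolding divide_inverse by (rule cart_mult[OF g(1) cart_inverse[OF cD']])
    show "g (A.dvr \<pi>) / ?D (A.dvr \<pi>) \<in> units_of_ring (A.dvr \<pi>)" if \<pi>: "prime_elem \<pi>" for \<pi>
    proof -
      have V: "A.dvr \<pi> = chart.dvr (prod_chart 1 1) \<pi>" by (simp add: prod_chart_11)
      have "?D (A.dvr \<pi>) / (f * 1 powi a * 1 powi b) \<in> units_of_ring (A.dvr \<pi>)"
        by (rule combo_away[OF dvrA_in_X[OF \<pi>] base_dvr_values(1,3)[OF \<pi> V] base_dvr_away(2)[OF \<pi> V] f(1)])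
      then show ?thesis by (intro quot[where r=f] dvrA_in_X[OF \<pi>] f \<pi>) simp
    qed
    show "g V1 / ?D V1 \<in> units_of_ring V1"
    proof -
      have "?D V1 / (f * inverse Sf powi a * 1 powi b) \<in> units_of_ring V1"
        by (rule combo_away[OF V1X base_dvr_values(2)[OF prime_elem_vars(1) V1_def] base_dvr_values(3)[OF prime_elem_vars(1) V1_def]
              base_dvr_away(2)[OF prime_elem_vars(1) V1_def] f(1)])
      moreover have "g V1 / (f * inverse Sf powi a) = u1"
        using u1(2) f(1) by (simp add: field_simps)
      ultimately show ?thesis using u1(1) f(1) by (intro quot[where r="f * inverse Sf powi a"] V1X) simp_all
    qed
    show "g V2 / ?D V2 \<in> units_of_ring V2"
    proof -
      have "?D V2 / (f * 1 powi a * inverse (t2 2) powi b) \<in> units_of_ring V2"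
        by (rule combo_away[OF V2X base_dvr_values(1)[OF prime_elem_vars(2) V2_def] base_dvr_values(4)[OF prime_elem_vars(2) V2_def]
              base_dvr_away(2)[OF prime_elem_vars(2) V2_def] f(1)])
      moreover have "g V2 / (f * inverse Xf powi b) = u2"
        using u2(2) f(1) by (simp add: field_simps)
      ultimately show ?thesis using u2(1) f(1) by (intro quot[where r="f * inverse Xf powi b"] V2X) (simp_all add: t2_simps)
    qed
    show "g (VE (pt i)) / ?D (VE (pt i)) \<in> units_of_ring (VE (pt i))" for i
    proof -
      note bv = blow_dvr_values[OF prime_elem_vars(1) VE_def]
      have "?D (VE (pt i)) / (f * 1 powi a * 1 powi b * dev (pt i) 1 powi (- m i)) \<in> units_of_ring (VE (pt i))"
        by (rule combo_over[OF VEX bv(4,5,2,3) f(1)])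
      moreover have "g (VE (pt i)) / (f * dev (pt i) 1 powi (- m i)) = uE i"
        using uE(2)[of i] f(1) dev_nz[of "pt i" 1] by (simp add: m_def field_simps)
      ultimately show ?thesis
        using uE(1)[of i] f(1) dev_nz[of "pt i" 1] by (intro quot[where r="f * dev (pt i) 1 powi (- m i)"] VEX) simp_all
    qed
  qed
  have Deq: "D = dv ?D" using dv_cong[OF g(1) cD' unit] g(2) by simp
  have eff: "?D R \<in> R" if "R \<in> X" for R using D effective_dv_iff[OF cD'] Deq that by simp
  \<comment> \<open>On every chart the equation of \<open>D\<close> differs from a product of \<open>f\<close> with powers of the boundary coordinates
    by units; effectivity makes this product regular along all prime divisors of the chart.\<close>
  have "f \<in> range to_fract"
  proof (rule A.in_range_if_in_dvrs)
    fix \<pi> :: poly3 assume \<pi>: "prime_elem \<pi>"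
    have V: "A.dvr \<pi> = chart.dvr (prod_chart 1 1) \<pi>" by (simp add: prod_chart_11)
    have "?D (A.dvr \<pi>) / (f * 1 powi a * 1 powi b) \<in> units_of_ring (A.dvr \<pi>)"
      by (rule combo_away[OF dvrA_in_X[OF \<pi>] base_dvr_values(1,3)[OF \<pi> V] base_dvr_away(2)[OF \<pi> V] f(1)])
    from mem_if_unit_quotient[OF A.dvr_subring[OF \<pi>] this] show "f \<in> A.dvr \<pi>"
      using eff[OF dvrA_in_X[OF \<pi>]] f(1) by simp
  qed
  then obtain F where F: "f = to_fract F" by blast
  have "f * inverse Sf powi a \<in> range (prod_chart 2 1)"
  proof (rule C1.in_range_if_in_dvrs)
    fix \<pi> :: poly3 assume \<pi>: "prime_elem \<pi>"
    have VX: "C1.dvr \<pi> \<in> X" by (rule dvr_in_X_prod[OF \<pi>])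
    have "?D (C1.dvr \<pi>) / (f * inverse Sf powi a * 1 powi b) \<in> units_of_ring (C1.dvr \<pi>)"
      by (rule combo_away[OF VX base_dvr_values(2,3)[OF \<pi> refl] base_dvr_away(2)[OF \<pi> refl] f(1)])
    from mem_if_unit_quotient[OF C1.dvr_subring[OF \<pi>] this] show "f * inverse Sf powi a \<in> C1.dvr \<pi>"
      using eff[OF VX] f(1) by simp
  qed
  moreover have "f * inverse Xf powi b \<in> range (prod_chart 1 2)"
  proof (rule C2.in_range_if_in_dvrs)
    fix \<pi> :: poly3 assume \<pi>: "prime_elem \<pi>"
    have VX: "C2.dvr \<pi> \<in> X" by (rule dvr_in_X_prod[OF \<pi>])
    have "?D (C2.dvr \<pi>) / (f * 1 powi a * inverse (t2 2) powi b) \<in> units_of_ring (C2.dvr \<pi>)"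
      by (rule combo_away[OF VX base_dvr_values(1,4)[OF \<pi> refl] base_dvr_away(2)[OF \<pi> refl] f(1)])
    from mem_if_unit_quotient[OF C2.dvr_subring[OF \<pi>] this] show "f * inverse Xf powi b \<in> C2.dvr \<pi>"
      using eff[OF VX] f(1) by (simp add: t2_simps)
  qed
  moreover have "f * inverse Yf powi b \<in> range (prod_chart 1 3)"
  proof (rule C3.in_range_if_in_dvrs)
    fix \<pi> :: poly3 assume \<pi>: "prime_elem \<pi>"
    have VX: "C3.dvr \<pi> \<in> X" by (rule dvr_in_X_prod[OF \<pi>])
    have "?D (C3.dvr \<pi>) / (f * 1 powi a * inverse (t2 3) powi b) \<in> units_of_ring (C3.dvr \<pi>)"
      by (rule combo_away[OF VX base_dvr_values(1,4)[OF \<pi> refl] base_dvr_away(2)[OF \<pi> refl] f(1)])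
    from mem_if_unit_quotient[OF C3.dvr_subring[OF \<pi>] this] show "f * inverse Yf powi b \<in> C3.dvr \<pi>"
      using eff[OF VX] f(1) by (simp add: t2_simps)
  qed
  moreover have "f * dev (pt i) 1 powi (- m i) \<in> range (blow_chart (pt i) 1)" for i
  proof -
    interpret Ci: chart "blow_chart (pt i) 1" by (rule chart_blow_chart)
    show ?thesis
    proof (rule Ci.in_range_if_in_dvrs)
      fix \<pi> :: poly3 assume \<pi>: "prime_elem \<pi>"
      note bv = blow_dvr_values[where i=i, OF \<pi> refl]
      have "?D (Ci.dvr \<pi>) / (f * 1 powi a * 1 powi b * dev (pt i) 1 powi (- m i)) \<in> units_of_ring (Ci.dvr \<pi>)"
        by (rule combo_over[OF bv(1,4,5,2,3) f(1)])
      from mem_if_unit_quotient[OF Ci.dvr_subring[OF \<pi>] this] show "f * dev (pt i) 1 powi (- m i) \<in> Ci.dvr \<pi>"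
        using eff[OF bv(1)] f(1) dev_nz[of "pt i" 1] by simp
    qed
  qed
  ultimately have ex: "\<exists>G. f * inverse Sf powi a = prod_chart 2 1 G" "\<exists>G. f * inverse Xf powi b = prod_chart 1 2 G"
    "\<exists>G. f * inverse Yf powi b = prod_chart 1 3 G"
    "\<forall>i. \<exists>H. f * dev (pt i) 1 powi (- m i) = blow_chart (pt i) 1 H"
    by (simp_all only: image_iff bex_UNIV simp_thms)
  obtain G1 where G1: "f * inverse Sf powi a = prod_chart 2 1 G1" using ex(1) by (elim exE)
  obtain G2 where G2: "f * inverse Xf powi b = prod_chart 1 2 G2" using ex(2) by (elim exE)
  obtain G3 where G3: "f * inverse Yf powi b = prod_chart 1 3 G3" using ex(3) by (elim exE)
  obtain H where H: "\<forall>i. f * dev (pt i) 1 powi (- m i) = blow_chart (pt i) 1 (H i)" using choice[OF ex(4)] by (elim exE)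
  have F0: "F \<noteq> 0" using f(1) F by auto
  have cls: "formal D \<sim> real_of_int a *\<^sub>R formal H1 + real_of_int b *\<^sub>R formal H2 - (\<Sum>i\<in>UNIV. real_of_int (m i) *\<^sub>R formal (E i))"
    unfolding Deq by (rule class_combo[OF f(1)])
  show thesis by (rule that[OF F0 cls G1[unfolded F] G2[unfolded F] G3[unfolded F] H[unfolded F, rule_format]])
qed

end

section \<open>Restriction of an equation to a rational curve\<close>

lemma poly_eq_if_eq_off_finite:
  fixes P Q :: "complex poly"
  assumes "finite A" "\<And>t. t \<notin> A \<Longrightarrow> poly P t = poly Q t"
  shows "P = Q"
proof -
  have "- A \<subseteq> {t. poly (P - Q) t = 0}" using assms(2) by auto
  moreover have "infinite (- A)" using assms(1) by (simp add: Compl_eq_Diff_UNIV infinite_UNIV_char_0)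
  ultimately have "infinite {t. poly (P - Q) t = 0}" using infinite_super by blast
  then show ?thesis using poly_zero_if_infinitely_many_zeros by fastforce
qed

text \<open>
  Substituting fractions with denominator \<open>q\<close> into a polynomial and clearing denominators by a high
  power of \<open>q\<close>.
\<close>
lemma homogenize:
  fixes n1 n2 n3 q :: "complex poly"
  assumes deg: "degree n1 \<le> e" "degree n2 \<le> e" "degree n3 \<le> e" "degree q \<le> e"
  shows "\<exists>M0. \<forall>M\<ge>M0. \<exists>H. degree H \<le> e * M \<and>
    (\<forall>t. poly q t \<noteq> 0 \<longrightarrow> poly H t = poly q t ^ M * pval (poly n1 t / poly q t, poly n2 t / poly q t, poly n3 t / poly q t) G)"
    (is "\<exists>M0. ?P G M0")
proof -
  have dp: "degree (q ^ M) \<le> e * M" for M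
    using degree_power_le[of q M] deg(4) mult_le_mono1[of "degree q" e M] by linarith
  have var: "?P v 1" if v: "\<And>t. pval (poly n1 t / poly q t, poly n2 t / poly q t, poly n3 t / poly q t) v = poly n t / poly q t"
    and n: "degree n \<le> e" for v n
  proof (intro allI impI)
    fix M :: nat assume "M \<ge> 1"
    then obtain M' where M: "M = Suc M'" by (cases M) auto
    have "degree (n * q ^ M') \<le> e * M"
      using degree_mult_le[of n "q ^ M'"] n dp[of M'] M by simp
    moreover have "poly (n * q ^ M') t = poly q t ^ M * (poly n t / poly q t)" if "poly q t \<noteq> 0" for t
      using that M by simp
    ultimately show "\<exists>H. degree H \<le> e * M \<and>
      (\<forall>t. poly q t \<noteq> 0 \<longrightarrow> poly H t = poly q t ^ M * pval (poly n1 t / poly q t, poly n2 t / poly q t, poly n3 t / poly q t) v)"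
      unfolding v by blast
  qed
  show ?thesis
  proof (induction G rule: poly3_induct)
    case (1 k)
    have "degree (smult k (q ^ M)) \<le> e * M" for M using dp[of M] degree_smult_le order_trans by blast
    moreover have "poly (smult k (q ^ M)) t = poly q t ^ M *
        pval (poly n1 t / poly q t, poly n2 t / poly q t, poly n3 t / poly q t) (C3 k)" for M t
      by simp
    ultimately show ?case by blast
  next
    case 2 show ?case by (rule exI, rule var[OF _ deg(1)]) simp
  next
    case 3 show ?case by (rule exI, rule var[OF _ deg(2)]) simp
  next
    case 4 show ?case by (rule exI, rule var[OF _ deg(3)]) simp
  next
    case (5 F G)
    then obtain M1 M2 where M: "?P F M1" "?P G M2" by blast
    have "?P (F + G) (max M1 M2)"
    proof (intro allI impI)
      fix M assume "max M1 M2 \<le> M"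
      then have "M1 \<le> M" "M2 \<le> M" by auto
      from M(1)[rule_format, OF this(1)] M(2)[rule_format, OF this(2)]
      obtain H1 H2 where H: "degree H1 \<le> e * M" "degree H2 \<le> e * M"
        "\<forall>t. poly q t \<noteq> 0 \<longrightarrow> poly H1 t = poly q t ^ M * pval (poly n1 t / poly q t, poly n2 t / poly q t, poly n3 t / poly q t) F"
        "\<forall>t. poly q t \<noteq> 0 \<longrightarrow> poly H2 t = poly q t ^ M * pval (poly n1 t / poly q t, poly n2 t / poly q t, poly n3 t / poly q t) G"
        by (elim exE conjE)
      show "\<exists>H. degree H \<le> e * M \<and>
        (\<forall>t. poly q t \<noteq> 0 \<longrightarrow> poly H t = poly q t ^ M * pval (poly n1 t / poly q t, poly n2 t / poly q t, poly n3 t / poly q t) (F + G))"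
        using H by (intro exI[of _ "H1 + H2"]) (simp add: degree_add_le distrib_left)
    qed
    then show ?case by blast
  next
    case (6 F G)
    then obtain M1 M2 where M: "?P F M1" "?P G M2" by blast
    have "?P (F * G) (M1 + M2)"
    proof (intro allI impI)
      fix M assume "M1 + M2 \<le> M"
      then have "M1 \<le> M1" "M2 \<le> M - M1" and MM: "M = M1 + (M - M1)" by auto
      from M(1)[rule_format, OF this(1)] M(2)[rule_format, OF this(2)]
      obtain H1 H2 where H: "degree H1 \<le> e * M1" "degree H2 \<le> e * (M - M1)"
        "\<forall>t. poly q t \<noteq> 0 \<longrightarrow> poly H1 t = poly q t ^ M1 * pval (poly n1 t / poly q t, poly n2 t / poly q t, poly n3 t / poly q t) F"
        "\<forall>t. poly q t \<noteq> 0 \<longrightarrow> poly H2 t = poly q t ^ (M - M1) * pval (poly n1 t / poly q t, poly n2 t / poly q t, poly n3 t / poly q t) G"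
        by (elim exE conjE)
      have "degree (H1 * H2) \<le> e * M1 + e * (M - M1)" using degree_mult_le[of H1 H2] H(1,2) by linarith
      also have "\<dots> = e * M" using MM by (metis distrib_left)
      finally have 1: "degree (H1 * H2) \<le> e * M" .
      have 2: "poly (H1 * H2) t = poly q t ^ M * pval (poly n1 t / poly q t, poly n2 t / poly q t, poly n3 t / poly q t) (F * G)"
        if "poly q t \<noteq> 0" for t
      proof -
        have "poly q t ^ M = poly q t ^ M1 * poly q t ^ (M - M1)" using MM by (metis power_add)
        then show ?thesis using H(3,4) that by (simp add: mult_ac)
      qed
      show "\<exists>H. degree H \<le> e * M \<and>
        (\<forall>t. poly q t \<noteq> 0 \<longrightarrow> poly H t = poly q t ^ M * pval (poly n1 t / poly q t, poly n2 t / poly q t, poly n3 t / poly q t) (F * G))"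
        using 1 2 by blast
    qed
    then show ?case by blast
  qed
qed

lemma coprime_if_no_common_root:
  fixes p q :: "complex poly"
  assumes "\<And>z. poly p z = 0 \<Longrightarrow> poly q z \<noteq> 0"
  shows "coprime p q"
proof (rule coprimeI)
  fix h assume h: "h dvd p" "h dvd q"
  have "h \<noteq> 0"
  proof
    assume "h = 0" then have "p = 0" "q = 0" using h by auto
    then show False using assms[of 0] by simp
  qed
  have "degree h = 0"
  proof (rule ccontr)
    assume "degree h \<noteq> 0"
    then obtain z where "poly h z = 0" using alg_closed_imp_poly_has_root[of h] by blast
    then have "poly p z = 0" "poly q z = 0" using h by (auto simp: dvd_def)
    then show False using assms by blast
  qed
  then show "is_unit h" using \<open>h \<noteq> 0\<close> by (auto simp: is_unit_iff_degree)
qed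

lemma power_dvd_if_no_common_root:
  fixes \<beta> \<gamma> \<delta> P :: "complex poly"
  assumes nr: "\<And>z. poly \<delta> z = 0 \<Longrightarrow> poly \<beta> z \<noteq> 0 \<or> poly \<gamma> z \<noteq> 0"
    and d: "\<delta> ^ N dvd \<beta> ^ B * P" "\<delta> ^ N dvd \<gamma> ^ C * P"
  shows "\<delta> ^ N dvd P"
proof -
  define g where "g = gcd (\<beta> ^ B) (\<gamma> ^ C)"
  have "coprime \<delta> g"
  proof (rule coprime_if_no_common_root)
    fix z assume z: "poly \<delta> z = 0"
    show "poly g z \<noteq> 0"
    proof
      assume "poly g z = 0"
      then have "poly (\<beta> ^ B) z = 0" "poly (\<gamma> ^ C) z = 0"
        using gcd_dvd1[of "\<beta> ^ B" "\<gamma> ^ C"] gcd_dvd2[of "\<beta> ^ B" "\<gamma> ^ C"] unfolding g_def poly_eq_0_iff_dvd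
        by (blast intro: dvd_trans)+
      then show False using nr[OF z] by simp
    qed
  qed
  then have co: "coprime (\<delta> ^ N) g" by simp
  have "\<delta> ^ N dvd gcd (\<beta> ^ B * P) (\<gamma> ^ C * P)" using d by simp
  then have "\<delta> ^ N dvd g * P" by (simp add: g_def gcd_mult_right dvd_mult_unit_iff gcd.commute)
  then show ?thesis using co by (simp add: coprime_dvd_mult_right_iff)
qed


text \<open>
  The numerical form of the regularity of the equation of an effective divisor on the charts at
  infinity and on the charts of the blowup.
\<close>
locale plane_class =
  fixes F :: poly3 and a b :: int and m :: "3 \<Rightarrow> int" and G1 G2 G3 :: poly3 and H :: "3 \<Rightarrow> poly3" and pt :: "3 \<Rightarrow> point"
  assumes F0: "F \<noteq> 0"
    and N1: "s \<noteq> 0 \<Longrightarrow> pval (s, x, y) F * inverse s powi a = pval (inverse s, x, y) G1"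
    and N2: "x \<noteq> 0 \<Longrightarrow> pval (s, x, y) F * inverse x powi b = pval (s, inverse x, y / x) G2"
    and N3: "y \<noteq> 0 \<Longrightarrow> pval (s, x, y) F * inverse y powi b = pval (s, inverse y, x / y) G3"
    and N4: "s \<noteq> fst (pt i) \<Longrightarrow> pval (s, x, y) F * (s - fst (pt i)) powi (- m i) =
      pval (s - fst (pt i), (x - fst (snd (pt i))) / (s - fst (pt i)), (y - snd (snd (pt i))) / (s - fst (pt i))) (H i)"
begin

text \<open>
  The restriction of \<open>F\<close> to the curve \<open>t \<mapsto> (\<sigma>, \<beta>/\<delta>, \<gamma>/\<delta>)\<close>, with denominators cleared.
\<close>
definition restricts_to :: "complex poly \<Rightarrow> complex poly \<Rightarrow> complex poly \<Rightarrow> complex poly \<Rightarrow> nat \<Rightarrow> complex poly \<Rightarrow> bool" where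
  "restricts_to \<sigma> \<beta> \<gamma> \<delta> M P \<longleftrightarrow> (\<forall>t. poly \<delta> t \<noteq> 0 \<longrightarrow>
     poly P t = poly \<delta> t ^ M * pval (poly \<sigma> t, poly \<beta> t / poly \<delta> t, poly \<gamma> t / poly \<delta> t) F)"

lemma restriction_exists:
  assumes "degree (\<sigma> * \<delta>) \<le> e" "degree \<beta> \<le> e" "degree \<gamma> \<le> e" "degree \<delta> \<le> e"
  shows "\<exists>M0. \<forall>M\<ge>M0. \<exists>P. restricts_to \<sigma> \<beta> \<gamma> \<delta> M P \<and> degree P \<le> e * M"
proof -
  obtain M0 where M0: "\<forall>M\<ge>M0. \<exists>P. degree P \<le> e * M \<and> (\<forall>t. poly \<delta> t \<noteq> 0 \<longrightarrow> poly P t = poly \<delta> t ^ M *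
      pval (poly (\<sigma> * \<delta>) t / poly \<delta> t, poly \<beta> t / poly \<delta> t, poly \<gamma> t / poly \<delta> t) F)"
    using homogenize[OF assms] by blast
  have "\<exists>P. restricts_to \<sigma> \<beta> \<gamma> \<delta> M P \<and> degree P \<le> e * M" if M: "M \<ge> M0" for M
  proof -
    obtain P where P: "degree P \<le> e * M" "\<forall>t. poly \<delta> t \<noteq> 0 \<longrightarrow> poly P t = poly \<delta> t ^ M *
      pval (poly (\<sigma> * \<delta>) t / poly \<delta> t, poly \<beta> t / poly \<delta> t, poly \<gamma> t / poly \<delta> t) F"
      using M0 M by blast
    have "restricts_to \<sigma> \<beta> \<gamma> \<delta> M P" unfolding restricts_to_def
    proof (intro allI impI)
      fix t assume t: "poly \<delta> t \<noteq> 0"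
      then have "poly (\<sigma> * \<delta>) t / poly \<delta> t = poly \<sigma> t" by simp
      then show "poly P t = poly \<delta> t ^ M * pval (poly \<sigma> t, poly \<beta> t / poly \<delta> t, poly \<gamma> t / poly \<delta> t) F"
        using P(2)[rule_format, OF t] by (simp only:)
    qed
    then show ?thesis using P(1) by blast
  qed
  then show ?thesis by blast
qed

text \<open>
  The pole order at \<open>t = \<infinity>\<close>, where \<open>s\<close> has a simple pole: regularity on the chart at \<open>s = \<infinity>\<close>
  bounds it by \<open>a\<close>.
\<close>
lemma restriction_degree:
  assumes \<delta>: "\<delta> \<noteq> 0" and deg: "degree \<beta> \<le> e" "degree \<gamma> \<le> e" "degree \<delta> \<le> e"
  shows "\<exists>M0. \<forall>M\<ge>M0. \<forall>P. restricts_to [:0, 1:] \<beta> \<gamma> \<delta> M P \<longrightarrow> P \<noteq> 0 \<longrightarrow> int (degree P) \<le> a + int (e * M)"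
proof -
  let ?t = "[:0, 1 :: complex:]"
  have d: "degree (?t * p) \<le> Suc e" if "degree p \<le> e" for p
    using degree_mult_le[of ?t p] that by simp
  obtain M0 where M0: "\<forall>M\<ge>M0. \<exists>K. degree K \<le> Suc e * M \<and> (\<forall>t. poly (?t * \<delta>) t \<noteq> 0 \<longrightarrow> poly K t = poly (?t * \<delta>) t ^ M *
      pval (poly \<delta> t / poly (?t * \<delta>) t, poly (?t * \<beta>) t / poly (?t * \<delta>) t, poly (?t * \<gamma>) t / poly (?t * \<delta>) t) G1)"
    using homogenize[of \<delta> "Suc e" "?t * \<beta>" "?t * \<gamma>" "?t * \<delta>"] d deg le_SucI by blast
  have "int (degree P) \<le> a + int (e * M)" if M: "M \<ge> M0" and P: "restricts_to ?t \<beta> \<gamma> \<delta> M P" "P \<noteq> 0" for M P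
  proof -
    obtain K where K: "degree K \<le> Suc e * M" "\<forall>t. poly (?t * \<delta>) t \<noteq> 0 \<longrightarrow> poly K t = poly (?t * \<delta>) t ^ M *
      pval (poly \<delta> t / poly (?t * \<delta>) t, poly (?t * \<beta>) t / poly (?t * \<delta>) t, poly (?t * \<gamma>) t / poly (?t * \<delta>) t) G1"
      using M0 M by blast
    have eq: "?t ^ (M + nat (- a)) * P = ?t ^ nat a * K"
    proof (rule poly_eq_if_eq_off_finite)
      show "finite (insert 0 {t. poly \<delta> t = 0})" using poly_roots_finite[OF \<delta>] by simp
      fix t assume "t \<notin> insert 0 {t. poly \<delta> t = 0}"
      then have t: "t \<noteq> 0" "poly \<delta> t \<noteq> 0" by auto
      define v where "v = pval (t, poly \<beta> t / poly \<delta> t, poly \<gamma> t / poly \<delta> t) F"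
      have Pt: "poly P t = poly \<delta> t ^ M * v" using P(1) t by (simp add: restricts_to_def v_def)
      have "poly K t = (t * poly \<delta> t) ^ M * pval (inverse t, poly \<beta> t / poly \<delta> t, poly \<gamma> t / poly \<delta> t) G1"
      proof -
        have "poly \<delta> t / (t * poly \<delta> t) = inverse t" "t * poly \<beta> t / (t * poly \<delta> t) = poly \<beta> t / poly \<delta> t"
          "t * poly \<gamma> t / (t * poly \<delta> t) = poly \<gamma> t / poly \<delta> t" using t by (simp_all add: field_simps)
        moreover have "poly (?t * p) t = t * poly p t" for p by simp
        ultimately show ?thesis using K(2)[rule_format, of t] t by (simp only:) simp
      qed
      also have "\<dots> = (t * poly \<delta> t) ^ M * (v * inverse t powi a)" using N1[OF t(1)] by (simp add: v_def)
      finally have Kt: "poly K t = t ^ M * poly P t * inverse t powi a" by (simp add: Pt power_mult_distrib)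
      have "t ^ nat a * inverse t powi a = t ^ nat (- a)" using t(1) by (cases "a \<ge> 0") (simp_all add: power_int_def power_inverse)
      then have "t ^ nat a * poly K t = t ^ M * t ^ nat (- a) * poly P t" unfolding Kt by (metis mult.assoc mult.commute)
      then show "poly (?t ^ (M + nat (- a)) * P) t = poly (?t ^ nat a * K) t" by (simp add: power_add)
    qed
    have "degree (?t ^ n * Q) = n + degree Q" if "Q \<noteq> 0" for n Q
      using that by (simp add: degree_mult_eq degree_power_eq)
    moreover have "K \<noteq> 0" using eq P(2) by auto
    ultimately have "M + nat (- a) + degree P = nat a + degree K" using arg_cong[OF eq, of degree] P(2) by simp
    moreover have "degree K \<le> M + e * M" using K(1) by simp
    moreover have "int (nat a) - int (nat (- a)) = a" by simp
    ultimately show ?thesis by linarith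
  qed
  then show ?thesis by blast
qed

text \<open>
  The pole order at a zero of \<open>\<delta>\<close> where \<open>\<beta>\<close> does not vanish: regularity on the chart with coordinates
  \<open>1/x\<close> and \<open>y/x\<close> bounds it by \<open>b\<close> times the multiplicity of the zero. Exchanging the roles of \<open>x\<close> and \<open>y\<close> in
  \<open>f\<close> gives the same for \<open>\<gamma>\<close>.
\<close>
lemma restriction_dvd_one_chart:
  fixes f :: "complex \<Rightarrow> complex \<Rightarrow> complex \<Rightarrow> complex"
  assumes \<delta>: "\<delta> \<noteq> 0" and M: "int M \<ge> b"
    and P: "\<And>t. poly \<delta> t \<noteq> 0 \<Longrightarrow> poly P t = poly \<delta> t ^ M * f (poly \<sigma> t) (poly \<beta> t / poly \<delta> t) (poly \<gamma> t / poly \<delta> t)"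
    and N: "\<And>s x y. x \<noteq> 0 \<Longrightarrow> f s x y * inverse x powi b = pval (s, inverse x, y / x) G"
  shows "\<exists>B. \<delta> ^ nat (int M - b) dvd \<beta> ^ B * P"
proof (cases "\<beta> = 0")
  case True
  then show ?thesis by (intro exI[of _ 1]) simp
next
  case \<beta>: False
  define D where "D = degree (\<sigma> * \<beta>) + degree \<delta> + degree \<gamma> + degree \<beta>"
  have "degree (\<sigma> * \<beta>) \<le> D" "degree \<delta> \<le> D" "degree \<gamma> \<le> D" "degree \<beta> \<le> D" by (simp_all add: D_def)
  from homogenize[OF this, of G] obtain L K where
    K: "\<forall>t. poly \<beta> t \<noteq> 0 \<longrightarrow> poly K t = poly \<beta> t ^ L *
      pval (poly (\<sigma> * \<beta>) t / poly \<beta> t, poly \<delta> t / poly \<beta> t, poly \<gamma> t / poly \<beta> t) G" by blast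
  \<comment> \<open>At most one of the exponents \<open>nat b\<close> and \<open>nat (- b)\<close> is nonzero, according to the sign of \<open>b\<close>; they clear
    the power of \<open>\<beta> / \<delta>\<close> that compares the two dehomogenizations.\<close>
  have "\<beta> ^ (L + nat (- b)) * P = \<delta> ^ nat (int M - b) * (\<beta> ^ nat b * K)"
  proof (rule poly_eq_if_eq_off_finite)
    show "finite ({t. poly \<delta> t = 0} \<union> {t. poly \<beta> t = 0})" using poly_roots_finite \<delta> \<beta> by blast
    fix t assume "t \<notin> {t. poly \<delta> t = 0} \<union> {t. poly \<beta> t = 0}"
    then have t: "poly \<delta> t \<noteq> 0" "poly \<beta> t \<noteq> 0" by auto
    define d c v where "d = poly \<delta> t" "c = poly \<beta> t" "v = f (poly \<sigma> t) (poly \<beta> t / poly \<delta> t) (poly \<gamma> t / poly \<delta> t)"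
    have dc: "d \<noteq> 0" "c \<noteq> 0" using t by (simp_all add: d_c_v_def)
    have Pt: "poly P t = d ^ M * v" using P[OF t(1)] by (simp add: d_c_v_def)
    have "poly K t = c ^ L * pval (poly \<sigma> t, inverse (c / d), (poly \<gamma> t / d) / (c / d)) G"
      using K t by (simp add: d_c_v_def)
    also have "\<dots> = c ^ L * (v * inverse (c / d) powi b)"
      using N[of "c / d" "poly \<sigma> t" "poly \<gamma> t / d"] dc by (simp add: d_c_v_def)
    finally have Kt: "poly K t = c ^ L * v * (d / c) powi b" by simp
    have "d ^ nat (int M - b) * c ^ nat b * (d / c) powi b = c ^ nat (- b) * d ^ M"
    proof (cases "b \<ge> 0")
      case True
      then have "nat (int M - b) + nat b = M" using M by simp
      then have "d ^ nat (int M - b) * d ^ nat b = d ^ M" by (simp flip: power_add)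
      then show ?thesis using True dc by (simp add: power_int_def power_divide)
    next
      case False
      then have "nat (int M - b) = M + nat (- b)" by simp
      then show ?thesis using False dc by (simp add: power_int_def power_divide power_add)
    qed
    then have "c ^ L * v * (d ^ nat (int M - b) * c ^ nat b * (d / c) powi b) = c ^ L * v * (c ^ nat (- b) * d ^ M)"
      by (simp only:)
    then have "d ^ nat (int M - b) * (c ^ nat b * poly K t) = c ^ (L + nat (- b)) * poly P t"
      unfolding Kt Pt power_add by (simp only: mult_ac)
    then show "poly (\<beta> ^ (L + nat (- b)) * P) t = poly (\<delta> ^ nat (int M - b) * (\<beta> ^ nat b * K)) t"
      by (simp add: d_c_v_def)
  qed
  then show ?thesis by (metis dvd_triv_left)
qed

lemma restriction_dvd:
  assumes \<delta>: "\<delta> \<noteq> 0" and M: "int M \<ge> b" and P: "restricts_to \<sigma> \<beta> \<gamma> \<delta> M P"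
    and nr: "\<And>z. poly \<delta> z = 0 \<Longrightarrow> poly \<beta> z \<noteq> 0 \<or> poly \<gamma> z \<noteq> 0"
  shows "\<delta> ^ nat (int M - b) dvd P"
proof -
  have "\<exists>B. \<delta> ^ nat (int M - b) dvd \<beta> ^ B * P"
    by (rule restriction_dvd_one_chart[OF \<delta> M, where f="\<lambda>s x y. pval (s, x, y) F" and G=G2 and \<sigma>=\<sigma> and \<gamma>=\<gamma>])
      (use P N2 in \<open>auto simp: restricts_to_def\<close>)
  moreover have "\<exists>B. \<delta> ^ nat (int M - b) dvd \<gamma> ^ B * P"
    by (rule restriction_dvd_one_chart[OF \<delta> M, where f="\<lambda>s x y. pval (s, y, x) F" and G=G3 and \<sigma>=\<sigma> and \<gamma>=\<beta>])
      (use P N3 in \<open>auto simp: restricts_to_def\<close>)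
  ultimately show ?thesis using power_dvd_if_no_common_root[OF nr] by blast
qed

text \<open>
  The curve passes through the \<open>i\<close>-th point with parameter \<open>t = s\<^sub>i\<close>. On its strict transform the
  coordinates of the blowup chart are regular at this parameter and \<open>s - s\<^sub>i\<close> is \<open>t - s\<^sub>i\<close>.
\<close>
lemma restriction_multiplicity:
  assumes \<delta>: "\<delta> \<noteq> 0"
    and p: "poly \<beta> (fst (pt i)) = fst (snd (pt i)) * poly \<delta> (fst (pt i))"
      "poly \<gamma> (fst (pt i)) = snd (snd (pt i)) * poly \<delta> (fst (pt i))" "poly \<delta> (fst (pt i)) \<noteq> 0"
  shows "\<exists>M0. \<forall>M\<ge>M0. \<forall>P. restricts_to [:0, 1:] \<beta> \<gamma> \<delta> M P \<longrightarrow> [:- fst (pt i), 1:] ^ nat (m i) dvd P"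
proof -
  obtain si xi yi where pt: "pt i = (si, xi, yi)" by (cases "pt i") auto
  have "poly (\<beta> - smult xi \<delta>) si = 0" "poly (\<gamma> - smult yi \<delta>) si = 0" using p by (simp_all add: pt)
  then obtain \<beta>' \<gamma>' where \<beta>': "\<beta> - smult xi \<delta> = [:- si, 1:] * \<beta>'" and \<gamma>': "\<gamma> - smult yi \<delta> = [:- si, 1:] * \<gamma>'"
    unfolding poly_eq_0_iff_dvd by (auto simp: dvd_def)
  have \<beta>t: "poly \<beta> t = xi * poly \<delta> t + (t - si) * poly \<beta>' t" for t
    using arg_cong[OF \<beta>', of "\<lambda>p. poly p t"] by (simp add: algebra_simps)
  have \<gamma>t: "poly \<gamma> t = yi * poly \<delta> t + (t - si) * poly \<gamma>' t" for t
    using arg_cong[OF \<gamma>', of "\<lambda>p. poly p t"] by (simp add: algebra_simps)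
  define D where "D = degree ([:- si, 1:] * \<delta>) + degree \<beta>' + degree \<gamma>' + degree \<delta>"
  have "degree ([:- si, 1:] * \<delta>) \<le> D" "degree \<beta>' \<le> D" "degree \<gamma>' \<le> D" "degree \<delta> \<le> D" by (simp_all add: D_def)
  from homogenize[OF this, of "H i"] obtain M0 where
    M0: "\<forall>M\<ge>M0. \<exists>K. \<forall>t. poly \<delta> t \<noteq> 0 \<longrightarrow> poly K t = poly \<delta> t ^ M *
      pval (poly ([:- si, 1:] * \<delta>) t / poly \<delta> t, poly \<beta>' t / poly \<delta> t, poly \<gamma>' t / poly \<delta> t) (H i)" by blast
  have "[:- si, 1:] ^ nat (m i) dvd P" if M: "M \<ge> M0" and P: "restricts_to [:0, 1:] \<beta> \<gamma> \<delta> M P" for M P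
  proof (cases "m i \<ge> 0")
    case False then show ?thesis by simp
  next
    case True
    obtain K where K: "\<forall>t. poly \<delta> t \<noteq> 0 \<longrightarrow> poly K t = poly \<delta> t ^ M *
      pval (poly ([:- si, 1:] * \<delta>) t / poly \<delta> t, poly \<beta>' t / poly \<delta> t, poly \<gamma>' t / poly \<delta> t) (H i)"
      using M0 M by blast
    have "P = [:- si, 1:] ^ nat (m i) * K"
    proof (rule poly_eq_if_eq_off_finite)
      show "finite (insert si {t. poly \<delta> t = 0})" using poly_roots_finite[OF \<delta>] by simp
      fix t assume "t \<notin> insert si {t. poly \<delta> t = 0}"
      then have t: "t \<noteq> si" "poly \<delta> t \<noteq> 0" by auto
      define x y where "x = poly \<beta> t / poly \<delta> t" and "y = poly \<gamma> t / poly \<delta> t"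
      have "(x - xi) / (t - si) = poly \<beta>' t / poly \<delta> t" "(y - yi) / (t - si) = poly \<gamma>' t / poly \<delta> t"
        using t by (simp_all add: x_def y_def \<beta>t \<gamma>t field_simps)
      then have "pval (t, x, y) F * (t - si) powi (- m i) = pval (t - si, poly \<beta>' t / poly \<delta> t, poly \<gamma>' t / poly \<delta> t) (H i)"
        using N4[of t i x y] t by (simp add: pt)
      moreover have "poly K t = poly \<delta> t ^ M * pval (t - si, poly \<beta>' t / poly \<delta> t, poly \<gamma>' t / poly \<delta> t) (H i)"
        using K[rule_format, OF t(2)] t(2) by simp
      ultimately have Kt: "poly K t = poly \<delta> t ^ M * (pval (t, x, y) F * (t - si) powi (- m i))" by simp
      have "(t - si) ^ nat (m i) * (t - si) powi (- m i) = 1"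
        using True t(1) by (simp add: power_int_minus) (simp add: power_int_def)
      moreover have "(t - si) ^ nat (m i) * poly K t =
          poly \<delta> t ^ M * pval (t, x, y) F * ((t - si) ^ nat (m i) * (t - si) powi (- m i))"
        unfolding Kt by (simp only: mult_ac)
      ultimately have "(t - si) ^ nat (m i) * poly K t = poly \<delta> t ^ M * pval (t, x, y) F" by (simp only: mult_1_right)
      also have "\<dots> = poly P t" using P t(2) by (simp add: restricts_to_def x_def y_def)
      finally show "poly P t = poly ([:- si, 1:] ^ nat (m i) * K) t" by simp
    qed
    then show ?thesis by simp
  qed
  then show ?thesis unfolding pt by auto
qed

end

section \<open>Moving curves\<close>

definition det3 :: "complex \<times> complex \<Rightarrow> complex \<times> complex \<Rightarrow> complex \<times> complex \<Rightarrow> complex" where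
  "det3 p q r = (fst q - fst p) * (snd r - snd p) - (fst r - fst p) * (snd q - snd p)"

context plane_class
begin

lemma infinite_Compl_singleton: "infinite (UNIV - {z :: complex})"
  by (simp add: infinite_UNIV_char_0)

text \<open>
  Restriction to a fibre of the projection to the plane.
\<close>
lemma a_nonneg: "0 \<le> a"
proof -
  obtain s x y where F: "pval (s, x, y) F \<noteq> 0"
    by (rule poly3_nonzero_value[OF F0 infinite_Compl_singleton[of 0] infinite_Compl_singleton[of 0] infinite_Compl_singleton[of 0]])
  obtain M1 where M1: "\<forall>M\<ge>M1. \<exists>P. restricts_to [:0, 1:] [:x:] [:y:] 1 M P \<and> degree P \<le> 1 * M"
    using restriction_exists[of "[:0, 1:]" 1 1 "[:x:]" "[:y:]"] by auto
  obtain M2 where M2: "\<forall>M\<ge>M2. \<forall>P. restricts_to [:0, 1:] [:x:] [:y:] 1 M P \<longrightarrow> P \<noteq> 0 \<longrightarrow> int (degree P) \<le> a + int (0 * M)"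
    using restriction_degree[of 1 "[:x:]" 0 "[:y:]"] by auto
  obtain P where P: "restricts_to [:0, 1:] [:x:] [:y:] 1 (M1 + M2) P" using M1[rule_format, of "M1 + M2"] by auto
  then have "poly P s = pval (s, x, y) F" by (simp add: restricts_to_def)
  then have "P \<noteq> 0" using F by auto
  then show ?thesis using M2[rule_format, of "M1 + M2" P] P by simp
qed

text \<open>
  Restriction to a line in a fibre of the projection to the projective line; the parametrization is
  chosen so that \<open>t = 0\<close> is at infinity.
\<close>
lemma b_nonneg: "0 \<le> b"
proof (rule ccontr)
  assume b: "\<not> 0 \<le> b"
  obtain s x y where x: "x \<in> UNIV - {0}" and F: "pval (s, x, y) F \<noteq> 0"
    by (rule poly3_nonzero_value[OF F0 infinite_Compl_singleton[of 0] infinite_Compl_singleton[of 0] infinite_Compl_singleton[of 0]])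
  let ?t = "[:0, 1 :: complex:]"
  have "degree ([:s:] * ?t) \<le> 1" "degree [:x:] \<le> 1" "degree [:y:] \<le> 1" "degree ?t \<le> 1" by simp_all
  from restriction_exists[OF this] obtain M P where P: "restricts_to [:s:] [:x:] [:y:] ?t M P" "degree P \<le> 1 * M"
    by blast
  have "?t ^ nat (int M - b) dvd P"
    by (rule restriction_dvd[OF _ _ P(1)]) (use x b in auto)
  moreover have "poly P 1 = pval (s, x, y) F" using P(1) by (simp add: restricts_to_def)
  then have "P \<noteq> 0" using F by auto
  ultimately have "degree (?t ^ nat (int M - b)) \<le> degree P" by (rule dvd_imp_degree_le)
  then have "nat (int M - b) \<le> M" using P(2) by (simp add: degree_power_eq)
  then show False using b by simp
qed

text \<open>
  The left hand side is at most the number of zeros of \<open>F\<close> on the curve, and the right hand side is the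
  intersection number of the curve with \<open>a H\<^sub>1 + b H\<^sub>2\<close>. The difference is nonnegative because \<open>F\<close> does not
  vanish identically on the curve.
\<close>
lemma curve_bound:
  assumes deg: "degree \<delta> = e" "degree \<beta> \<le> e" "degree \<gamma> \<le> e"
    and nr: "\<And>z. poly \<delta> z = 0 \<Longrightarrow> poly \<beta> z \<noteq> 0 \<or> poly \<gamma> z \<noteq> 0"
    and pts: "\<And>i. i \<in> I \<Longrightarrow> poly \<delta> (fst (pt i)) \<noteq> 0"
      "\<And>i. i \<in> I \<Longrightarrow> poly \<beta> (fst (pt i)) = fst (snd (pt i)) * poly \<delta> (fst (pt i))"
      "\<And>i. i \<in> I \<Longrightarrow> poly \<gamma> (fst (pt i)) = snd (snd (pt i)) * poly \<delta> (fst (pt i))"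
    and inj: "inj_on (\<lambda>i. fst (pt i)) I"
    and t0: "poly \<delta> t0 \<noteq> 0" "pval (t0, poly \<beta> t0 / poly \<delta> t0, poly \<gamma> t0 / poly \<delta> t0) F \<noteq> 0"
  shows "(\<Sum>i\<in>I. int (nat (m i))) \<le> a + int e * b"
proof -
  have \<delta>: "\<delta> \<noteq> 0" using t0 by auto
  have fin: "finite I" by simp
  let ?t = "[:0, 1 :: complex:]"
  define q where "q i = [:- fst (pt i), 1:] ^ nat (m i)" for i
  have "degree (?t * \<delta>) \<le> Suc e" using degree_mult_le[of ?t \<delta>] deg by simp
  then obtain M1 where M1: "\<forall>M\<ge>M1. \<exists>P. restricts_to ?t \<beta> \<gamma> \<delta> M P \<and> degree P \<le> Suc e * M"
    using restriction_exists[of ?t \<delta> "Suc e" \<beta> \<gamma>] deg by auto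
  obtain M2 where M2: "\<forall>M\<ge>M2. \<forall>P. restricts_to ?t \<beta> \<gamma> \<delta> M P \<longrightarrow> P \<noteq> 0 \<longrightarrow> int (degree P) \<le> a + int (e * M)"
    using restriction_degree[OF \<delta> deg(2,3)] deg(1) by auto
  have "\<forall>i\<in>I. \<exists>M0. \<forall>M\<ge>M0. \<forall>P. restricts_to ?t \<beta> \<gamma> \<delta> M P \<longrightarrow> q i dvd P"
    unfolding q_def using restriction_multiplicity[OF \<delta>] pts by blast
  then obtain Mi where Mi: "\<forall>i\<in>I. \<forall>M\<ge>Mi i. \<forall>P. restricts_to ?t \<beta> \<gamma> \<delta> M P \<longrightarrow> q i dvd P"
    by (rule bchoice[THEN exE])
  define M where "M = M1 + M2 + (\<Sum>i\<in>I. Mi i) + nat b"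
  have MM: "M \<ge> M1" "M \<ge> M2" "M \<ge> nat b" unfolding M_def by linarith+
  have Mb: "int M \<ge> b" using MM(3) by linarith
  have MMi: "M \<ge> Mi i" if "i \<in> I" for i
    using member_le_sum[of i I Mi] that fin by (simp add: M_def)
  obtain P where P: "restricts_to ?t \<beta> \<gamma> \<delta> M P" using M1 MM(1) by blast
  have "poly P t0 \<noteq> 0" using P t0 by (simp add: restricts_to_def)
  then have P0: "P \<noteq> 0" by auto
  define N where "N = nat (int M - b)"
  have d1: "\<delta> ^ N dvd P" unfolding N_def by (rule restriction_dvd[OF \<delta> Mb P nr])
  have qi: "q i dvd P" if "i \<in> I" for i using Mi that MMi[OF that] P by blast
  have qroot: "z = fst (pt i)" if "poly (q i) z = 0" for i z
    using that by (auto simp: q_def)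
  have d2: "\<delta> ^ N * (\<Prod>i\<in>J. q i) dvd P" if "J \<subseteq> I" for J
    using finite_subset[OF that fin] that
  proof (induction J rule: finite_induct)
    case empty then show ?case using d1 by simp
  next
    case (insert i J)
    have "coprime (\<delta> ^ N * (\<Prod>i\<in>J. q i)) (q i)"
    proof (rule coprime_if_no_common_root, rule notI)
      fix z assume z: "poly (\<delta> ^ N * (\<Prod>i\<in>J. q i)) z = 0" "poly (q i) z = 0"
      have zi: "z = fst (pt i)" by (rule qroot[OF z(2)])
      have "poly \<delta> z \<noteq> 0" using pts(1) insert.prems zi by auto
      then have "(\<Prod>j\<in>J. poly (q j) z) = 0" using z(1) by (simp add: poly_prod)
      then obtain j where j: "j \<in> J" "poly (q j) z = 0" using insert.hyps(1) by auto
      then have "fst (pt j) = fst (pt i)" using qroot zi by metis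
      then have "j = i" using inj insert.prems j(1) by (auto simp: inj_on_def)
      then show False using j(1) insert.hyps(2) by simp
    qed
    note co = this
    have J: "\<delta> ^ N * (\<Prod>i\<in>J. q i) dvd P" using insert.IH insert.prems by blast
    have "q i dvd P" using qi insert.prems by blast
    from divides_mult[OF J this co] have "(\<delta> ^ N * (\<Prod>i\<in>J. q i)) * q i dvd P" .
    then show ?case using insert.hyps by (simp add: mult_ac)
  qed
  have "degree (\<delta> ^ N * (\<Prod>i\<in>I. q i)) = N * e + (\<Sum>i\<in>I. nat (m i))"
  proof -
    have q0: "q i \<noteq> 0" for i by (simp add: q_def)
    have "degree (\<Prod>i\<in>I. q i) = (\<Sum>i\<in>I. degree (q i))" by (rule degree_prod_eq_sum_degree) (simp add: q0)
    also have "\<dots> = (\<Sum>i\<in>I. nat (m i))" by (simp add: q_def degree_power_eq)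
    finally have 1: "degree (\<Prod>i\<in>I. q i) = (\<Sum>i\<in>I. nat (m i))" .
    have "(\<Prod>i\<in>I. q i) \<noteq> 0" using q0 fin by simp
    then show ?thesis using \<delta> 1 deg(1) by (simp add: degree_mult_eq degree_power_eq)
  qed
  then have "N * e + (\<Sum>i\<in>I. nat (m i)) \<le> degree P" using dvd_imp_degree_le[OF d2[OF order_refl] P0] by simp
  moreover have "int (degree P) \<le> a + int (e * M)" using M2 MM(2) P P0 by blast
  ultimately have "int (N * e + (\<Sum>i\<in>I. nat (m i))) \<le> a + int (e * M)" by linarith
  then have "int N * int e + (\<Sum>i\<in>I. int (nat (m i))) \<le> a + int e * int M"
    by (simp only: of_nat_mult of_nat_sum of_nat_add)
  moreover have "int N = int M - b" using Mb by (simp add: N_def)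
  ultimately show ?thesis by (simp add: algebra_simps)
qed

text \<open>
  Curves of bidegree \<open>(1, 1)\<close> through the point: the plane coordinates move on a line and reach infinity at
  the parameter \<open>r\<close>. They cover the space, so one of them passes through a point where \<open>F\<close> does not vanish.
\<close>
lemma line_bound: "m i \<le> a + b"
proof -
  obtain si xi yi where pt: "pt i = (si, xi, yi)" by (cases "pt i") auto
  obtain t0 x y where t0: "t0 \<in> UNIV - {si}" "x \<in> UNIV - {xi}" and F: "pval (t0, x, y) F \<noteq> 0"
    by (rule poly3_nonzero_value[OF F0 infinite_Compl_singleton[of si] infinite_Compl_singleton[of xi] infinite_Compl_singleton[of 0]])
  obtain r where r: "r \<noteq> si" "r \<noteq> t0"
    using ex_new_if_finite[of "{si, t0}"] infinite_UNIV_char_0 by auto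
  define \<delta> where "\<delta> = [:- r, 1:]"
  define \<xi> where "\<xi> = (x - xi) * (t0 - r) / (t0 - si)"
  define \<eta> where "\<eta> = (y - yi) * (t0 - r) / (t0 - si)"
  define \<beta> where "\<beta> = smult xi \<delta> + smult \<xi> [:- si, 1:]"
  define \<gamma> where "\<gamma> = smult yi \<delta> + smult \<eta> [:- si, 1:]"
  have ts: "t0 - si \<noteq> 0" "t0 - r \<noteq> 0" "r - si \<noteq> 0" using t0 r by auto
  have "(\<Sum>i\<in>{i}. int (nat (m i))) \<le> a + int 1 * b"
  proof (rule curve_bound[of \<delta> 1 \<beta> \<gamma> "{i}" t0])
    show "degree \<delta> = 1" by (simp add: \<delta>_def)
    show "degree \<beta> \<le> 1" "degree \<gamma> \<le> 1" unfolding \<beta>_def \<gamma>_def \<delta>_def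
      by (intro degree_add_le degree_smult_le[THEN order_trans]; simp)+
    show "poly \<beta> z \<noteq> 0 \<or> poly \<gamma> z \<noteq> 0" if z: "poly \<delta> z = 0" for z
    proof -
      have "z = r" using z by (simp add: \<delta>_def)
      then have "poly \<beta> z = \<xi> * (r - si)" by (simp add: \<beta>_def \<delta>_def algebra_simps)
      then show ?thesis using ts t0(2) by (simp add: \<xi>_def)
    qed
    show "inj_on (\<lambda>i. fst (pt i)) {i}" by simp
    show "poly \<delta> t0 \<noteq> 0" using r by (simp add: \<delta>_def)
    have \<xi>\<eta>: "\<xi> * (t0 - si) = (x - xi) * (t0 - r)" "\<eta> * (t0 - si) = (y - yi) * (t0 - r)"
      using ts by (simp_all add: \<xi>_def \<eta>_def)
    have "poly \<beta> t0 = xi * (t0 - r) + \<xi> * (t0 - si)" "poly \<gamma> t0 = yi * (t0 - r) + \<eta> * (t0 - si)"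
      by (simp_all add: \<beta>_def \<gamma>_def \<delta>_def algebra_simps)
    then have "poly \<beta> t0 = x * (t0 - r)" "poly \<gamma> t0 = y * (t0 - r)" unfolding \<xi>\<eta> by (simp_all add: algebra_simps)
    then have 1: "poly \<beta> t0 / poly \<delta> t0 = x" and 2: "poly \<gamma> t0 / poly \<delta> t0 = y" using ts by (simp_all add: \<delta>_def)
    show "pval (t0, poly \<beta> t0 / poly \<delta> t0, poly \<gamma> t0 / poly \<delta> t0) F \<noteq> 0" unfolding 1 2 by (rule F)
  qed (use r in \<open>simp_all add: pt \<delta>_def \<beta>_def \<gamma>_def algebra_simps\<close>)
  moreover have "m i \<le> int (nat (m i))" by simp
  ultimately show ?thesis by (simp del: int_nat_eq)
qed

text \<open>
  The graphs \<open>t \<mapsto> (t, c(t))\<close> of conics \<open>c\<close> with \<open>c(s\<^sub>i)\<close> equal to the \<open>i\<close>-th plane point. With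
  respect to the triangle of these points they are \<open>t \<mapsto> (l\<^sub>i / (t - s\<^sub>i))\<^sub>i\<close>, and the coefficients \<open>l\<^sub>i\<close> can be chosen so that
  the curve passes through a given point with barycentric coordinates \<open>v\<^sub>i\<close>. As the triangle is nondegenerate, the
  curves cover the space, and their degree in the plane is \<open>2\<close>.
\<close>
lemma conic_bound:
  assumes distinct: "\<And>i j. i \<noteq> j \<Longrightarrow> fst (pt i) \<noteq> fst (pt j)"
    and det: "det3 (snd (pt 1)) (snd (pt 2)) (snd (pt 3)) \<noteq> 0"
  shows "(\<Sum>i\<in>UNIV. int (nat (m i))) \<le> a + 2 * b"
proof -
  define s where "s i = fst (pt i)" for i
  define x where "x i = fst (snd (pt i))" for i
  define y where "y i = snd (snd (pt i))" for i
  have pt: "fst (pt i) = s i" "snd (pt i) = (x i, y i)" for i by (simp_all add: s_def x_def y_def)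
  have dist: "s 1 \<noteq> s 2" "s 1 \<noteq> s 3" "s 2 \<noteq> s 3" using distinct by (auto simp: s_def)
  define c where "c = (x 2 - x 1) * (y 3 - y 1) - (x 3 - x 1) * (y 2 - y 1)"
  have c: "c \<noteq> 0" using det by (simp add: det3_def pt c_def)
  \<comment> \<open>Barycentric coordinates with respect to the three points, as polynomials with sum \<open>c\<close>.\<close>
  define \<mu>1 where "\<mu>1 = (C3 (x 2) - X3) * (C3 (y 3) - Y3) - (C3 (x 3) - X3) * (C3 (y 2) - Y3)"
  define \<mu>2 where "\<mu>2 = (X3 - C3 (x 1)) * (C3 (y 3) - C3 (y 1)) - (C3 (x 3) - C3 (x 1)) * (Y3 - C3 (y 1))"
  define \<mu>3 where "\<mu>3 = (C3 (x 2) - C3 (x 1)) * (Y3 - C3 (y 1)) - (X3 - C3 (x 1)) * (C3 (y 2) - C3 (y 1))"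
  \<comment> \<open>The value of \<open>L\<close> at the chosen point is the leading coefficient of the denominator \<open>\<delta>\<close> of the conic.\<close>
  define L where "L = C3 c * S3 - (\<mu>1 * C3 (s 1) + \<mu>2 * C3 (s 2) + \<mu>3 * C3 (s 3))"
  define W where "W = F * \<mu>1 * \<mu>2 * \<mu>3 * L * (S3 - C3 (s 1)) * (S3 - C3 (s 2)) * (S3 - C3 (s 3))"
  have nz: "G \<noteq> 0" if "pval p G \<noteq> 0" for p G using that by auto
  have "pval (0, x 1, y 1) \<mu>1 = c" "pval (0, x 2, y 2) \<mu>2 = c" "pval (0, x 3, y 3) \<mu>3 = c"
    unfolding \<mu>1_def \<mu>2_def \<mu>3_def c_def by (simp_all only: pval_simps)
  then have \<mu>nz: "\<mu>1 \<noteq> 0" "\<mu>2 \<noteq> 0" "\<mu>3 \<noteq> 0" using c nz by metis+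
  have "pval (1 + s 1, x 1, y 1) L = c"
    unfolding L_def \<mu>1_def \<mu>2_def \<mu>3_def c_def by (simp only: pval_simps) (simp add: algebra_simps)
  then have Lnz: "L \<noteq> 0" using c nz by metis
  have "pval (1 + r, 0, 0) (S3 - C3 r) = 1" for r by (simp only: pval_simps) simp
  then have Snz: "S3 - C3 r \<noteq> 0" for r using nz by (metis one_neq_zero)
  have "W \<noteq> 0" unfolding W_def using F0 \<mu>nz Lnz Snz by (simp only: mult_eq_0_iff simp_thms)
  obtain t0 x0 y0 where W: "pval (t0, x0, y0) W \<noteq> 0"
    by (rule poly3_nonzero_value[OF \<open>W \<noteq> 0\<close> infinite_Compl_singleton[of 0] infinite_Compl_singleton[of 0] infinite_Compl_singleton[of 0]])
  define v1 where "v1 = (x 2 - x0) * (y 3 - y0) - (x 3 - x0) * (y 2 - y0)"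
  define v2 where "v2 = (x0 - x 1) * (y 3 - y 1) - (x 3 - x 1) * (y0 - y 1)"
  define v3 where "v3 = (x 2 - x 1) * (y0 - y 1) - (x0 - x 1) * (y 2 - y 1)"
  have vals: "pval (t0, x0, y0) \<mu>1 = v1" "pval (t0, x0, y0) \<mu>2 = v2" "pval (t0, x0, y0) \<mu>3 = v3"
    "pval (t0, x0, y0) L = c * t0 - (v1 * s 1 + v2 * s 2 + v3 * s 3)"
    unfolding L_def \<mu>1_def \<mu>2_def \<mu>3_def v1_def v2_def v3_def by (simp_all only: pval_simps)
  have W': "pval (t0, x0, y0) F \<noteq> 0" "v1 \<noteq> 0" "v2 \<noteq> 0" "v3 \<noteq> 0" "c * t0 - (v1 * s 1 + v2 * s 2 + v3 * s 3) \<noteq> 0"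
    "t0 \<noteq> s 1" "t0 \<noteq> s 2" "t0 \<noteq> s 3"
    using W unfolding W_def pval_simps vals by auto
  have bary: "v1 + v2 + v3 = c" "v1 * x 1 + v2 * x 2 + v3 * x 3 = c * x0" "v1 * y 1 + v2 * y 2 + v3 * y 3 = c * y0"
    unfolding v1_def v2_def v3_def c_def by algebra+
  \<comment> \<open>The factor \<open>t0 - s 1\<close> makes the curve pass through \<open>(x0, y0)\<close> at the parameter \<open>t0\<close>, where \<open>P1\<close> is \<open>T / (t0 - s 1)\<close>.\<close>
  define l1 where "l1 = v1 * (t0 - s 1)"
  define l2 where "l2 = v2 * (t0 - s 2)"
  define l3 where "l3 = v3 * (t0 - s 3)"
  define P1 where "P1 = [:- s 2, 1:] * [:- s 3, 1:]"
  define P2 where "P2 = [:- s 1, 1:] * [:- s 3, 1:]"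
  define P3 where "P3 = [:- s 1, 1:] * [:- s 2, 1:]"
  have lnz: "l1 \<noteq> 0" "l2 \<noteq> 0" "l3 \<noteq> 0" using W' by (simp_all add: l1_def l2_def l3_def)
  define comb where "comb z1 z2 z3 = smult (l1 * z1) P1 + smult (l2 * z2) P2 + smult (l3 * z3) P3" for z1 z2 z3
  define \<delta> where "\<delta> = comb 1 1 1"
  define \<beta> where "\<beta> = comb (x 1) (x 2) (x 3)"
  define \<gamma> where "\<gamma> = comb (y 1) (y 2) (y 3)"
  have comb_poly: "poly (comb z1 z2 z3) t = l1 * z1 * ((t - s 2) * (t - s 3)) + l2 * z2 * ((t - s 1) * (t - s 3)) +
      l3 * z3 * ((t - s 1) * (t - s 2))" for z1 z2 z3 t
    by (simp add: comb_def P1_def P2_def P3_def algebra_simps)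
  define T where "T = (t0 - s 1) * (t0 - s 2) * (t0 - s 3)"
  have T: "T \<noteq> 0" using W' by (simp add: T_def)
  have comb_t0: "poly (comb z1 z2 z3) t0 = (v1 * z1 + v2 * z2 + v3 * z3) * T" for z1 z2 z3
    unfolding comb_poly l1_def l2_def l3_def T_def by (simp add: algebra_simps)
  have deg_comb: "degree (comb z1 z2 z3) \<le> 2" for z1 z2 z3
    unfolding comb_def P1_def P2_def P3_def
    by (intro degree_add_le degree_smult_le[THEN order_trans]) (simp_all add: degree_mult_eq)
  have "coeff \<delta> 2 = l1 + l2 + l3"
    by (simp add: \<delta>_def comb_def P1_def P2_def P3_def numeral_2_eq_2)
  also have "\<dots> = (v1 + v2 + v3) * t0 - (v1 * s 1 + v2 * s 2 + v3 * s 3)"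
    by (simp add: l1_def l2_def l3_def algebra_simps)
  finally have "coeff \<delta> 2 \<noteq> 0" using W'(5) bary(1) by simp
  then have deg\<delta>: "degree \<delta> = 2" using deg_comb[of 1 1 1] le_degree[of \<delta> 2] unfolding \<delta>_def by simp
  have at: "poly (comb z1 z2 z3) (s 1) = z1 * (l1 * ((s 1 - s 2) * (s 1 - s 3)))"
    "poly (comb z1 z2 z3) (s 2) = z2 * (l2 * ((s 2 - s 1) * (s 2 - s 3)))"
    "poly (comb z1 z2 z3) (s 3) = z3 * (l3 * ((s 3 - s 1) * (s 3 - s 2)))" for z1 z2 z3
    unfolding comb_poly by simp_all
  have "(\<Sum>i\<in>UNIV. int (nat (m i))) \<le> a + int 2 * b"
  proof (rule curve_bound[of \<delta> 2 \<beta> \<gamma> UNIV t0])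
    show "degree \<delta> = 2" by (rule deg\<delta>)
    show "degree \<beta> \<le> 2" "degree \<gamma> \<le> 2" unfolding \<beta>_def \<gamma>_def by (rule deg_comb)+
    show "poly \<beta> z \<noteq> 0 \<or> poly \<gamma> z \<noteq> 0" if z: "poly \<delta> z = 0" for z
    proof (rule ccontr)
      assume "\<not> ?thesis"
      then have 0: "poly \<beta> z = 0" "poly \<gamma> z = 0" by auto
      define w1 where "w1 = l1 * ((z - s 2) * (z - s 3))"
      define w2 where "w2 = l2 * ((z - s 1) * (z - s 3))"
      define w3 where "w3 = l3 * ((z - s 1) * (z - s 2))"
      have e: "w1 + w2 + w3 = 0" "w1 * x 1 + w2 * x 2 + w3 * x 3 = 0" "w1 * y 1 + w2 * y 2 + w3 * y 3 = 0"
        using z 0 unfolding \<beta>_def \<gamma>_def \<delta>_def comb_poly w1_def w2_def w3_def by (simp_all add: mult_ac)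
      have "c * w2 = 0" "c * w3 = 0" "c * w1 = 0" using e unfolding c_def by algebra+
      then have "w1 = 0" "w2 = 0" "w3 = 0" using c by simp_all
      then show False using lnz dist unfolding w1_def w2_def w3_def by auto
    qed
    show "inj_on (\<lambda>i. fst (pt i)) UNIV" using distinct by (auto simp: inj_on_def)
    have \<delta>t0: "poly \<delta> t0 = c * T" unfolding \<delta>_def comb_t0 using bary(1) by simp
    then show "poly \<delta> t0 \<noteq> 0" using c T by simp
    have "poly \<beta> t0 / poly \<delta> t0 = x0" "poly \<gamma> t0 / poly \<delta> t0 = y0"
      unfolding \<delta>t0 unfolding \<beta>_def \<gamma>_def comb_t0 bary using c T by simp_all
    then show "pval (t0, poly \<beta> t0 / poly \<delta> t0, poly \<gamma> t0 / poly \<delta> t0) F \<noteq> 0" using W'(1) by simp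
    show "poly \<delta> (fst (pt i)) \<noteq> 0" for i
      using exhaust_3[of i] dist lnz unfolding pt \<delta>_def by (auto simp: at)
    show "poly \<beta> (fst (pt i)) = fst (snd (pt i)) * poly \<delta> (fst (pt i))" for i
      using exhaust_3[of i] unfolding pt \<beta>_def \<delta>_def by (auto simp: at)
    show "poly \<gamma> (fst (pt i)) = snd (snd (pt i)) * poly \<delta> (fst (pt i))" for i
      using exhaust_3[of i] unfolding pt \<gamma>_def \<delta>_def by (auto simp: at)
  qed
  then show ?thesis by simp
qed

end

section \<open>The effective cone\<close>

context three_points
begin

text \<open>
  The bound from conics involves the positive parts of the multiplicities, so it implies the
  bounds for two points whatever the sign of the third multiplicity.
\<close>
lemma effective_class_bounds:
  assumes det: "det3 (snd (pt 1)) (snd (pt 2)) (snd (pt 3)) \<noteq> 0"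
    and D: "effective_divisor X D"
  obtains a b :: int and m where
    "formal D \<sim> real_of_int a *\<^sub>R formal H1 + real_of_int b *\<^sub>R formal H2 - (\<Sum>i\<in>UNIV. real_of_int (m i) *\<^sub>R formal (E i))"
    "0 \<le> a" "0 \<le> b" "\<And>i. m i \<le> a + b" "\<And>i j. i \<noteq> j \<Longrightarrow> m i + m j \<le> a + 2 * b" "(\<Sum>i\<in>UNIV. m i) \<le> a + 2 * b"
proof (rule effective_divisor_equation[OF D])
  fix F a b m G1 G2 G3 H
  assume F0: "F \<noteq> 0"
    and cls: "formal D \<sim> real_of_int a *\<^sub>R formal H1 + real_of_int b *\<^sub>R formal H2 - (\<Sum>i\<in>UNIV. real_of_int (m i) *\<^sub>R formal (E i))"
    and eq1: "to_fract F * inverse Sf powi a = prod_chart 2 1 G1"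
    and eq2: "to_fract F * inverse Xf powi b = prod_chart 1 2 G2"
    and eq3: "to_fract F * inverse Yf powi b = prod_chart 1 3 G3"
    and eq4: "\<And>i. to_fract F * dev (pt i) 1 powi (- m i) = blow_chart (pt i) 1 (H i)"
  note hv = has_value_arith(2)[OF has_value_poly has_value_powi]
  interpret N: plane_class F a b m G1 G2 G3 H pt
  proof
    show "F \<noteq> 0" by (rule F0)
    fix s x y :: complex
    note c = has_value_coords[of s x y]
    show "pval (s, x, y) F * inverse s powi a = pval (inverse s, x, y) G1" if s: "s \<noteq> 0"
    proof -
      have "has_value (s, x, y) (to_fract F * inverse Sf powi a) (pval (s, x, y) F * inverse s powi a)"
        using s by (intro hv has_value_inverse c) simp_all
      moreover have "has_value (s, x, y) (prod_chart 2 1 G1) (pval (inverse s, x, y) G1)"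
        unfolding prod_chart_def affine_coord_simps by (intro has_value_eval3 has_value_inverse c s)
      ultimately show ?thesis unfolding eq1 by (rule has_value_unique)
    qed
    show "pval (s, x, y) F * inverse x powi b = pval (s, inverse x, y / x) G2" if x: "x \<noteq> 0"
    proof -
      have "has_value (s, x, y) (to_fract F * inverse Xf powi b) (pval (s, x, y) F * inverse x powi b)"
        using x by (intro hv has_value_inverse c) simp_all
      moreover have "has_value (s, x, y) (prod_chart 1 2 G2) (pval (s, inverse x, y / x) G2)"
        unfolding prod_chart_def affine_coord_simps by (intro has_value_eval3 has_value_inverse has_value_divide c x)
      ultimately show ?thesis unfolding eq2 by (rule has_value_unique)
    qed
    show "pval (s, x, y) F * inverse y powi b = pval (s, inverse y, x / y) G3" if y: "y \<noteq> 0"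
    proof -
      have "has_value (s, x, y) (to_fract F * inverse Yf powi b) (pval (s, x, y) F * inverse y powi b)"
        using y by (intro hv has_value_inverse c) simp_all
      moreover have "has_value (s, x, y) (prod_chart 1 3 G3) (pval (s, inverse y, x / y) G3)"
        unfolding prod_chart_def affine_coord_simps by (intro has_value_eval3 has_value_inverse has_value_divide c y)
      ultimately show ?thesis unfolding eq3 by (rule has_value_unique)
    qed
    show "pval (s, x, y) F * (s - fst (pt i)) powi (- m i) =
        pval (s - fst (pt i), (x - fst (snd (pt i))) / (s - fst (pt i)), (y - snd (snd (pt i))) / (s - fst (pt i))) (H i)"
      if s: "s \<noteq> fst (pt i)" for i
    proof -
      have d: "has_value (s, x, y) (dev (pt i) 1) (s - fst (pt i))" "has_value (s, x, y) (dev (pt i) 2) (x - fst (snd (pt i)))"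
        "has_value (s, x, y) (dev (pt i) 3) (y - snd (snd (pt i)))"
        unfolding dev_def using has_value_arith(3)[OF c(1) has_value_const] has_value_arith(3)[OF c(2) has_value_const]
          has_value_arith(3)[OF c(3) has_value_const] by simp_all
      have "has_value (s, x, y) (to_fract F * dev (pt i) 1 powi (- m i)) (pval (s, x, y) F * (s - fst (pt i)) powi (- m i))"
        using s by (intro hv d) simp
      moreover have "has_value (s, x, y) (blow_chart (pt i) 1 (H i))
          (pval (s - fst (pt i), (x - fst (snd (pt i))) / (s - fst (pt i)), (y - snd (snd (pt i))) / (s - fst (pt i))) (H i))"
        unfolding blow_chart_def other1_def other2_def using s
        by (simp only: three_ne if_False if_True simp_thms) (intro has_value_eval3 has_value_divide d, simp_all)
      ultimately show ?thesis unfolding eq4 by (rule has_value_unique)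
    qed
  qed
  have conic: "(\<Sum>i\<in>UNIV. int (nat (m i))) \<le> a + 2 * b" by (rule N.conic_bound[OF distinct det])
  have le: "m i \<le> int (nat (m i))" "0 \<le> int (nat (m i))" for i by simp_all
  have "(\<Sum>i\<in>UNIV. m i) \<le> (\<Sum>i\<in>UNIV. int (nat (m i)))" by (intro sum_mono le)
  then have 3: "(\<Sum>i\<in>UNIV. m i) \<le> a + 2 * b" using conic by linarith
  have 2: "m i + m j \<le> a + 2 * b" if ij: "i \<noteq> j" for i j
  proof -
    have "m i + m j \<le> (\<Sum>k\<in>{i, j}. int (nat (m k)))" using ij le[of i] le[of j] by simp
    also have "\<dots> \<le> (\<Sum>k\<in>UNIV. int (nat (m k)))" by (intro sum_mono2) simp_all
    finally show ?thesis using conic by linarith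
  qed
  show thesis by (rule that[OF cls N.a_nonneg N.b_nonneg N.line_bound 2 3])
qed

definition bounds :: "real \<Rightarrow> real \<Rightarrow> (3 \<Rightarrow> real) \<Rightarrow> bool" where
  "bounds d1 d2 m \<longleftrightarrow> 0 \<le> d1 \<and> 0 \<le> d2 \<and> (\<forall>i. m i \<le> d1 + d2) \<and>
     (\<forall>i j. i \<noteq> j \<longrightarrow> m i + m j \<le> d1 + 2 * d2) \<and> (\<Sum>i\<in>UNIV. m i) \<le> d1 + 2 * d2"

definition cls :: "real \<Rightarrow> real \<Rightarrow> (3 \<Rightarrow> real) \<Rightarrow> K divisor \<Rightarrow>\<^sub>0 real" where
  "cls d1 d2 m = d1 *\<^sub>R formal H1 + d2 *\<^sub>R formal H2 - (\<Sum>i\<in>UNIV. m i *\<^sub>R formal (E i))"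

definition gens :: "(K divisor \<Rightarrow>\<^sub>0 real) set" where
  "gens = {formal (E i) | i. True} \<union> {formal H1 - formal (E i) | i. True} \<union>
     {formal H2 - formal (E i) - formal (E j) | i j. i \<noteq> j}"

abbreviation "effs \<equiv> {formal D | D. effective_divisor X D}"

lemma cls_add: "cls d1 d2 m + cls d1' d2' m' = cls (d1 + d1') (d2 + d2') (\<lambda>i. m i + m' i)"
  by (simp add: cls_def scaleR_add_left sum.distrib algebra_simps)

lemma cls_scale: "c *\<^sub>R cls d1 d2 m = cls (c * d1) (c * d2) (\<lambda>i. c * m i)"
  by (simp add: cls_def scaleR_add_right scaleR_diff_right scaleR_sum_right)

lemma effs_subset_polyhedron:
  assumes det: "det3 (snd (pt 1)) (snd (pt 2)) (snd (pt 3)) \<noteq> 0"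
    and v: "v \<in> convex_cone hull effs"
  shows "\<exists>d1 d2 m. bounds d1 d2 m \<and> v \<sim> cls d1 d2 m"
proof -
  let ?T = "{v. \<exists>d1 d2 m. bounds d1 d2 m \<and> v \<sim> cls d1 d2 m}"
  have "convex_cone ?T"
    unfolding convex_cone_iff[of ?T]
  proof (intro conjI ballI allI impI)
    have "bounds 0 0 (\<lambda>_. 0)" "0 \<sim> cls 0 0 (\<lambda>_. 0)" by (simp_all add: bounds_def cls_def same_class_refl)
    then show "0 \<in> ?T" by blast
    show "v + w \<in> ?T" if vw: "v \<in> ?T" "w \<in> ?T" for v w
    proof -
      obtain d1 d2 m d1' d2' m' where 1: "bounds d1 d2 m" "v \<sim> cls d1 d2 m" "bounds d1' d2' m'" "w \<sim> cls d1' d2' m'"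
        using vw by blast
      have "v + w \<sim> cls (d1 + d1') (d2 + d2') (\<lambda>i. m i + m' i)"
        using same_class_add[OF 1(2,4)] by (simp add: cls_add)
      moreover have "bounds (d1 + d1') (d2 + d2') (\<lambda>i. m i + m' i)" unfolding bounds_def
      proof (intro conjI allI impI)
        show "0 \<le> d1 + d1'" "0 \<le> d2 + d2'" using 1(1,3) by (auto simp: bounds_def)
        show "m i + m' i \<le> d1 + d1' + (d2 + d2')" for i
          using 1(1,3) unfolding bounds_def by (metis add.assoc add.left_commute add_mono)
        show "m i + m' i + (m j + m' j) \<le> d1 + d1' + 2 * (d2 + d2')" if "i \<noteq> j" for i j
        proof -
          have "m i + m j \<le> d1 + 2 * d2" "m' i + m' j \<le> d1' + 2 * d2'" using 1(1,3) that unfolding bounds_def by blast+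
          then show ?thesis by simp
        qed
        show "(\<Sum>i\<in>UNIV. m i + m' i) \<le> d1 + d1' + 2 * (d2 + d2')"
          using 1(1,3) unfolding bounds_def by (simp add: sum.distrib)
      qed
      ultimately show ?thesis by blast
    qed
    show "c *\<^sub>R v \<in> ?T" if vc: "v \<in> ?T" "0 \<le> c" for v c
    proof -
      obtain d1 d2 m where 1: "bounds d1 d2 m" "v \<sim> cls d1 d2 m" using vc by blast
      have "c *\<^sub>R v \<sim> cls (c * d1) (c * d2) (\<lambda>i. c * m i)"
        using same_class_scale[OF 1(2), of c] by (simp add: cls_scale)
      moreover have "bounds (c * d1) (c * d2) (\<lambda>i. c * m i)" unfolding bounds_def
      proof (intro conjI allI impI)
        have 2: "c * y \<le> c * z" if "y \<le> z" for y z using that vc(2) by (rule mult_left_mono)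
        show "0 \<le> c * d1" "0 \<le> c * d2" using 1 vc(2) by (auto simp: bounds_def)
        show "c * m i \<le> c * d1 + c * d2" for i
          using 2[of "m i" "d1 + d2"] 1(1) by (simp add: bounds_def distrib_left)
        show "c * m i + c * m j \<le> c * d1 + 2 * (c * d2)" if "i \<noteq> j" for i j
          using 2[of "m i + m j" "d1 + 2 * d2"] 1(1) that by (simp add: bounds_def distrib_left)
        show "(\<Sum>i\<in>UNIV. c * m i) \<le> c * d1 + 2 * (c * d2)"
          using 2[of "\<Sum>i\<in>UNIV. m i" "d1 + 2 * d2"] 1(1) by (simp add: bounds_def distrib_left sum_distrib_left)
      qed
      ultimately show ?thesis by blast
    qed
  qed
  moreover have "effs \<subseteq> ?T"
  proof
    fix v assume "v \<in> effs"
    then obtain D where D: "v = formal D" "effective_divisor X D" by blast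
    obtain a b :: int and m where 1:
      "formal D \<sim> real_of_int a *\<^sub>R formal H1 + real_of_int b *\<^sub>R formal H2 - (\<Sum>i\<in>UNIV. real_of_int (m i) *\<^sub>R formal (E i))"
      "0 \<le> a" "0 \<le> b" "\<And>i. m i \<le> a + b" "\<And>i j. i \<noteq> j \<Longrightarrow> m i + m j \<le> a + 2 * b" "(\<Sum>i\<in>UNIV. m i) \<le> a + 2 * b"
      using effective_class_bounds[OF det D(2)] by blast
    have "v \<sim> cls a b (\<lambda>i. m i)" using 1(1) by (simp add: D(1) cls_def)
    moreover have "bounds a b (\<lambda>i. m i)" unfolding bounds_def
    proof (intro conjI allI impI)
      show "0 \<le> real_of_int a" "0 \<le> real_of_int b" using 1(2,3) by simp_all
      show "real_of_int (m i) \<le> real_of_int a + real_of_int b" for i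
        using 1(4)[of i] by linarith
      show "real_of_int (m i) + real_of_int (m j) \<le> real_of_int a + 2 * real_of_int b" if "i \<noteq> j" for i j
        using 1(5)[OF that] by linarith
      have "real_of_int (\<Sum>i\<in>UNIV. m i) \<le> real_of_int (a + 2 * b)" using 1(6) by (simp only: of_int_le_iff)
      then show "(\<Sum>i\<in>UNIV. real_of_int (m i)) \<le> real_of_int a + 2 * real_of_int b" by simp
    qed
    ultimately show "v \<in> ?T" by blast
  qed
  ultimately have "convex_cone hull effs \<subseteq> ?T" by (intro hull_minimal)
  then show ?thesis using v by blast
qed

lemma gens_effective:
  assumes v: "v \<in> convex_cone hull gens"
  shows "\<exists>w\<in>convex_cone hull effs. v \<sim> w"
proof -
  let ?T = "{v. \<exists>w\<in>convex_cone hull effs. v \<sim> w}"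
  note C = convex_cone_convex_cone_hull[of effs]
  have "convex_cone ?T"
    unfolding convex_cone_iff[of ?T]
  proof (intro conjI ballI allI impI)
    show "0 \<in> ?T" using convex_cone_hull_contains_0[of effs] same_class_refl[of 0] by blast
    show "v + w \<in> ?T" if vw: "v \<in> ?T" "w \<in> ?T" for v w
    proof -
      obtain v' w' where "v' \<in> convex_cone hull effs" "v \<sim> v'" "w' \<in> convex_cone hull effs" "w \<sim> w'"
        using vw by blast
      then have "v' + w' \<in> convex_cone hull effs" "v + w \<sim> v' + w'"
        by (simp_all add: convex_cone_add[OF C] same_class_add)
      then show ?thesis by blast
    qed
    show "c *\<^sub>R v \<in> ?T" if vc: "v \<in> ?T" "0 \<le> c" for v c
    proof -
      obtain v' where "v' \<in> convex_cone hull effs" "v \<sim> v'" using vc by blast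
      then have "c *\<^sub>R v' \<in> convex_cone hull effs" "c *\<^sub>R v \<sim> c *\<^sub>R v'"
        using vc(2) by (simp_all add: convex_cone_scaleR[OF C] same_class_scale)
      then show ?thesis by blast
    qed
  qed
  moreover have "gens \<subseteq> ?T"
  proof
    have I: "v \<in> ?T" if "\<exists>D. effective_divisor X D \<and> v \<sim> formal D" for v
      using that hull_inc[of _ effs convex_cone] by blast
    fix v assume "v \<in> gens"
    then consider i where "v = formal (E i)" | i where "v = formal H1 - formal (E i)"
      | i j where "i \<noteq> j" "v = formal H2 - formal (E i) - formal (E j)"
      unfolding gens_def by blast
    then show "v \<in> ?T"
    proof cases
      case (1 i) show ?thesis by (rule I) (simp only: 1(1) effective_E)
    next
      case (2 i) show ?thesis by (rule I) (simp only: 2(1) effective_H1_minus_E)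
    next
      case (3 i j) show ?thesis by (rule I) (simp only: 3(2) effective_H2_minus_E_minus_E[OF 3(1)])
    qed
  qed
  ultimately have "convex_cone hull gens \<subseteq> ?T" by (intro hull_minimal)
  then show ?thesis using v by blast
qed

end

text \<open>Each multiplicity is split into a part \<open>a\<^sub>i\<close> carried by the fibre classes and a part \<open>r\<^sub>i \<le> d\<^sub>2\<close> carried
  by the line classes. Negative multiplicities are first raised to zero, and \<open>c\<^sub>i\<close> truncates the result at \<open>d\<^sub>2\<close>. If
  the truncated multiplicities have sum at most \<open>2 d\<^sub>2\<close>, they are moved towards \<open>d\<^sub>2\<close> until the sum is \<open>2 d\<^sub>2\<close>;
  otherwise they are scaled down to this sum. In both cases the inequalities bound the sum of the remainders
  by \<open>d\<^sub>1\<close>.\<close>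
lemma split_multiplicities:
  fixes d1 d2 m1 m2 m3 :: real
  assumes "0 \<le> d1" "0 \<le> d2" "m1 \<le> d1 + d2" "m2 \<le> d1 + d2" "m3 \<le> d1 + d2"
    "m1 + m2 \<le> d1 + 2 * d2" "m1 + m3 \<le> d1 + 2 * d2" "m2 + m3 \<le> d1 + 2 * d2" "m1 + m2 + m3 \<le> d1 + 2 * d2"
  obtains a1 a2 a3 r1 r2 r3 where "0 \<le> a1" "0 \<le> a2" "0 \<le> a3" "a1 + a2 + a3 \<le> d1"
    "0 \<le> r1" "0 \<le> r2" "0 \<le> r3" "r1 \<le> d2" "r2 \<le> d2" "r3 \<le> d2" "r1 + r2 + r3 = 2 * d2"
    "m1 \<le> a1 + r1" "m2 \<le> a2 + r2" "m3 \<le> a3 + r3"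
proof -
  define n1 where "n1 = max 0 m1" define n2 where "n2 = max 0 m2" define n3 where "n3 = max 0 m3"
  have n: "0 \<le> n1" "0 \<le> n2" "0 \<le> n3" "m1 \<le> n1" "m2 \<le> n2" "m3 \<le> n3" by (auto simp: n1_def n2_def n3_def)
  have nle: "n1 \<le> d1 + d2" "n2 \<le> d1 + d2" "n3 \<le> d1 + d2"
    "n1 + n2 \<le> d1 + 2 * d2" "n1 + n3 \<le> d1 + 2 * d2" "n2 + n3 \<le> d1 + 2 * d2" "n1 + n2 + n3 \<le> d1 + 2 * d2"
    unfolding n1_def n2_def n3_def using assms by (simp_all add: max_def)
  define c1 where "c1 = min n1 d2" define c2 where "c2 = min n2 d2" define c3 where "c3 = min n3 d2"
  have c: "0 \<le> c1" "0 \<le> c2" "0 \<le> c3" "c1 \<le> d2" "c2 \<le> d2" "c3 \<le> d2" "c1 \<le> n1" "c2 \<le> n2" "c3 \<le> n3"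
    using n assms(2) by (auto simp: c1_def c2_def c3_def)
  show thesis
  proof (cases "c1 + c2 + c3 \<le> 2 * d2")
    case True
    define \<theta> where "\<theta> = (if c1 + c2 + c3 = 3 * d2 then 0 else (2 * d2 - (c1 + c2 + c3)) / (3 * d2 - (c1 + c2 + c3)))"
    have \<theta>: "0 \<le> \<theta>" "\<theta> \<le> 1" "\<theta> * (3 * d2 - (c1 + c2 + c3)) = 2 * d2 - (c1 + c2 + c3)"
      using True c assms(2) by (auto simp: \<theta>_def divide_simps)
    define f where "f c = c + \<theta> * (d2 - c)" for c
    have f: "c \<le> f c" "f c \<le> d2" if "c \<le> d2" for c
    proof -
      show "c \<le> f c" using \<theta>(1) that by (simp add: f_def)
      have "\<theta> * (d2 - c) \<le> 1 * (d2 - c)" using \<theta>(2) that by (intro mult_right_mono) simp_all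
      then show "f c \<le> d2" by (simp add: f_def)
    qed
    have sum: "f c1 + f c2 + f c3 = 2 * d2" using \<theta>(3) by (simp add: f_def algebra_simps)
    have a: "n1 \<le> (n1 - c1) + f c1" "n2 \<le> (n2 - c2) + f c2" "n3 \<le> (n3 - c3) + f c3" using f(1) c by auto
    have "(n1 - c1) + (n2 - c2) + (n3 - c3) \<le> d1"
      unfolding c1_def c2_def c3_def min_def using nle assms(1,2) by (simp split: if_splits)
    moreover have "0 \<le> f c1" "0 \<le> f c2" "0 \<le> f c3"
      using f(1)[OF c(4)] f(1)[OF c(5)] f(1)[OF c(6)] c(1-3) by linarith+
    moreover have "m1 \<le> (n1 - c1) + f c1" "m2 \<le> (n2 - c2) + f c2" "m3 \<le> (n3 - c3) + f c3"
      using a n(4-6) by linarith+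
    ultimately show thesis
      using that[of "n1 - c1" "n2 - c2" "n3 - c3" "f c1" "f c2" "f c3"] c(7-9) f(2)[OF c(4)] f(2)[OF c(5)] f(2)[OF c(6)] sum
      by simp
  next
    case False
    define \<theta> where "\<theta> = 2 * d2 / (c1 + c2 + c3)"
    have \<theta>: "0 \<le> \<theta>" "\<theta> \<le> 1" "\<theta> * (c1 + c2 + c3) = 2 * d2"
      using False assms(2) by (auto simp: \<theta>_def divide_simps)
    have f: "0 \<le> \<theta> * c" "\<theta> * c \<le> c" if "0 \<le> c" for c
      using \<theta>(1,2) that by (simp_all add: mult_left_le_one_le)
    have sum: "\<theta> * c1 + \<theta> * c2 + \<theta> * c3 = 2 * d2" using \<theta>(3) by (simp add: algebra_simps)
    have "(n1 - \<theta> * c1) + (n2 - \<theta> * c2) + (n3 - \<theta> * c3) \<le> d1" using sum nle(7) by linarith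
    moreover have "0 \<le> n1 - \<theta> * c1" "0 \<le> n2 - \<theta> * c2" "0 \<le> n3 - \<theta> * c3"
      "\<theta> * c1 \<le> d2" "\<theta> * c2 \<le> d2" "\<theta> * c3 \<le> d2"
      using f(2)[OF c(1)] f(2)[OF c(2)] f(2)[OF c(3)] c by linarith+
    ultimately show thesis
      using that[of "n1 - \<theta> * c1" "n2 - \<theta> * c2" "n3 - \<theta> * c3" "\<theta> * c1" "\<theta> * c2" "\<theta> * c3"] c f(1) sum n by simp
  qed
qed

context three_points
begin

text \<open>
  With the multiplicities split as above, \<open>a\<^sub>i\<close> is the coefficient of \<open>H\<^sub>1 - E\<^sub>i\<close>, and \<open>d\<^sub>2 - r\<^sub>k\<close> that of
  \<open>H\<^sub>2 - E\<^sub>i - E\<^sub>j\<close>, where \<open>k\<close> is the third index: the coefficients involving \<open>i\<close> add up to \<open>2 d\<^sub>2 - r\<^sub>j - r\<^sub>k = r\<^sub>i\<close>. What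
  remains is a nonnegative combination of \<open>H\<^sub>1 = (H\<^sub>1 - E\<^sub>1) + E\<^sub>1\<close> and the \<open>E\<^sub>i\<close>.
\<close>
lemma polyhedron_subset_gens:
  assumes b: "bounds d1 d2 m" shows "cls d1 d2 m \<in> convex_cone hull gens"
proof -
  let ?C = "convex_cone hull gens"
  note C = convex_cone_convex_cone_hull[of gens]
  define e1 e2 e3 h1' h2' where e: "e1 = formal (E 1)" "e2 = formal (E 2)" "e3 = formal (E 3)"
    "h1' = formal H1" "h2' = formal H2"
  have Eg: "formal (E i) \<in> gens" and H1g: "formal H1 - formal (E i) \<in> gens"
    and H2g: "i \<noteq> j \<Longrightarrow> formal H2 - formal (E i) - formal (E j) \<in> gens" for i j
    unfolding gens_def by blast+
  have g: "e1 \<in> ?C" "e2 \<in> ?C" "e3 \<in> ?C" "h1' - e1 \<in> ?C" "h1' - e2 \<in> ?C" "h1' - e3 \<in> ?C"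
    "h2' - e1 - e2 \<in> ?C" "h2' - e1 - e3 \<in> ?C" "h2' - e2 - e3 \<in> ?C"
    unfolding e using Eg H1g H2g three_ne by (auto intro!: hull_inc)
  have h1: "h1' \<in> ?C" using convex_cone_add[OF C g(4) g(1)] by simp
  obtain a1 a2 a3 r1 r2 r3 where r: "0 \<le> a1" "0 \<le> a2" "0 \<le> a3" "a1 + a2 + a3 \<le> d1"
    "0 \<le> r1" "0 \<le> r2" "0 \<le> r3" "r1 \<le> d2" "r2 \<le> d2" "r3 \<le> d2" "r1 + r2 + r3 = 2 * d2"
    "m 1 \<le> a1 + r1" "m 2 \<le> a2 + r2" "m 3 \<le> a3 + r3"
    by (rule split_multiplicities[of d1 d2 "m 1" "m 2" "m 3"])
      (use b three_ne in \<open>auto simp: bounds_def sum_3\<close>)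
  let ?v = "a1 *\<^sub>R (h1' - e1) + a2 *\<^sub>R (h1' - e2) + a3 *\<^sub>R (h1' - e3) + (d1 - (a1 + a2 + a3)) *\<^sub>R h1' +
    (d2 - r3) *\<^sub>R (h2' - e1 - e2) + (d2 - r2) *\<^sub>R (h2' - e1 - e3) + (d2 - r1) *\<^sub>R (h2' - e2 - e3) +
    (a1 + r1 - m 1) *\<^sub>R e1 + (a2 + r2 - m 2) *\<^sub>R e2 + (a3 + r3 - m 3) *\<^sub>R e3"
  have "?v \<in> ?C"
    using r by (intro convex_cone_add[OF C] convex_cone_scaleR[OF C] g h1) simp_all
  moreover have "cls d1 d2 m = ?v"
  proof -
    have r3: "r3 = d2 + d2 - r1 - r2" using r(11) by simp
    show ?thesis unfolding cls_def sum_3 e[symmetric] r3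
      by (simp add: algebra_simps) (simp only: mult_2 mult_2_right scaleR_add_left)
  qed
  ultimately show ?thesis by simp
qed

theorem effective_cone:
  assumes det: "det3 (snd (pt 1)) (snd (pt 2)) (snd (pt 3)) \<noteq> 0"
  shows "Eff X = num_cone X gens" "Eff X = {num_class X (cls d1 d2 m) | d1 d2 m. bounds d1 d2 m}"
proof -
  have 1: "Eff X \<subseteq> {num_class X (cls d1 d2 m) | d1 d2 m. bounds d1 d2 m}"
  proof
    fix c assume "c \<in> Eff X"
    then obtain v where v: "v \<in> convex_cone hull effs" "c = num_class X v" unfolding Eff_def num_cone_def by blast
    then obtain d1 d2 m where "bounds d1 d2 m" "v \<sim> cls d1 d2 m" using effs_subset_polyhedron[OF det] by blast
    then show "c \<in> {num_class X (cls d1 d2 m) | d1 d2 m. bounds d1 d2 m}"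
      unfolding v(2) num_class_eq_iff[symmetric] by blast
  qed
  have 2: "{num_class X (cls d1 d2 m) | d1 d2 m. bounds d1 d2 m} \<subseteq> num_cone X gens"
    unfolding num_cone_def using polyhedron_subset_gens by blast
  have 3: "num_cone X gens \<subseteq> Eff X"
  proof
    fix c assume "c \<in> num_cone X gens"
    then obtain v where v: "v \<in> convex_cone hull gens" "c = num_class X v" unfolding num_cone_def by blast
    then obtain w where "w \<in> convex_cone hull effs" "v \<sim> w" using gens_effective by blast
    then show "c \<in> Eff X" unfolding v(2) Eff_def num_cone_def using num_class_eq_iff by blast
  qed
  show "Eff X = num_cone X gens" "Eff X = {num_class X (cls d1 d2 m) | d1 d2 m. bounds d1 d2 m}"
    using 1 2 3 by blast+
qed

end

section \<open>General position\<close>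

text \<open>Zero iff the two points have the same image in the projective line. The product with \<open>- 1\<close> replaces
  a subtraction because the rules for polynomials mention sums and products only.\<close>
definition minor :: "triple \<Rightarrow> 3 \<Rightarrow> 3 \<Rightarrow> complex" where
  "minor c i j = fst (c i) $ 1 * fst (c j) $ 2 + (- 1) * (fst (c i) $ 2 * fst (c j) $ 1)"

definition plane_det :: "triple \<Rightarrow> complex" where
  "plane_det c = det (\<chi> i. snd (c i))"

text \<open>
  Its zeros are the triples in special position: a point outside the affine chart, two points with the
  same image in the projective line, or three points with collinear images in the plane.
\<close>
definition special :: "triple \<Rightarrow> complex" where
  "special c = (fst (c 1) $ 1 * (fst (c 2) $ 1 * fst (c 3) $ 1)) * ((snd (c 1) $ 1 * (snd (c 2) $ 1 * snd (c 3) $ 1)) *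
     ((minor c 1 2 * (minor c 1 3 * minor c 2 3)) * plane_det c))"

lemma plane_det_expand:
  "plane_det c =
    snd (c 1) $ 1 * (snd (c 2) $ 2 * snd (c 3) $ 3) + (snd (c 1) $ 2 * (snd (c 2) $ 3 * snd (c 3) $ 1) +
    (snd (c 1) $ 3 * (snd (c 2) $ 1 * snd (c 3) $ 2) + (- 1) * (snd (c 1) $ 1 * (snd (c 2) $ 3 * snd (c 3) $ 2) +
    (snd (c 1) $ 2 * (snd (c 2) $ 1 * snd (c 3) $ 3) + snd (c 1) $ 3 * (snd (c 2) $ 2 * snd (c 3) $ 1)))))"
  unfolding plane_det_def det_3 by (simp add: algebra_simps)

lemma special_polynomial: "special \<in> polynomials"
  unfolding special_def[abs_def] minor_def plane_det_expand by (intro polynomials.intros)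

lemma special_multihomogeneous: "multihomogeneous special"
  unfolding multihomogeneous_def
proof (rule exI[of _ "\<lambda>_. 3"], rule exI[of _ "\<lambda>_. 2"], intro allI)
  fix c :: triple and l m :: "3 \<Rightarrow> complex"
  let ?c = "\<lambda>i. (l i *s fst (c i), m i *s snd (c i))"
  have 1: "minor ?c i j = l i * l j * minor c i j" for i j
    by (simp add: minor_def algebra_simps)
  have 2: "plane_det ?c = m 1 * m 2 * m 3 * plane_det c"
    unfolding plane_det_expand by (simp add: algebra_simps)
  show "special ?c = (\<Prod>i\<in>UNIV. l i ^ 3 * m i ^ 2) * special c"
    unfolding special_def 1 2 UNIV_3 using three_ne by (simp add: power2_eq_square power3_eq_cube mult_ac)
qed

lemma special_eq_0_iff:
  "special c = 0 \<longleftrightarrow> (\<exists>i. fst (c i) $ 1 = 0) \<or> (\<exists>i. snd (c i) $ 1 = 0) \<or> (\<exists>i j. i \<noteq> j \<and> minor c i j = 0) \<or> plane_det c = 0"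
proof -
  have sym: "minor c i j = 0 \<longleftrightarrow> minor c j i = 0" for i j by (auto simp: minor_def algebra_simps)
  have "(\<exists>i j. i \<noteq> j \<and> minor c i j = 0) \<longleftrightarrow> minor c 1 2 = 0 \<or> minor c 1 3 = 0 \<or> minor c 2 3 = 0"
    using exhaust_3 sym three_ne by metis
  moreover have "(\<exists>i. P i) \<longleftrightarrow> P 1 \<or> P 2 \<or> P 3" for P :: "3 \<Rightarrow> bool" using exhaust_3 by metis
  ultimately show ?thesis unfolding special_def by simp
qed

lemma special_permute:
  assumes \<sigma>: "bij \<sigma>" and c: "special c = 0" shows "special (c \<circ> \<sigma>) = 0"
proof -
  have surj: "\<exists>j. i = \<sigma> j" for i using \<sigma> by (metis bij_pointE)
  have "\<sigma> permutes UNIV" using \<sigma> by (simp add: permutes_def bij_iff)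
  then have "plane_det (c \<circ> \<sigma>) = of_int (sign \<sigma>) * plane_det c"
    using det_permute_rows[of \<sigma> "\<chi> i. snd (c i)"] by (simp add: plane_det_def)
  moreover have "minor (c \<circ> \<sigma>) i j = minor c (\<sigma> i) (\<sigma> j)" for i j by (simp add: minor_def)
  ultimately show ?thesis
    using c surj unfolding special_eq_0_iff comp_def by (metis mult_zero_right)
qed

definition affine_point :: "triple \<Rightarrow> 3 \<Rightarrow> point" where
  "affine_point c i = (fst (c i) $ 2 / fst (c i) $ 1, snd (c i) $ 2 / snd (c i) $ 1, snd (c i) $ 3 / snd (c i) $ 1)"

lemma affine_point_general:
  assumes "special c \<noteq> 0"
  shows "three_points (affine_point c)"
    and "det3 (snd (affine_point c 1)) (snd (affine_point c 2)) (snd (affine_point c 3)) \<noteq> 0"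
    and "closed_point (c i) = point_ring (affine_point c i)"
proof -
  have a: "fst (c i) $ 1 \<noteq> 0" and b: "snd (c i) $ 1 \<noteq> 0" and ij: "i \<noteq> j \<Longrightarrow> minor c i j \<noteq> 0"
    and d: "plane_det c \<noteq> 0" for i j
    using assms special_eq_0_iff by blast+
  show "three_points (affine_point c)"
  proof
    fix i j :: 3 assume "i \<noteq> j"
    then show "fst (affine_point c i) \<noteq> fst (affine_point c j)"
      using ij[of i j] a[of i] a[of j] by (auto simp: minor_def affine_point_def field_simps)
  qed
  show "closed_point (c i) = point_ring (affine_point c i)"
    unfolding affine_point_def by (rule closed_point_eq_point_ring[OF a b])
  have "plane_det c = snd (c 1) $ 1 * snd (c 2) $ 1 * snd (c 3) $ 1 *
      det3 (snd (affine_point c 1)) (snd (affine_point c 2)) (snd (affine_point c 3))"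
    unfolding plane_det_expand det3_def affine_point_def using b[of 1] b[of 2] b[of 3]
    by (simp add: field_simps)
  then show "det3 (snd (affine_point c 1)) (snd (affine_point c 2)) (snd (affine_point c 3)) \<noteq> 0"
    using d by auto
qed

lemma special_nonzero_triple: "\<exists>c\<in>triples. special c \<noteq> 0"
proof -
  define c :: triple where "c i = (if i = 1 then (vector [1, 0], vector [1, 0, 0])
    else if i = 2 then (vector [1, 1], vector [1, 1, 0]) else (vector [1, 2], vector [1, 0, 1]))" for i
  have c: "c 1 = (vector [1, 0], vector [1, 0, 0])" "c 2 = (vector [1, 1], vector [1, 1, 0])"
    "c 3 = (vector [1, 2], vector [1, 0, 1])"
    using three_ne by (simp_all add: c_def)
  have 1: "fst (c i) $ 1 = 1" "snd (c i) $ 1 = 1" for i using exhaust_3[of i] by (auto simp: c)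
  have "fst (c i) \<noteq> 0" "snd (c i) \<noteq> 0" for i using 1[of i] by (metis zero_index zero_neq_one)+
  then have "c \<in> triples" unfolding triples_def by simp
  moreover have "special c \<noteq> 0"
    by (simp add: special_def minor_def plane_det_expand c)
  ultimately show ?thesis by blast
qed

theorem theorem3p4:
  shows "holds_in_general_position (\<lambda>c.
    let X = blowup P1xP2 (range (\<lambda>i. closed_point (c i)));
        H1 = formal (hyperplane_divisor X P1_coords);
        H2 = formal (hyperplane_divisor X P2_coords);
        E = (\<lambda>i :: 3. formal (exceptional_divisor X (closed_point (c i))))
    in
      Eff X = num_cone X
        ({E i | i. True} \<union> {H1 - E i | i. True} \<union> {H2 - E i - E j | i j. i \<noteq> j})
      \<and>
      Eff X = {num_class X (d1 *\<^sub>R H1 + d2 *\<^sub>R H2 - (\<Sum>i\<in>UNIV. m i *\<^sub>R E i)) | d1 d2 m.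
        0 \<le> d1 \<and> 0 \<le> d2 \<and> (\<forall>i. m i \<le> d1 + d2) \<and>
        (\<forall>i j. i \<noteq> j \<longrightarrow> m i + m j \<le> d1 + 2 * d2) \<and>
        (\<Sum>i\<in>UNIV. m i) \<le> d1 + 2 * d2})"
proof -
  let ?Z = "{c \<in> triples. special c = 0}"
  have closed: "zariski_closed ?Z"
    unfolding zariski_closed_def using special_polynomial special_multihomogeneous
    by (intro exI[of _ "{special}"]) auto
  have proper: "?Z \<noteq> triples" using special_nonzero_triple by blast
  have perm: "c \<circ> \<sigma> \<in> ?Z" if "c \<in> ?Z" "bij \<sigma>" for c \<sigma>
    using that special_permute by (auto simp: triples_def)
  show ?thesis
    unfolding holds_in_general_position_def
  proof (rule exI[of _ ?Z], intro conjI ballI allI impI closed proper)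
    show "c \<circ> \<sigma> \<in> ?Z" if "c \<in> ?Z" "bij \<sigma>" for c \<sigma> by (rule perm[OF that])
    fix c assume "c \<in> triples - ?Z" "pairwise_distinct c"
    then have c: "special c \<noteq> 0" by blast
    note G = affine_point_general[OF c]
    interpret P: three_points "affine_point c" by (rule G(1))
    note cone = P.effective_cone[OF G(2), unfolded P.gens_def P.cls_def P.bounds_def P.H1_def P.H2_def P.E_def]
    show "let X = blowup P1xP2 (range (\<lambda>i. closed_point (c i)));
        H1 = formal (hyperplane_divisor X P1_coords);
        H2 = formal (hyperplane_divisor X P2_coords);
        E = (\<lambda>i :: 3. formal (exceptional_divisor X (closed_point (c i))))
    in
      Eff X = num_cone X
        ({E i | i. True} \<union> {H1 - E i | i. True} \<union> {H2 - E i - E j | i j. i \<noteq> j})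
      \<and>
      Eff X = {num_class X (d1 *\<^sub>R H1 + d2 *\<^sub>R H2 - (\<Sum>i\<in>UNIV. m i *\<^sub>R E i)) | d1 d2 m.
        0 \<le> d1 \<and> 0 \<le> d2 \<and> (\<forall>i. m i \<le> d1 + d2) \<and>
        (\<forall>i j. i \<noteq> j \<longrightarrow> m i + m j \<le> d1 + 2 * d2) \<and>
        (\<Sum>i\<in>UNIV. m i) \<le> d1 + 2 * d2}"
      unfolding Let_def G(3) P.X_def[symmetric] using cone by (intro conjI)
  qed
qed

end
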